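(* Let $G=1+\mathfrak g$ be a pattern subgroup of $UT_n(\mathbb F_{q^k})$, $q$ a power of an odd prime, with $\mathfrak g$ viewed as an $\mathbb F_q$-algebra, and let $\dagger$ be an anti-involution of $\mathfrak g$ with $(\alpha e_{ij})^\dagger\in\mathbb F_{q^k}^\times e_{\bar j\bar i}$ for all $\alpha\in\mathbb F_{q^k}^\times$ and all $e_{ij}\in\mathfrak g$. Let $U=\{u\in G\mid u^\dagger=u^{-1}\}$ and $\mathfrak u=\{x\in\mathfrak g\mid x^\dagger=-x\}$. Let $f$ be any Springer morphism and $\theta:\mathbb F_q^+\to\mathbb C^\times$ a nontrivial homomorphism. For $u\in U$ and $\lambda\in\mathfrak u^*$ define $$K_u=\{v\in U\mid f(v)\in G\cdot f(u)\},\qquad \chi_\lambda=\frac{|H\cdot\lambda|}{|G\cdot\lambda|}\sum_{\mu\in G\cdot\lambda}\theta\circ\mu\circ f .$$ Then: (a) The functions $\chi_\lambda$ ($\lambda\in\mathfrak u^*$) are characters of $U$. (b) The partition $\mathcal K=\{K_u\mid u\in U\}$ of $U$, along with the set of characters $\{\chi_\lambda\mid\lambda\in\mathfrak u^*\}$, form a supercharacter theory of $U$. Moreover this supercharacter theory is independent of the choice of $\theta$ and $f$, in the sense that the sets $\mathcal K$ and $\{\chi_\lambda\mid\lambda\in\mathfrak u^*\}$ do not depend on $\theta$ or $f$.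
   Context: Notation: $[n]=\{1,\dots,n\}$, $\bar i=n+1-i$ for $i\in[n]$; $UT_n(\mathbb F)$ is the group of upper triangular $n\times n$ matrices over $\mathbb F$ with ones on the diagonal; $e_{ij}$ are the elementary matrices. Pattern subgroups: for a partial order $\preceq$ on $[n]$ such that $i\preceq j$ implies $i\le j$, the associated pattern subalgebra $\mathfrak g$ consists of the strictly upper triangular matrices $x$ over the field with $x_{ij}=0$ unless $i\prec j$; the pattern subgroup is $G=1+\mathfrak g$. Anti-involution: an $\mathbb F_q$-linear bijection $\dagger:\mathfrak g\to\mathfrak g$ with $(xy)^\dagger=y^\dagger x^\dagger$ and $(x^\dagger)^\dagger=x$; extend it to $G$ by $(1+x)^\dagger=1+x^\dagger$. Actions: $G$ acts on $\mathfrak u$ by $g\cdot x=gxg^\dagger$ and on the $\mathbb F_q$-dual $\mathfrak u^*$ by $(g\cdot\lambda)(x)=\lambda(g^{-1}\cdot x)$; $G\cdot x$, $G\cdot\lambda$ denote orbits. $\mathfrak h=\{x\in\mathfrak g\mid x_{ij}=0\text{ if }j\le n/2\}$, a two-sided ideal of $\mathfrak g$, and $H=1+\mathfrak h$, a normal subgroup of $G$; $H\cdot\lambda$ is the $H$-orbit of $\lambda$. Springer morphism: a bijection $f:G\to\mathfrak g$ such that $f(U)=\mathfrak u$ and there exist $a_i\in\mathbb F_q$ with $f(1+x)=x+\sum_{i\ge2}a_ix^i$ for all $x\in\mathfrak g$. Supercharacter theory of a finite group $U$: a pair $(\mathcal K,\mathcal X)$ with $\mathcal K$ a partition of $U$ into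 unions of conjugacy classes and $\mathcal X$ a set of characters of $U$ such that (1) $|\mathcal X|=|\mathcal K|$; (2) each $\chi\in\mathcal X$ is constant on each member of $\mathcal K$; (3) each irreducible character of $U$ is a constituent of exactly one character in $\mathcal X$. *)

theory Defs
  imports
    "Jordan_Normal_Form.VS_Connect"
    "HOL-Algebra.Group_Action"
    "HOL-Algebra.Subrings"
    "HOL-Library.Disjoint_Sets"
begin

section \<open>Characters and supercharacter theories of finite groups\<close>

text \<open>
  Functions on a group \<open>G\<close> are represented by HOL functions that are \<open>undefined\<close> outside the
  carrier, so that equality and cardinality of sets of such functions have their usual meaning.
\<close>

definition mat_trace :: "complex mat \<Rightarrow> complex" where
  "mat_trace A = (\<Sum>i<dim_row A. A $$ (i, i))"

definition representation ::
    "('g, 'm) monoid_scheme \<Rightarrow> nat \<Rightarrow> ('g \<Rightarrow> complex mat) \<Rightarrow> bool" where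
  "representation G d \<rho> \<longleftrightarrow> 0 < d \<and> \<rho> \<in> hom G (units_of (ring_mat TYPE(complex) d ()))"

definition irreducible_representation ::
    "('g, 'm) monoid_scheme \<Rightarrow> nat \<Rightarrow> ('g \<Rightarrow> complex mat) \<Rightarrow> bool" where
  "irreducible_representation G d \<rho> \<longleftrightarrow> representation G d \<rho> \<and>
     (\<forall>W. VectorSpace.subspace class_ring W (module_vec TYPE(complex) d) \<and>
           (\<forall>g\<in>carrier G. \<forall>w\<in>W. \<rho> g *\<^sub>v w \<in> W)
        \<longrightarrow> W = {0\<^sub>v d} \<or> W = carrier_vec d)"

definition afforded_character ::
    "('g, 'm) monoid_scheme \<Rightarrow> ('g \<Rightarrow> complex mat) \<Rightarrow> 'g \<Rightarrow> complex" where
  "afforded_character G \<rho> = (\<lambda>g\<in>carrier G. mat_trace (\<rho> g))"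

definition is_character :: "('g, 'm) monoid_scheme \<Rightarrow> ('g \<Rightarrow> complex) \<Rightarrow> bool" where
  "is_character G \<chi> \<longleftrightarrow> (\<exists>d \<rho>. representation G d \<rho> \<and> \<chi> = afforded_character G \<rho>)"

definition is_irreducible_character ::
    "('g, 'm) monoid_scheme \<Rightarrow> ('g \<Rightarrow> complex) \<Rightarrow> bool" where
  "is_irreducible_character G \<psi> \<longleftrightarrow>
     (\<exists>d \<rho>. irreducible_representation G d \<rho> \<and> \<psi> = afforded_character G \<rho>)"

text \<open>\<open>\<psi>\<close> is a constituent of \<open>\<chi>\<close> if \<open>\<chi> - \<psi>\<close> is a character or zero.\<close>

definition constituent ::
    "('g, 'm) monoid_scheme \<Rightarrow> ('g \<Rightarrow> complex) \<Rightarrow> ('g \<Rightarrow> complex) \<Rightarrow> bool" where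
  "constituent G \<psi> \<chi> \<longleftrightarrow>
     \<chi> = \<psi> \<or> (\<exists>\<phi>. is_character G \<phi> \<and> \<chi> = (\<lambda>g\<in>carrier G. \<psi> g + \<phi> g))"

definition conjugacy_class :: "('g, 'm) monoid_scheme \<Rightarrow> 'g \<Rightarrow> 'g set" where
  "conjugacy_class G = orbit G (\<lambda>g x. g \<otimes>\<^bsub>G\<^esub> x \<otimes>\<^bsub>G\<^esub> inv\<^bsub>G\<^esub> g)"

definition supercharacter_theory ::
    "('g, 'm) monoid_scheme \<Rightarrow> 'g set set \<Rightarrow> ('g \<Rightarrow> complex) set \<Rightarrow> bool" where
  "supercharacter_theory G \<K> \<X> \<longleftrightarrow>
     group G \<and> finite (carrier G) \<and>
     partition_on (carrier G) \<K> \<and>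
     (\<forall>K\<in>\<K>. \<exists>S \<subseteq> conjugacy_class G ` carrier G. K = \<Union>S) \<and>
     finite \<X> \<and> (\<forall>\<chi>\<in>\<X>. is_character G \<chi>) \<and>
     card \<X> = card \<K> \<and>
     (\<forall>\<chi>\<in>\<X>. \<forall>K\<in>\<K>. \<forall>x\<in>K. \<forall>y\<in>K. \<chi> x = \<chi> y) \<and>
     (\<forall>\<psi>. is_irreducible_character G \<psi> \<longrightarrow> (\<exists>!\<chi>. \<chi> \<in> \<X> \<and> constituent G \<psi> \<chi>))"

section \<open>Pattern groups and anti-involutions\<close>

text \<open>
  Matrix indices are zero-based: the row or column \<open>i + 1 \<in> [n]\<close> is the index \<open>i < n\<close>. Hence
  the reversal of \<open>[n]\<close> becomes \<open>i \<mapsto> n - 1 - i\<close>.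
\<close>

definition pattern_order :: "nat \<Rightarrow> nat rel \<Rightarrow> bool" where
  "pattern_order n r \<longleftrightarrow> partial_order_on {..<n} r \<and> (\<forall>(i, j)\<in>r. i \<le> j)"

definition pattern_algebra :: "nat \<Rightarrow> nat rel \<Rightarrow> 'a::field mat set" where
  "pattern_algebra n r =
     {x \<in> carrier_mat n n. \<forall>i<n. \<forall>j<n. x $$ (i, j) \<noteq> 0 \<longrightarrow> i < j \<and> (i, j) \<in> r}"

definition pattern_group :: "nat \<Rightarrow> nat rel \<Rightarrow> 'a::field mat monoid" where
  "pattern_group n r =
     \<lparr>carrier = (\<lambda>x. 1\<^sub>m n + x) ` pattern_algebra n r, mult = (*), one = 1\<^sub>m n\<rparr>"

definition elementary_mat :: "nat \<Rightarrow> nat \<Rightarrow> nat \<Rightarrow> 'a::field mat" where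
  "elementary_mat n i j = mat n n (\<lambda>(k, l). if k = i \<and> l = j then 1 else 0)"

definition anti_involution :: "'a::field set \<Rightarrow> 'a mat set \<Rightarrow> ('a mat \<Rightarrow> 'a mat) \<Rightarrow> bool" where
  "anti_involution F A dag \<longleftrightarrow>
     bij_betw dag A A \<and>
     (\<forall>x\<in>A. \<forall>y\<in>A. dag (x + y) = dag x + dag y) \<and>
     (\<forall>c\<in>F. \<forall>x\<in>A. dag (c \<cdot>\<^sub>m x) = c \<cdot>\<^sub>m dag x) \<and>
     (\<forall>x\<in>A. \<forall>y\<in>A. dag (x * y) = dag y * dag x) \<and>
     (\<forall>x\<in>A. dag (dag x) = x)"

definition group_dag :: "nat \<Rightarrow> ('a::field mat \<Rightarrow> 'a mat) \<Rightarrow> 'a mat \<Rightarrow> 'a mat" where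
  "group_dag n dag g = 1\<^sub>m n + dag (g - 1\<^sub>m n)"

definition dag_group :: "nat \<Rightarrow> nat rel \<Rightarrow> ('a::field mat \<Rightarrow> 'a mat) \<Rightarrow> 'a mat monoid" where
  "dag_group n r dag = (pattern_group n r)
     \<lparr>carrier := {u \<in> carrier (pattern_group n r).
                    group_dag n dag u = inv\<^bsub>pattern_group n r\<^esub> u}\<rparr>"

definition dag_algebra :: "nat \<Rightarrow> nat rel \<Rightarrow> ('a::field mat \<Rightarrow> 'a mat) \<Rightarrow> 'a mat set" where
  "dag_algebra n r dag = {x \<in> pattern_algebra n r. dag x = - x}"

text \<open>In zero-based column indices, \<open>2 * (j + 1) \<le> n\<close> is the condition \<open>j \<le> n/2\<close> on \<open>[n]\<close>.\<close>

definition half_ideal :: "nat \<Rightarrow> nat rel \<Rightarrow> 'a::field mat set" where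
  "half_ideal n r =
     {x \<in> pattern_algebra n r. \<forall>i<n. \<forall>j<n. 2 * (j + 1) \<le> n \<longrightarrow> x $$ (i, j) = 0}"

definition half_group :: "nat \<Rightarrow> nat rel \<Rightarrow> 'a::field mat monoid" where
  "half_group n r = (pattern_group n r)\<lparr>carrier := (\<lambda>x. 1\<^sub>m n + x) ` half_ideal n r\<rparr>"

section \<open>Actions, Springer morphisms, superclasses and supercharacters\<close>

definition dag_act :: "nat \<Rightarrow> ('a::field mat \<Rightarrow> 'a mat) \<Rightarrow> 'a mat \<Rightarrow> 'a mat \<Rightarrow> 'a mat" where
  "dag_act n dag g x = g * x * group_dag n dag g"

definition mat_dual :: "'a::field set \<Rightarrow> 'a mat set \<Rightarrow> ('a mat \<Rightarrow> 'a) set" where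
  "mat_dual F V = {\<nu> \<in> V \<rightarrow>\<^sub>E F.
     (\<forall>x\<in>V. \<forall>y\<in>V. \<nu> (x + y) = \<nu> x + \<nu> y) \<and>
     (\<forall>c\<in>F. \<forall>x\<in>V. \<nu> (c \<cdot>\<^sub>m x) = c * \<nu> x)}"

definition dual_act ::
    "nat \<Rightarrow> nat rel \<Rightarrow> ('a::field mat \<Rightarrow> 'a mat) \<Rightarrow> 'a mat \<Rightarrow> ('a mat \<Rightarrow> 'a) \<Rightarrow> 'a mat \<Rightarrow> 'a" where
  "dual_act n r dag g \<nu> =
     (\<lambda>x\<in>dag_algebra n r dag. \<nu> (dag_act n dag (inv\<^bsub>pattern_group n r\<^esub> g) x))"

text \<open>
  Elements of \<open>pattern_algebra n r\<close> are strictly upper triangular, so their powers with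
  exponent at least \<open>n\<close> vanish and the sum below may stop at \<open>n\<close>.
\<close>

definition springer_morphism ::
    "'a::field set \<Rightarrow> nat \<Rightarrow> nat rel \<Rightarrow> ('a mat \<Rightarrow> 'a mat) \<Rightarrow> ('a mat \<Rightarrow> 'a mat) \<Rightarrow> bool" where
  "springer_morphism F n r dag f \<longleftrightarrow>
     bij_betw f (carrier (pattern_group n r)) (pattern_algebra n r) \<and>
     f ` carrier (dag_group n r dag) = dag_algebra n r dag \<and>
     (\<exists>a :: nat \<Rightarrow> 'a. (\<forall>k\<ge>2. a k \<in> F) \<and>
        (\<forall>x\<in>pattern_algebra n r.
           f (1\<^sub>m n + x) = x + mat n n (\<lambda>(i, j). \<Sum>k=2..n. a k * (x ^\<^sub>m k) $$ (i, j))))"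

definition nontrivial_additive_character :: "'a::field set \<Rightarrow> ('a \<Rightarrow> complex) \<Rightarrow> bool" where
  "nontrivial_additive_character F \<theta> \<longleftrightarrow>
     \<theta> \<in> hom (add_monoid (class_ring\<lparr>carrier := F\<rparr>)) (units_of (class_ring :: complex ring)) \<and>
     (\<exists>x\<in>F. \<theta> x \<noteq> 1)"

definition superclass ::
    "nat \<Rightarrow> nat rel \<Rightarrow> ('a::field mat \<Rightarrow> 'a mat) \<Rightarrow> ('a mat \<Rightarrow> 'a mat) \<Rightarrow> 'a mat \<Rightarrow> 'a mat set" where
  "superclass n r dag f u =
     {v \<in> carrier (dag_group n r dag). f v \<in> orbit (pattern_group n r) (dag_act n dag) (f u)}"

definition supercharacter ::
    "nat \<Rightarrow> nat rel \<Rightarrow> ('a::field mat \<Rightarrow> 'a mat) \<Rightarrow> ('a mat \<Rightarrow> 'a mat) \<Rightarrow> ('a \<Rightarrow> complex)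
      \<Rightarrow> ('a mat \<Rightarrow> 'a) \<Rightarrow> 'a mat \<Rightarrow> complex" where
  "supercharacter n r dag f \<theta> \<nu> =
     (\<lambda>u\<in>carrier (dag_group n r dag).
        of_nat (card (orbit (half_group n r) (dual_act n r dag) \<nu>)) /
        of_nat (card (orbit (pattern_group n r) (dual_act n r dag) \<nu>)) *
        (\<Sum>\<mu>\<in>orbit (pattern_group n r) (dual_act n r dag) \<nu>. \<theta> (\<mu> (f u))))"

definition superclasses ::
    "nat \<Rightarrow> nat rel \<Rightarrow> ('a::field mat \<Rightarrow> 'a mat) \<Rightarrow> ('a mat \<Rightarrow> 'a mat) \<Rightarrow> 'a mat set set" where
  "superclasses n r dag f = superclass n r dag f ` carrier (dag_group n r dag)"

definition supercharacters ::
    "'a::field set \<Rightarrow> nat \<Rightarrow> nat rel \<Rightarrow> ('a mat \<Rightarrow> 'a mat) \<Rightarrow> ('a mat \<Rightarrow> 'a mat) \<Rightarrow> ('a \<Rightarrow> complex)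
      \<Rightarrow> ('a mat \<Rightarrow> complex) set" where
  "supercharacters F n r dag f \<theta> =
     supercharacter n r dag f \<theta> ` mat_dual F (dag_algebra n r dag)"

end

theory Submission
  imports Defs "Jordan_Normal_Form.Spectral_Radius"
begin

text \<open>
  For \<open>v\<close> in \<open>U\<close> let \<open>c v\<close> be half of \<open>v - v\<inverse>\<close>. For every Springer morphism \<open>f\<close> there is \<open>s\<close> in \<open>G\<close>
  such that \<open>f v = s * c v * s\<^sup>\<dagger>\<close>. Hence \<open>f\<close> may be replaced by \<open>c\<close> in the superclasses and
  supercharacters, which gives the independence of \<open>f\<close>. The \<open>H\<close>-orbit of a functional \<open>\<nu>\<close> is an affine
  subspace, so the sum of \<open>\<theta> \<circ> \<mu>\<close> over \<open>\<mu>\<close> in this orbit is supported on a left ideal \<open>J\<close>. The set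
  \<open>L = {v \<in> U. v - 1 \<in> J}\<close> is a subgroup, and \<open>v \<mapsto> \<theta> (\<nu> (c v))\<close> is a linear character of it. Since
  \<open>G = H U\<close>, the supercharacter of \<open>\<nu>\<close> is induced from this linear character. By Fourier analysis on the
  space of skew elements, the supercharacters of distinct orbits are orthogonal and a positive
  combination of all supercharacters is a multiple of the regular character; by Burnside's lemma there are
  as many orbits of functionals as of skew elements.
\<close>

section \<open>Characters as traces of commuting idempotents\<close>

text \<open>What singles out \<open>c\<close> is that it is affine in \<open>v\<close>: on
  \<open>U\<close> the inverse of \<open>v\<close> is its image under the anti-involution, so
  \<open>c v\<close> is half of \<open>x - dag x\<close> with \<open>x = v - 1\<close>. A functional
  of \<open>c v\<close> is therefore additive in \<open>x\<close>, and multiplicativity on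
  \<open>L\<close> reduces to the vanishing of one quadratic term \<open>x * y\<close>. No logarithm
  is involved; dividing by 2 suffices. Moreover \<open>c\<close> visibly turns inversion into
  negation. The Springer morphism \<open>f\<close> supplies what is never proved for
  \<open>c\<close>: a bijection from \<open>U\<close> to the skew elements, which carries sums over
  the group to sums over a vector space. The half ideal is adapted to this: a product
  \<open>a * x * dag a\<close> with \<open>a\<close> in it vanishes, which makes the action of
  \<open>H\<close> on skew elements affine, while the ideal is still large enough for
  \<open>G = H U\<close>. Constituents are defined by subtraction of characters, so a nonzero value
  of the bilinear form must be turned into an explicit complementary representation; this is why the
  general character theory is built on idempotents.\<close>

lemma idempotent_rank_factorization:
  fixes P :: "'i \<Rightarrow> 'i \<Rightarrow> complex"
  assumes fin: "finite I"
    and idem: "\<And>i j. i \<in> I \<Longrightarrow> j \<in> I \<Longrightarrow> (\<Sum>k\<in>I. P i k * P k j) = P i j"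
  obtains K A B where "K \<subseteq> I"
    and "\<And>i j. i \<in> I \<Longrightarrow> j \<in> I \<Longrightarrow> P i j = (\<Sum>k\<in>K. A i k * B k j)"
    and "\<And>k l. k \<in> K \<Longrightarrow> l \<in> K \<Longrightarrow> (\<Sum>i\<in>I. B k i * A i l) = of_bool (k = l)"
proof -
  \<comment> \<open>Among all factorizations \<open>P = A B\<close> through an index set inside
    \<open>I\<close>, one of least size is taken. Minimality forces \<open>A\<close> to be injective
    and \<open>B\<close> to be surjective, so they can be cancelled from
    \<open>P P = P\<close>.\<close>
  define fac where "fac K \<longleftrightarrow> K \<subseteq> I \<and>
    (\<exists>A B. \<forall>i\<in>I. \<forall>j\<in>I. P i j = (\<Sum>k\<in>K. A i k * B k j))" for K
  have "fac I"
    unfolding fac_def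
    by (intro conjI exI[of _ P] exI[of _ "\<lambda>k j. of_bool (k = j)"])
      (use fin in \<open>simp_all add: of_bool_def if_distrib cong: if_cong\<close>)
  then obtain K where K: "fac K" and min: "\<And>K'. fac K' \<Longrightarrow> card K \<le> card K'"
    using ex_has_least_nat[of fac I card] by auto
  from K obtain A B where KI: "K \<subseteq> I"
    and AB: "\<And>i j. i \<in> I \<Longrightarrow> j \<in> I \<Longrightarrow> P i j = (\<Sum>k\<in>K. A i k * B k j)"
    unfolding fac_def by blast
  have finK: "finite K" using KI fin finite_subset by blast
  have smaller: False if m: "m \<in> K"
    and A'B': "\<And>i j. i \<in> I \<Longrightarrow> j \<in> I \<Longrightarrow> P i j = (\<Sum>k\<in>K - {m}. A' i k * B' k j)" for m A' B'
  proof -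
    have "fac (K - {m})" using KI A'B' unfolding fac_def by blast
    from min[OF this] m finK show False
      by (metis card_Diff1_less linorder_not_le)
  qed
  have A_inj: "w m = 0"
    if w: "\<And>i. i \<in> I \<Longrightarrow> (\<Sum>k\<in>K. A i k * w k) = 0" and m: "m \<in> K" for w m
  proof (rule ccontr)
    assume w0: "w m \<noteq> 0"
    \<comment> \<open>A relation among the columns of \<open>A\<close> with nonzero coefficient at
      \<open>m\<close> expresses column \<open>m\<close> by the others; substituting it removes
      \<open>m\<close> from the factorization.\<close>
    show False
    proof (rule smaller[OF m, of A "\<lambda>k j. B k j - w k / w m * B m j"])
      fix i j assume i: "i \<in> I" and j: "j \<in> I"
      have "A i m * w m = - (\<Sum>k\<in>K - {m}. A i k * w k)"
        using w[OF i] by (simp add: sum.remove[OF finK m] add_eq_0_iff)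
      then have Am: "A i m = - (\<Sum>k\<in>K - {m}. A i k * w k) / w m"
        using w0 by (simp add: field_simps)
      have "(\<Sum>k\<in>K - {m}. A i k * (B k j - w k / w m * B m j)) =
        (\<Sum>k\<in>K - {m}. A i k * B k j) - (\<Sum>k\<in>K - {m}. A i k * w k) / w m * B m j"
        by (simp add: right_diff_distrib sum_subtractf sum_distrib_right sum_divide_distrib mult.assoc)
      also have "\<dots> = P i j"
        using Am by (simp add: AB[OF i j] sum.remove[OF finK m])
      finally show "P i j = (\<Sum>k\<in>K - {m}. A i k * (B k j - w k / w m * B m j))" ..
    qed
  qed
  have B_surj: "w m = 0"
    if w: "\<And>j. j \<in> I \<Longrightarrow> (\<Sum>k\<in>K. w k * B k j) = 0" and m: "m \<in> K" for w m
  proof (rule ccontr)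
    assume w0: "w m \<noteq> 0"
    show False
    proof (rule smaller[OF m, of "\<lambda>i k. A i k - A i m * w k / w m" B])
      fix i j assume i: "i \<in> I" and j: "j \<in> I"
      have "w m * B m j = - (\<Sum>k\<in>K - {m}. w k * B k j)"
        using w[OF j] by (simp add: sum.remove[OF finK m] add_eq_0_iff)
      then have Bm: "B m j = - (\<Sum>k\<in>K - {m}. w k * B k j) / w m"
        using w0 by (simp add: field_simps)
      have "(\<Sum>k\<in>K - {m}. (A i k - A i m * w k / w m) * B k j) =
        (\<Sum>k\<in>K - {m}. A i k * B k j) - A i m * (\<Sum>k\<in>K - {m}. w k * B k j) / w m"
        by (simp add: left_diff_distrib sum_subtractf sum_distrib_left sum_divide_distrib mult.assoc)
      also have "\<dots> = P i j"
        using Bm by (simp add: AB[OF i j] sum.remove[OF finK m])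
      finally show "P i j = (\<Sum>k\<in>K - {m}. (A i k - A i m * w k / w m) * B k j)" ..
    qed
  qed
  have "(\<Sum>i\<in>I. B k i * A i l) = of_bool (k = l)" if k: "k \<in> K" and l: "l \<in> K" for k l
  proof -
    \<comment> \<open>\<open>C\<close> is \<open>B A - 1\<close>. Idempotence gives
      \<open>A C B = 0\<close>; injectivity of \<open>A\<close> and then surjectivity of
      \<open>B\<close> leave \<open>C = 0\<close>.\<close>
    define C where "C k l = (\<Sum>i\<in>I. B k i * A i l) - of_bool (k = l)" for k l
    have BAB: "(\<Sum>l\<in>K. C k l * B l j) = 0" if j: "j \<in> I" and k: "k \<in> K" for j k
    proof (rule A_inj[where w = "\<lambda>k. \<Sum>l\<in>K. C k l * B l j", OF _ k])
      fix i assume i: "i \<in> I"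
      have CB: "(\<Sum>l\<in>K. C k l * B l j) = (\<Sum>i'\<in>I. B k i' * P i' j) - B k j" if "k \<in> K" for k
      proof -
        have "(\<Sum>l\<in>K. C k l * B l j)
          = (\<Sum>l\<in>K. \<Sum>i'\<in>I. B k i' * A i' l * B l j) - (\<Sum>l\<in>K. of_bool (k = l) * B l j)"
          by (simp add: C_def left_diff_distrib sum_subtractf sum_distrib_right)
        also have "(\<Sum>l\<in>K. of_bool (k = l) * B l j) = B k j"
          using finK that by (simp add: of_bool_def if_distrib[of "\<lambda>x. x * _"] cong: if_cong)
        also have "(\<Sum>l\<in>K. \<Sum>i'\<in>I. B k i' * A i' l * B l j) = (\<Sum>i'\<in>I. B k i' * P i' j)"
          by (subst sum.swap) (use j in \<open>auto intro!: sum.cong simp: AB sum_distrib_left mult.assoc\<close>)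
        finally show ?thesis .
      qed
      have "(\<Sum>k\<in>K. A i k * (\<Sum>l\<in>K. C k l * B l j))
        = (\<Sum>k\<in>K. \<Sum>i'\<in>I. A i k * B k i' * P i' j) - (\<Sum>k\<in>K. A i k * B k j)"
        by (simp add: CB right_diff_distrib sum_subtractf sum_distrib_left mult.assoc)
      also have "(\<Sum>k\<in>K. \<Sum>i'\<in>I. A i k * B k i' * P i' j) = (\<Sum>i'\<in>I. P i i' * P i' j)"
        by (subst sum.swap) (use i in \<open>auto intro!: sum.cong simp: AB sum_distrib_right\<close>)
      finally show "(\<Sum>k\<in>K. A i k * (\<Sum>l\<in>K. C k l * B l j)) = 0"
        using idem[OF i j] AB[OF i j] by simp
    qed
    have "C k l = 0" by (rule B_surj[where w = "C k", OF BAB[OF _ k] l])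
    then show ?thesis by (simp add: C_def)
  qed
  with that[OF KI AB] show thesis by blast
qed

text \<open>With \<open>P = A B\<close> and \<open>B A = 1\<close>, the trace is that of an identity
  matrix of size \<open>card K\<close>. Rank 0 is recorded separately because it is the way
  positivity of the character form is detected.\<close>

lemma idempotent_trace:
  fixes P :: "'i \<Rightarrow> 'i \<Rightarrow> complex"
  assumes fin: "finite I"
    and idem: "\<And>i j. i \<in> I \<Longrightarrow> j \<in> I \<Longrightarrow> (\<Sum>k\<in>I. P i k * P k j) = P i j"
  obtains r :: nat where "(\<Sum>i\<in>I. P i i) = of_nat r"
    and "r = 0 \<Longrightarrow> \<forall>i\<in>I. \<forall>j\<in>I. P i j = 0"
proof -
  obtain K A B where KI: "K \<subseteq> I"
    and AB: "\<And>i j. i \<in> I \<Longrightarrow> j \<in> I \<Longrightarrow> P i j = (\<Sum>k\<in>K. A i k * B k j)"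
    and BA: "\<And>k l. k \<in> K \<Longrightarrow> l \<in> K \<Longrightarrow> (\<Sum>i\<in>I. B k i * A i l) = of_bool (k = l)"
    using idempotent_rank_factorization[of I P] fin idem by blast
  have finK: "finite K" using KI fin finite_subset by blast
  show thesis
  proof (rule that)
    have "(\<Sum>i\<in>I. P i i) = (\<Sum>k\<in>K. \<Sum>i\<in>I. B k i * A i k)"
      by (subst sum.swap) (simp add: AB mult.commute)
    also have "\<dots> = of_nat (card K)" using BA by simp
    finally show "(\<Sum>i\<in>I. P i i) = of_nat (card K)" .
    show "\<forall>i\<in>I. \<forall>j\<in>I. P i j = 0" if "card K = 0"
      using that finK AB by simp
  qed
qed

text \<open>Rows and columns range over an arbitrary finite set, so that pairs of indices (tensor
  products) and group elements (the regular representation) can serve directly. The empty set is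
  allowed, and entries outside \<open>I\<close> are unconstrained.\<close>

definition indexed_rep ::
    "('g, 'm) monoid_scheme \<Rightarrow> 'i set \<Rightarrow> ('g \<Rightarrow> 'i \<Rightarrow> 'i \<Rightarrow> complex) \<Rightarrow> bool" where
  "indexed_rep G I \<rho> \<longleftrightarrow> finite I \<and>
     (\<forall>i\<in>I. \<forall>j\<in>I. \<rho> \<one>\<^bsub>G\<^esub> i j = of_bool (i = j)) \<and>
     (\<forall>g\<in>carrier G. \<forall>h\<in>carrier G. \<forall>i\<in>I. \<forall>j\<in>I.
        \<rho> (g \<otimes>\<^bsub>G\<^esub> h) i j = (\<Sum>k\<in>I. \<rho> g i k * \<rho> h k j))"

lemma indexed_repD:
  assumes "indexed_rep G I \<rho>"
  shows "finite I"
    and "\<And>i j. i \<in> I \<Longrightarrow> j \<in> I \<Longrightarrow> \<rho> \<one>\<^bsub>G\<^esub> i j = of_bool (i = j)"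
    and "\<And>g h i j. g \<in> carrier G \<Longrightarrow> h \<in> carrier G \<Longrightarrow> i \<in> I \<Longrightarrow> j \<in> I \<Longrightarrow>
      \<rho> (g \<otimes>\<^bsub>G\<^esub> h) i j = (\<Sum>k\<in>I. \<rho> g i k * \<rho> h k j)"
  using assms by (auto simp: indexed_rep_def)

text \<open>A homomorphism into a group preserves the identity; conversely the image of the inverse
  element inverts the image, so membership in the unit group is automatic.\<close>

lemma representation_iff:
  assumes "group G"
  shows "representation G d \<rho> \<longleftrightarrow> 0 < d \<and> (\<forall>g\<in>carrier G. \<rho> g \<in> carrier_mat d d) \<and>
    \<rho> \<one>\<^bsub>G\<^esub> = 1\<^sub>m d \<and> (\<forall>g\<in>carrier G. \<forall>h\<in>carrier G. \<rho> (g \<otimes>\<^bsub>G\<^esub> h) = \<rho> g * \<rho> h)"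
    (is "?L \<longleftrightarrow> ?R")
proof
  interpret G: group G by fact
  interpret M: ring "ring_mat TYPE(complex) d ()" by (rule ring_mat)
  assume L: ?L
  then have h: "\<rho> \<in> hom G (units_of (ring_mat TYPE(complex) d ()))" and d: "0 < d"
    by (auto simp: representation_def)
  have "\<rho> \<one>\<^bsub>G\<^esub> = \<one>\<^bsub>units_of (ring_mat TYPE(complex) d ())\<^esub>"
    by (rule hom_one[OF h G.is_group M.units_group])
  with h d show ?R
    by (auto simp: hom_def units_of_def Units_def ring_mat_simps Pi_iff)
next
  interpret G: group G by fact
  assume R: ?R
  show ?L
    unfolding representation_def hom_def
  proof (intro conjI CollectI ballI Pi_I)
    show "0 < d" using R by simp
    fix g assume g: "g \<in> carrier G"
    have "\<rho> (inv\<^bsub>G\<^esub> g) * \<rho> g = 1\<^sub>m d" "\<rho> g * \<rho> (inv\<^bsub>G\<^esub> g) = 1\<^sub>m d"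
      using R g by (metis G.inv_closed G.l_inv, metis G.inv_closed G.r_inv)
    then show "\<rho> g \<in> carrier (units_of (ring_mat TYPE(complex) d ()))"
      using R g G.inv_closed[OF g] unfolding units_of_def Units_def by (auto simp: ring_mat_simps)
    fix h assume h: "h \<in> carrier G"
    show "\<rho> (g \<otimes>\<^bsub>G\<^esub> h) = \<rho> g \<otimes>\<^bsub>units_of (ring_mat TYPE(complex) d ())\<^esub> \<rho> h"
      using R g h by (simp add: units_of_def ring_mat_simps)
  qed
qed

lemma index_mult_mat_sum:
  assumes "A \<in> carrier_mat m n" "B \<in> carrier_mat n l" "i < m" "j < l"
  shows "(A * B) $$ (i, j) = (\<Sum>k<n. A $$ (i, k) * B $$ (k, j))"
  using assms by (simp add: scalar_prod_def atLeast0LessThan)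

lemma is_character_indexed_rep:
  assumes G: "group G" and \<rho>: "indexed_rep G I \<rho>" and ne: "I \<noteq> {}"
  shows "is_character G (\<lambda>g\<in>carrier G. \<Sum>i\<in>I. \<rho> g i i)"
proof -
  interpret G: group G by fact
  note fin = indexed_repD(1)[OF \<rho>]
  define d where "d = card I"
  obtain e where e: "bij_betw e {..<d} I"
    using ex_bij_betw_nat_finite[OF fin] by (auto simp: d_def atLeast0LessThan)
  have eI: "e i \<in> I" if "i < d" for i using e that by (auto simp: bij_betw_def)
  define \<sigma> where "\<sigma> g = mat d d (\<lambda>(i, j). \<rho> g (e i) (e j))" for g
  have "representation G d \<sigma>"
    unfolding representation_iff[OF G]
  proof (intro conjI ballI)
    show "0 < d" using ne fin by (simp add: d_def card_gt_0_iff)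
    show "\<sigma> g \<in> carrier_mat d d" for g by (simp add: \<sigma>_def)
    show "\<sigma> \<one>\<^bsub>G\<^esub> = 1\<^sub>m d"
      using e by (intro eq_matI) (auto simp: \<sigma>_def indexed_repD(2)[OF \<rho>] eI bij_betw_def inj_on_eq_iff)
    fix g h assume g: "g \<in> carrier G" and h: "h \<in> carrier G"
    show "\<sigma> (g \<otimes>\<^bsub>G\<^esub> h) = \<sigma> g * \<sigma> h"
    proof (rule eq_matI)
      fix i j assume "i < dim_row (\<sigma> g * \<sigma> h)" "j < dim_col (\<sigma> g * \<sigma> h)"
      then have ij: "i < d" "j < d" by (auto simp: \<sigma>_def)
      have "\<sigma> (g \<otimes>\<^bsub>G\<^esub> h) $$ (i, j) = (\<Sum>k\<in>I. \<rho> g (e i) k * \<rho> h k (e j))"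
        using ij by (simp add: \<sigma>_def indexed_repD(3)[OF \<rho> g h] eI)
      also have "\<dots> = (\<Sum>k<d. \<rho> g (e i) (e k) * \<rho> h (e k) (e j))"
        by (rule sum.reindex_bij_betw[OF e, symmetric])
      also have "\<dots> = (\<sigma> g * \<sigma> h) $$ (i, j)"
        using ij by (subst index_mult_mat_sum[of _ d d _ d]) (auto simp: \<sigma>_def)
      finally show "\<sigma> (g \<otimes>\<^bsub>G\<^esub> h) $$ (i, j) = (\<sigma> g * \<sigma> h) $$ (i, j)" .
    qed (auto simp: \<sigma>_def)
  qed
  moreover have "(\<lambda>g\<in>carrier G. \<Sum>i\<in>I. \<rho> g i i) = afforded_character G \<sigma>"
    by (auto simp: afforded_character_def mat_trace_def \<sigma>_def
        sum.reindex_bij_betw[OF e, of "\<lambda>i. \<rho> _ i i", symmetric] intro!: restrict_ext)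
  ultimately show ?thesis unfolding is_character_def by blast
qed

lemma representation_indexed_rep:
  assumes "group G" and "representation G d \<rho>"
  shows "indexed_rep G {..<d} (\<lambda>g i j. \<rho> g $$ (i, j))"
  using assms(2) unfolding indexed_rep_def representation_iff[OF assms(1)]
  by (auto simp: index_mult_mat_sum[of _ d d _ d])

lemma is_characterE:
  assumes "group G" and "is_character G \<chi>"
  obtains d \<rho> where "0 < d" and "indexed_rep G {..<d::nat} \<rho>"
    and "\<chi> = (\<lambda>g\<in>carrier G. \<Sum>i<d. \<rho> g i i)"
proof -
  from assms(2) obtain d \<rho> where \<rho>: "representation G d \<rho>" and \<chi>: "\<chi> = afforded_character G \<rho>"
    by (auto simp: is_character_def)
  show thesis
    by (rule that[OF _ representation_indexed_rep[OF assms(1) \<rho>]])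
      (use \<rho> \<chi> in \<open>auto simp: representation_iff[OF assms(1)] afforded_character_def mat_trace_def
        intro!: restrict_ext\<close>)
qed

text \<open>The image of a commuting idempotent is a subrepresentation: with \<open>P = A B\<close>
  and \<open>B A = 1\<close> it is given by \<open>B \<rho> A\<close>, whose trace is that of
  \<open>\<rho> P\<close>. A nonzero \<open>P\<close> keeps its dimension positive.\<close>

lemma is_character_commuting_idempotent:
  assumes G: "group G" and \<rho>: "indexed_rep G I \<rho>"
    and idem: "\<And>i j. i \<in> I \<Longrightarrow> j \<in> I \<Longrightarrow> (\<Sum>k\<in>I. P i k * P k j) = P i j"
    and comm: "\<And>g i j. g \<in> carrier G \<Longrightarrow> i \<in> I \<Longrightarrow> j \<in> I \<Longrightarrow>
      (\<Sum>k\<in>I. \<rho> g i k * P k j) = (\<Sum>k\<in>I. P i k * \<rho> g k j)"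
    and ne: "\<exists>i\<in>I. \<exists>j\<in>I. P i j \<noteq> 0"
  shows "is_character G (\<lambda>g\<in>carrier G. \<Sum>i\<in>I. \<Sum>j\<in>I. \<rho> g i j * P j i)"
proof -
  interpret G: group G by fact
  note fin = indexed_repD(1)[OF \<rho>]
  obtain K A B where KI: "K \<subseteq> I"
    and AB: "\<And>i j. i \<in> I \<Longrightarrow> j \<in> I \<Longrightarrow> P i j = (\<Sum>k\<in>K. A i k * B k j)"
    and BA: "\<And>k l. k \<in> K \<Longrightarrow> l \<in> K \<Longrightarrow> (\<Sum>i\<in>I. B k i * A i l) = of_bool (k = l)"
    using idempotent_rank_factorization[of I P] fin idem by blast
  have finK: "finite K" using KI fin finite_subset by blast
  define \<tau> where "\<tau> g k l = (\<Sum>i\<in>I. \<Sum>j\<in>I. B k i * \<rho> g i j * A j l)" for g k l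
  have BP: "(\<Sum>i\<in>I. B k i * P i j) = B k j" if "k \<in> K" "j \<in> I" for k j
  proof -
    have "(\<Sum>i\<in>I. B k i * P i j) = (\<Sum>l\<in>K. (\<Sum>i\<in>I. B k i * A i l) * B l j)"
      unfolding sum_distrib_right
      by (subst sum.swap) (use that in \<open>auto simp: AB sum_distrib_left mult.assoc intro!: sum.cong\<close>)
    also have "\<dots> = (\<Sum>l\<in>K. of_bool (k = l) * B l j)" using that by (simp add: BA)
    also have "\<dots> = B k j" using finK that by (simp add: of_bool_def if_distrib[of "\<lambda>x. x * _"] cong: if_cong)
    finally show ?thesis .
  qed
  have "indexed_rep G K \<tau>"
    unfolding indexed_rep_def
  proof (intro conjI ballI finK)
    fix k l assume k: "k \<in> K" and l: "l \<in> K"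
    have "\<tau> \<one>\<^bsub>G\<^esub> k l = (\<Sum>i\<in>I. \<Sum>j\<in>I. if j = i then B k i * A i l else 0)"
      unfolding \<tau>_def
      by (intro sum.cong refl) (auto simp: indexed_repD(2)[OF \<rho>])
    then show "\<tau> \<one>\<^bsub>G\<^esub> k l = of_bool (k = l)" using BA[OF k l] fin by simp
    fix g h assume g: "g \<in> carrier G" and h: "h \<in> carrier G"
    \<comment> \<open>\<open>P\<close> can be inserted after \<open>B \<rho> g\<close>, because
      \<open>B P = B\<close> and \<open>P\<close> commutes with \<open>\<rho> g\<close>. Replacing
      this \<open>P\<close> by \<open>A B\<close> then splits \<open>\<tau>\<close> of a
      product.\<close>
    have Bg: "(\<Sum>i\<in>I. B k i * \<rho> g i j) = (\<Sum>i\<in>I. (\<Sum>i'\<in>I. B k i' * \<rho> g i' i) * P i j)" if j: "j \<in> I" for j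
    proof -
      have "(\<Sum>i\<in>I. (\<Sum>i'\<in>I. B k i' * \<rho> g i' i) * P i j) = (\<Sum>i'\<in>I. B k i' * (\<Sum>i\<in>I. \<rho> g i' i * P i j))"
        unfolding sum_distrib_left sum_distrib_right by (subst sum.swap) (simp add: mult.assoc)
      also have "\<dots> = (\<Sum>i'\<in>I. B k i' * (\<Sum>i\<in>I. P i' i * \<rho> g i j))" using g j by (simp add: comm)
      also have "\<dots> = (\<Sum>i\<in>I. (\<Sum>i'\<in>I. B k i' * P i' i) * \<rho> g i j)"
        unfolding sum_distrib_left sum_distrib_right by (subst sum.swap) (simp add: mult.assoc)
      also have "\<dots> = (\<Sum>i\<in>I. B k i * \<rho> g i j)" using k by (simp add: BP)
      finally show ?thesis by simp
    qed
    have cPd: "c * P i j * d = (\<Sum>m\<in>K. (c * A i m) * (B m j * d))" if "i \<in> I" "j \<in> I" for c d i j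
      using that by (simp add: AB sum_distrib_left sum_distrib_right mult.assoc)
    have "\<tau> (g \<otimes>\<^bsub>G\<^esub> h) k l
      = (\<Sum>i\<in>I. \<Sum>j\<in>I. \<Sum>i'\<in>I. B k i * \<rho> g i i' * \<rho> h i' j * A j l)"
      unfolding \<tau>_def
      by (intro sum.cong refl)
        (simp add: indexed_repD(3)[OF \<rho> g h] sum_distrib_left sum_distrib_right mult.assoc)
    also have "\<dots> = (\<Sum>i\<in>I. \<Sum>i'\<in>I. \<Sum>j\<in>I. B k i * \<rho> g i i' * \<rho> h i' j * A j l)"
      by (rule sum.cong[OF refl], rule sum.swap)
    also have "\<dots> = (\<Sum>i'\<in>I. (\<Sum>i\<in>I. B k i * \<rho> g i i') * (\<Sum>j\<in>I. \<rho> h i' j * A j l))"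
      unfolding sum_distrib_left sum_distrib_right
      by (subst sum.swap, rule sum.cong[OF refl], subst sum.swap) (simp add: mult.assoc)
    also have "\<dots> = (\<Sum>i'\<in>I. \<Sum>i\<in>I. (\<Sum>i''\<in>I. B k i'' * \<rho> g i'' i) * P i i' * (\<Sum>j\<in>I. \<rho> h i' j * A j l))"
      by (rule sum.cong[OF refl], subst Bg) (simp_all add: sum_distrib_right)
    also have "\<dots> = (\<Sum>i'\<in>I. \<Sum>i\<in>I. \<Sum>m\<in>K. ((\<Sum>i''\<in>I. B k i'' * \<rho> g i'' i) * A i m) * (B m i' * (\<Sum>j\<in>I. \<rho> h i' j * A j l)))"
      by (intro sum.cong refl cPd)
    also have "\<dots> = (\<Sum>i'\<in>I. \<Sum>m\<in>K. \<Sum>i\<in>I. ((\<Sum>i''\<in>I. B k i'' * \<rho> g i'' i) * A i m) * (B m i' * (\<Sum>j\<in>I. \<rho> h i' j * A j l)))"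
      by (rule sum.cong[OF refl], rule sum.swap)
    also have "\<dots> = (\<Sum>m\<in>K. (\<Sum>i\<in>I. (\<Sum>i''\<in>I. B k i'' * \<rho> g i'' i) * A i m) * (\<Sum>i'\<in>I. B m i' * (\<Sum>j\<in>I. \<rho> h i' j * A j l)))"
      unfolding sum_product by (subst sum.swap, rule sum.cong[OF refl], rule sum.swap)
    also have "\<dots> = (\<Sum>m\<in>K. \<tau> g k m * \<tau> h m l)"
    proof (intro sum.cong refl arg_cong2[of _ _ _ _ "(*)"])
      fix m
      show "(\<Sum>i\<in>I. (\<Sum>i''\<in>I. B k i'' * \<rho> g i'' i) * A i m) = \<tau> g k m"
        unfolding \<tau>_def sum_distrib_right by (subst sum.swap) simp
      show "(\<Sum>i'\<in>I. B m i' * (\<Sum>j\<in>I. \<rho> h i' j * A j l)) = \<tau> h m l"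
        unfolding \<tau>_def sum_distrib_left by (simp add: mult.assoc)
    qed
    finally show "\<tau> (g \<otimes>\<^bsub>G\<^esub> h) k l = (\<Sum>m\<in>K. \<tau> g k m * \<tau> h m l)" .
  qed
  moreover have "K \<noteq> {}" using ne AB by auto
  ultimately have "is_character G (\<lambda>g\<in>carrier G. \<Sum>k\<in>K. \<tau> g k k)"
    by (rule is_character_indexed_rep[OF G])
  moreover have "(\<Sum>k\<in>K. \<tau> g k k) = (\<Sum>i\<in>I. \<Sum>j\<in>I. \<rho> g i j * P j i)" for g
  proof -
    have "(\<Sum>k\<in>K. \<tau> g k k) = (\<Sum>i\<in>I. \<Sum>j\<in>I. \<Sum>k\<in>K. B k i * \<rho> g i j * A j k)"
      unfolding \<tau>_def by (subst sum.swap, rule sum.cong[OF refl], rule sum.swap)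
    also have "\<dots> = (\<Sum>i\<in>I. \<Sum>j\<in>I. \<rho> g i j * P j i)"
      by (intro sum.cong refl) (simp add: AB sum_distrib_left mult_ac)
    finally show ?thesis .
  qed
  ultimately show ?thesis by simp
qed

section \<open>The bilinear form on characters\<close>

text \<open>Matrix products stay atomic for the simplifier, so that additive identities can be checked entrywise.\<close>

declare index_mult_mat(1) [simp del]

text \<open>The inverse replaces complex conjugation, so neither unitarity nor a Hermitian structure
  has to be established; the form is bilinear.\<close>

definition char_form ::
    "('g, 'm) monoid_scheme \<Rightarrow> ('g \<Rightarrow> complex) \<Rightarrow> ('g \<Rightarrow> complex) \<Rightarrow> complex" where
  "char_form G \<phi> \<psi> = (\<Sum>g\<in>carrier G. \<phi> g * \<psi> (inv\<^bsub>G\<^esub> g)) / of_nat (card (carrier G))"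

lemma (in group) sum_left_translation:
  assumes "h \<in> carrier G"
  shows "(\<Sum>g\<in>carrier G. F (h \<otimes> g)) = (\<Sum>g\<in>carrier G. F g)"
  by (rule sum.reindex_bij_witness[of _ "\<lambda>g. inv h \<otimes> g" "\<lambda>g. h \<otimes> g"])
    (use assms in \<open>auto simp: m_assoc[symmetric]\<close>)

lemma (in group) sum_right_translation:
  assumes "h \<in> carrier G"
  shows "(\<Sum>g\<in>carrier G. F (g \<otimes> h)) = (\<Sum>g\<in>carrier G. F g)"
  by (rule sum.reindex_bij_witness[of _ "\<lambda>g. g \<otimes> inv h" "\<lambda>g. g \<otimes> h"])
    (use assms in \<open>auto simp: m_assoc\<close>)

lemma (in group) sum_inv:
  "(\<Sum>g\<in>carrier G. F (inv g)) = (\<Sum>g\<in>carrier G. F g)"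
  by (rule sum.reindex_bij_witness[of _ "\<lambda>g. inv g" "\<lambda>g. inv g"]) auto

text \<open>The average over the group projects onto the invariant vectors: by translation
  invariance one of the two summations in \<open>P P\<close> contributes only the factor
  \<open>card (carrier G)\<close>.\<close>

lemma average_idempotent:
  assumes G: "group G" and fin: "finite (carrier G)" and \<rho>: "indexed_rep G I \<rho>"
  defines "P \<equiv> \<lambda>i j. (\<Sum>g\<in>carrier G. \<rho> g i j) / of_nat (card (carrier G))"
  assumes i: "i \<in> I" and j: "j \<in> I"
  shows "(\<Sum>k\<in>I. P i k * P k j) = P i j"
proof -
  interpret G: group G by fact
  define N :: complex where "N = of_nat (card (carrier G))"
  have N: "N \<noteq> 0" using fin G.carrier_not_empty by (simp add: N_def)
  have "(\<Sum>k\<in>I. P i k * P k j)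
    = (\<Sum>k\<in>I. \<Sum>g\<in>carrier G. \<Sum>h\<in>carrier G. \<rho> g i k * \<rho> h k j) / (N * N)"
    by (simp add: P_def N_def sum_product sum_divide_distrib)
  also have "(\<Sum>k\<in>I. \<Sum>g\<in>carrier G. \<Sum>h\<in>carrier G. \<rho> g i k * \<rho> h k j)
    = (\<Sum>g\<in>carrier G. \<Sum>h\<in>carrier G. \<Sum>k\<in>I. \<rho> g i k * \<rho> h k j)"
    by (subst sum.swap, rule sum.cong[OF refl], rule sum.swap)
  also have "\<dots> = (\<Sum>g\<in>carrier G. \<Sum>h\<in>carrier G. \<rho> (g \<otimes>\<^bsub>G\<^esub> h) i j)"
    by (intro sum.cong refl) (simp add: indexed_repD(3)[OF \<rho>] i j)
  also have "\<dots> = N * (\<Sum>h\<in>carrier G. \<rho> h i j)"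
    by (simp add: G.sum_left_translation[of _ "\<lambda>g. \<rho> g i j"] N_def)
  also have "\<dots> / (N * N) = P i j" using N by (simp add: P_def N_def)
  finally show ?thesis .
qed

text \<open>The second factor is the contragredient of \<sigma>: inverse argument, transposed
  indices. Invariants of this tensor product are the intertwiners between the two
  representations.\<close>

lemma indexed_rep_tensor_dual:
  assumes G: "group G" and \<rho>: "indexed_rep G I \<rho>" and \<sigma>: "indexed_rep G J \<sigma>"
  shows "indexed_rep G (I \<times> J) (\<lambda>g x y. \<rho> g (fst x) (fst y) * \<sigma> (inv\<^bsub>G\<^esub> g) (snd y) (snd x))"
proof -
  interpret G: group G by fact
  show ?thesis
    unfolding indexed_rep_def
  proof (intro conjI ballI)
    show "finite (I \<times> J)" using indexed_repD(1)[OF \<rho>] indexed_repD(1)[OF \<sigma>] by simp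
    fix x y assume x: "x \<in> I \<times> J" and y: "y \<in> I \<times> J"
    show "\<rho> \<one>\<^bsub>G\<^esub> (fst x) (fst y) * \<sigma> (inv\<^bsub>G\<^esub> \<one>\<^bsub>G\<^esub>) (snd y) (snd x) = of_bool (x = y)"
      using x y by (auto simp: indexed_repD(2)[OF \<rho>] indexed_repD(2)[OF \<sigma>] prod_eq_iff)
    fix g h assume g: "g \<in> carrier G" and h: "h \<in> carrier G"
    have "\<rho> (g \<otimes>\<^bsub>G\<^esub> h) (fst x) (fst y) * \<sigma> (inv\<^bsub>G\<^esub> (g \<otimes>\<^bsub>G\<^esub> h)) (snd y) (snd x)
      = (\<Sum>k\<in>I. \<rho> g (fst x) k * \<rho> h k (fst y)) *
        (\<Sum>l\<in>J. \<sigma> (inv\<^bsub>G\<^esub> h) (snd y) l * \<sigma> (inv\<^bsub>G\<^esub> g) l (snd x))"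
      using x y g h
      by (auto simp: G.inv_mult_group indexed_repD(3)[OF \<rho>] indexed_repD(3)[OF \<sigma>])
    also have "\<dots> = (\<Sum>z\<in>I \<times> J. \<rho> g (fst x) (fst z) * \<sigma> (inv\<^bsub>G\<^esub> g) (snd z) (snd x) *
        (\<rho> h (fst z) (fst y) * \<sigma> (inv\<^bsub>G\<^esub> h) (snd y) (snd z)))"
      unfolding sum_product sum.cartesian_product by (auto intro!: sum.cong simp: mult_ac)
    finally show "\<rho> (g \<otimes>\<^bsub>G\<^esub> h) (fst x) (fst y) * \<sigma> (inv\<^bsub>G\<^esub> (g \<otimes>\<^bsub>G\<^esub> h)) (snd y) (snd x)
      = (\<Sum>z\<in>I \<times> J. \<rho> g (fst x) (fst z) * \<sigma> (inv\<^bsub>G\<^esub> g) (snd z) (snd x) *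
        (\<rho> h (fst z) (fst y) * \<sigma> (inv\<^bsub>G\<^esub> h) (snd y) (snd z)))" .
  qed
qed

lemma char_form_eq_trace:
  assumes G: "group G"
    and \<phi>: "\<phi> = (\<lambda>g\<in>carrier G. \<Sum>i\<in>I. \<rho> g i i)" and \<psi>: "\<psi> = (\<lambda>g\<in>carrier G. \<Sum>i\<in>J. \<sigma> g i i)"
  shows "char_form G \<phi> \<psi> = (\<Sum>x\<in>I \<times> J.
    (\<Sum>g\<in>carrier G. \<rho> g (fst x) (fst x) * \<sigma> (inv\<^bsub>G\<^esub> g) (snd x) (snd x)) / of_nat (card (carrier G)))"
proof -
  interpret G: group G by fact
  have "(\<Sum>g\<in>carrier G. \<phi> g * \<psi> (inv\<^bsub>G\<^esub> g))
    = (\<Sum>g\<in>carrier G. \<Sum>x\<in>I \<times> J. \<rho> g (fst x) (fst x) * \<sigma> (inv\<^bsub>G\<^esub> g) (snd x) (snd x))"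
    by (intro sum.cong refl) (auto simp: \<phi> \<psi> sum_product sum.cartesian_product case_prod_beta)
  also have "\<dots> = (\<Sum>x\<in>I \<times> J. \<Sum>g\<in>carrier G. \<rho> g (fst x) (fst x) * \<sigma> (inv\<^bsub>G\<^esub> g) (snd x) (snd x))"
    by (rule sum.swap)
  finally show ?thesis by (simp add: char_form_def sum_divide_distrib)
qed

text \<open>The form is the trace of the averaging idempotent on the tensor product with the dual,
  hence a dimension. It is nonzero on a pair of equal characters because the identity is then an
  intertwiner.\<close>

lemma char_form_characters:
  assumes G: "group G" and fin: "finite (carrier G)"
    and \<phi>: "is_character G \<phi>" and \<psi>: "is_character G \<psi>"
  obtains r :: nat where "char_form G \<phi> \<psi> = of_nat r" and "\<phi> = \<psi> \<Longrightarrow> r \<noteq> 0"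
proof -
  interpret G: group G by fact
  obtain d \<rho> where d: "0 < d" and \<rho>: "indexed_rep G {..<d::nat} \<rho>"
    and \<phi>': "\<phi> = (\<lambda>g\<in>carrier G. \<Sum>i<d. \<rho> g i i)"
    by (rule is_characterE[OF G \<phi>])
  \<comment> \<open>Equal characters are given the same matrices here, which makes the nonvanishing
    argument a computation with a single representation.\<close>
  obtain e \<sigma> where e: "0 < e" and \<sigma>: "indexed_rep G {..<e::nat} \<sigma>"
    and \<psi>': "\<psi> = (\<lambda>g\<in>carrier G. \<Sum>i<e. \<sigma> g i i)"
    and same: "\<phi> = \<psi> \<Longrightarrow> e = d \<and> \<sigma> = \<rho>"
  proof (cases "\<phi> = \<psi>")
    case True
    then show ?thesis using that[OF d \<rho>] \<phi>' by blast
  next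
    case False
    then show ?thesis using is_characterE[OF G \<psi>] that by metis
  qed
  let ?N = "of_nat (card (carrier G)) :: complex"
  have N: "?N \<noteq> 0" using fin G.carrier_not_empty by simp
  define T where "T g x y = \<rho> g (fst x) (fst y) * \<sigma> (inv\<^bsub>G\<^esub> g) (snd y) (snd x)"
    for g and x y :: "nat \<times> nat"
  have T: "indexed_rep G ({..<d} \<times> {..<e}) T"
    unfolding T_def by (rule indexed_rep_tensor_dual[OF G \<rho> \<sigma>])
  define P where "P x y = (\<Sum>g\<in>carrier G. T g x y) / ?N" for x y
  have idem: "(\<Sum>k\<in>{..<d} \<times> {..<e}. P x k * P k y) = P x y"
    if "x \<in> {..<d} \<times> {..<e}" "y \<in> {..<d} \<times> {..<e}" for x y
    unfolding P_def by (rule average_idempotent[OF G fin T that])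
  obtain r :: nat where r: "(\<Sum>x\<in>{..<d} \<times> {..<e}. P x x) = of_nat r"
    and r0: "r = 0 \<Longrightarrow> \<forall>x\<in>{..<d} \<times> {..<e}. \<forall>y\<in>{..<d} \<times> {..<e}. P x y = 0"
    using idempotent_trace[OF indexed_repD(1)[OF T], of P] idem by blast
  have "char_form G \<phi> \<psi> = of_nat r"
    unfolding r[symmetric] char_form_eq_trace[where \<rho> = \<rho> and \<sigma> = \<sigma>, OF G \<phi>' \<psi>'] by (simp add: P_def T_def)
  moreover have "r \<noteq> 0" if "\<phi> = \<psi>"
  proof
    assume "r = 0"
    from same[OF that] have [simp]: "e = d" "\<sigma> = \<rho>" by simp_all
    \<comment> \<open>The chosen entries of the projector, summed over \<open>k\<close>, average
      \<open>\<rho> (g g^-1)\<close> at position \<open>(0, 0)\<close>, which is 1.\<close>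
    have "0 = (\<Sum>k<d. P (0, 0) (k, k))" using r0[OF \<open>r = 0\<close>] d by simp
    also have "\<dots> = (\<Sum>g\<in>carrier G. \<Sum>k<d. \<rho> g 0 k * \<rho> (inv\<^bsub>G\<^esub> g) k 0) / ?N"
      by (subst sum.swap) (simp add: P_def T_def sum_divide_distrib)
    also have "\<dots> = (\<Sum>g\<in>carrier G. \<rho> \<one>\<^bsub>G\<^esub> 0 0) / ?N"
      using d by (simp add: indexed_repD(3)[OF \<rho>, symmetric])
    also have "\<dots> = 1" using N d by (simp add: indexed_repD(2)[OF \<rho>])
    finally show False by simp
  qed
  ultimately show thesis by (rule that)
qed

section \<open>Traces, Schur's lemma and constituents\<close>

lemma mat_trace_mult_comm:
  assumes "A \<in> carrier_mat m n" "B \<in> carrier_mat n m"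
  shows "mat_trace (A * B) = mat_trace (B * A)"
proof -
  have "mat_trace (A * B) = (\<Sum>i<m. \<Sum>k<n. A $$ (i, k) * B $$ (k, i))"
    using assms by (auto simp: mat_trace_def index_mult_mat_sum[OF assms])
  also have "\<dots> = (\<Sum>k<n. \<Sum>i<m. B $$ (k, i) * A $$ (i, k))"
    by (subst sum.swap) (simp add: mult.commute)
  also have "\<dots> = mat_trace (B * A)"
    using assms by (auto simp: mat_trace_def index_mult_mat_sum[OF assms(2,1)])
  finally show ?thesis .
qed

lemma mat_trace_minus:
  assumes "A \<in> carrier_mat n n" "B \<in> carrier_mat n n"
  shows "mat_trace (A - B) = mat_trace A - mat_trace B"
  using assms by (auto simp: mat_trace_def sum_subtractf)

text \<open>Schur's lemma: over the complex numbers \<open>Z\<close> has an eigenspace, which is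
  invariant and nonzero, so it is the whole space.\<close>

lemma irreducible_commutant_scalar:
  assumes irr: "irreducible_representation G d \<rho>" and G: "group G"
    and Z: "Z \<in> carrier_mat d d" and comm: "\<And>g. g \<in> carrier G \<Longrightarrow> \<rho> g * Z = Z * \<rho> g"
  obtains z where "Z = z \<cdot>\<^sub>m 1\<^sub>m d"
proof -
  have rep: "representation G d \<rho>" using irr by (simp add: irreducible_representation_def)
  then have d: "0 < d" and \<rho>: "\<And>g. g \<in> carrier G \<Longrightarrow> \<rho> g \<in> carrier_mat d d"
    by (auto simp: representation_iff[OF G])
  obtain z where "eigenvalue Z z"
    using spectrum_non_empty[OF Z d] by (auto simp: spectrum_def)
  then obtain v where v: "v \<in> carrier_vec d" "v \<noteq> 0\<^sub>v d" "Z *\<^sub>v v = z \<cdot>\<^sub>v v"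
    using Z by (auto simp: eigenvalue_def eigenvector_def)
  define W where "W = {w \<in> carrier_vec d. Z *\<^sub>v w = z \<cdot>\<^sub>v w}"
  interpret vec_space "TYPE(complex)" d .
  have "VectorSpace.subspace class_ring W (module_vec TYPE(complex) d)"
  proof (rule subspace.intro[OF vec_vs], rule submodule.intro[OF vec_module])
    show "W \<subseteq> carrier (module_vec TYPE(complex) d)" by (auto simp: W_def module_vec_simps)
    fix a b assume "a \<in> W" "b \<in> W"
    then show "a \<oplus>\<^bsub>module_vec TYPE(complex) d\<^esub> b \<in> W"
      using Z by (auto simp: W_def module_vec_simps mult_add_distrib_mat_vec smult_add_distrib_vec)
  next
    show "\<zero>\<^bsub>module_vec TYPE(complex) d\<^esub> \<in> W"
      using Z by (auto simp: W_def module_vec_simps)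
    fix c :: complex and a assume "a \<in> W"
    then show "c \<odot>\<^bsub>module_vec TYPE(complex) d\<^esub> a \<in> W"
      using Z by (auto simp: W_def module_vec_simps mult_mat_vec smult_smult_assoc mult.commute)
  qed
  moreover have "\<rho> g *\<^sub>v w \<in> W" if g: "g \<in> carrier G" and w: "w \<in> W" for g w
  proof -
    have w': "w \<in> carrier_vec d" "Z *\<^sub>v w = z \<cdot>\<^sub>v w" using w by (auto simp: W_def)
    have "Z *\<^sub>v (\<rho> g *\<^sub>v w) = \<rho> g *\<^sub>v (Z *\<^sub>v w)"
      using w'(1) Z \<rho>[OF g] comm[OF g]
      by (metis assoc_mult_mat_vec)
    also have "\<dots> = z \<cdot>\<^sub>v (\<rho> g *\<^sub>v w)" using w' \<rho>[OF g] by (simp add: mult_mat_vec)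
    finally show ?thesis using w' \<rho>[OF g] by (auto simp: W_def)
  qed
  ultimately have "W = {0\<^sub>v d} \<or> W = carrier_vec d"
    using irr by (auto simp: irreducible_representation_def)
  moreover have "v \<in> W" using v by (simp add: W_def)
  ultimately have W: "W = carrier_vec d" using v by auto
  have "Z = z \<cdot>\<^sub>m 1\<^sub>m d"
  proof (rule eq_matI)
    fix i j assume "i < dim_row (z \<cdot>\<^sub>m 1\<^sub>m d)" "j < dim_col (z \<cdot>\<^sub>m 1\<^sub>m d)"
    then have ij: "i < d" "j < d" by simp_all
    have "unit_vec d j \<in> W" unfolding W by simp
    then have "Z *\<^sub>v unit_vec d j = z \<cdot>\<^sub>v unit_vec d j" unfolding W_def by simp
    then have "(Z *\<^sub>v unit_vec d j) $ i = (z \<cdot>\<^sub>v unit_vec d j) $ i" by simp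
    then show "Z $$ (i, j) = (z \<cdot>\<^sub>m 1\<^sub>m d) $$ (i, j)" using ij Z by auto
  qed (use Z in auto)
  then show thesis by (rule that)
qed

text \<open>\<open>X\<close> is, up to a factor, the average of the elementary matrix with entry at
  \<open>(a, b)\<close>; left translation of the summation variable exchanges the two
  actions.\<close>

lemma averaged_intertwiner:
  fixes \<rho> \<sigma> :: "'g \<Rightarrow> complex mat"
  assumes G: "group G" and \<rho>: "representation G d \<rho>" and \<sigma>: "representation G e \<sigma>"
    and a: "a < d" and b: "b < e" and h: "h \<in> carrier G"
  defines "X \<equiv> mat d e (\<lambda>(i, j). \<Sum>g\<in>carrier G. \<rho> g $$ (i, a) * \<sigma> (inv\<^bsub>G\<^esub> g) $$ (b, j))"
  shows "\<rho> h * X = X * \<sigma> h"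
proof -
  interpret G: group G by fact
  note R = \<rho>[unfolded representation_iff[OF G]] and S = \<sigma>[unfolded representation_iff[OF G]]
  have Rc: "\<rho> g \<in> carrier_mat d d" and Sc: "\<sigma> g \<in> carrier_mat e e" if "g \<in> carrier G" for g
    using R S that by auto
  have X: "X \<in> carrier_mat d e" by (simp add: X_def)
  show ?thesis
  proof (rule eq_matI)
    fix i j assume "i < dim_row (X * \<sigma> h)" "j < dim_col (X * \<sigma> h)"
    then have ij: "i < d" "j < e" using Sc[OF h] by (auto simp: X_def)
    have "(\<rho> h * X) $$ (i, j)
      = (\<Sum>k<d. \<Sum>g\<in>carrier G. \<rho> h $$ (i, k) * \<rho> g $$ (k, a) * \<sigma> (inv\<^bsub>G\<^esub> g) $$ (b, j))"
      using ij by (subst index_mult_mat_sum[OF Rc[OF h] X]) (simp_all add: X_def sum_distrib_left mult.assoc)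
    also have "\<dots> = (\<Sum>g\<in>carrier G. (\<rho> h * \<rho> g) $$ (i, a) * \<sigma> (inv\<^bsub>G\<^esub> g) $$ (b, j))"
      by (subst sum.swap) (intro sum.cong refl, simp add: index_mult_mat_sum[OF Rc[OF h] Rc] ij a sum_distrib_right)
    also have "\<dots> = (\<Sum>g\<in>carrier G. \<rho> (h \<otimes>\<^bsub>G\<^esub> g) $$ (i, a) * \<sigma> (inv\<^bsub>G\<^esub> (h \<otimes>\<^bsub>G\<^esub> g) \<otimes>\<^bsub>G\<^esub> h) $$ (b, j))"
      using R h by (intro sum.cong refl) (simp add: G.inv_mult_group G.m_assoc)
    also have "\<dots> = (\<Sum>g\<in>carrier G. \<rho> g $$ (i, a) * \<sigma> (inv\<^bsub>G\<^esub> g \<otimes>\<^bsub>G\<^esub> h) $$ (b, j))"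
      by (rule G.sum_left_translation[OF h])
    also have "\<dots> = (\<Sum>g\<in>carrier G. \<Sum>k<e. \<rho> g $$ (i, a) * \<sigma> (inv\<^bsub>G\<^esub> g) $$ (b, k) * \<sigma> h $$ (k, j))"
      using S h ij b
      by (intro sum.cong refl) (simp add: index_mult_mat_sum[OF Sc Sc] sum_distrib_left mult.assoc)
    also have "\<dots> = (X * \<sigma> h) $$ (i, j)"
      using ij by (subst sum.swap, subst index_mult_mat_sum[OF X Sc[OF h]]) (simp_all add: X_def sum_distrib_right)
    finally show "(\<rho> h * X) $$ (i, j) = (X * \<sigma> h) $$ (i, j)" .
  qed (use Rc[OF h] Sc[OF h] X in auto)
qed

text \<open>Averaged elementary matrices give intertwiners \<open>X\<close> and \<open>Y\<close> in
  both directions. Schur's lemma normalizes \<open>X Y\<close> to 1, so \<open>Y X\<close> is a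
  commuting idempotent cutting out \<psi>. The complementary idempotent affords
  \<open>\<chi> - \<psi>\<close>, unless it vanishes and the characters agree.\<close>

lemma irreducible_constituent:
  assumes G: "group G" and fin: "finite (carrier G)"
    and \<psi>: "is_irreducible_character G \<psi>" and \<chi>: "is_character G \<chi>"
    and ne: "char_form G \<psi> \<chi> \<noteq> 0"
  shows "constituent G \<psi> \<chi>"
proof -
  interpret G: group G by fact
  obtain d \<rho> where irr: "irreducible_representation G d \<rho>" and \<psi>': "\<psi> = afforded_character G \<rho>"
    using \<psi> by (auto simp: is_irreducible_character_def)
  have \<rho>: "representation G d \<rho>" using irr by (simp add: irreducible_representation_def)
  obtain e \<sigma> where \<sigma>: "representation G e \<sigma>" and \<chi>': "\<chi> = afforded_character G \<sigma>"
    using \<chi> by (auto simp: is_character_def)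
  note R = \<rho>[unfolded representation_iff[OF G]] and S = \<sigma>[unfolded representation_iff[OF G]]
  have Rc: "\<rho> g \<in> carrier_mat d d" and Sc: "\<sigma> g \<in> carrier_mat e e" if "g \<in> carrier G" for g
    using R S that by auto
  define N :: complex where "N = of_nat (card (carrier G))"
  have N: "N \<noteq> 0" using fin G.carrier_not_empty by (simp add: N_def)
  have \<psi>2: "\<psi> = (\<lambda>g\<in>carrier G. \<Sum>i<d. \<rho> g $$ (i, i))"
    and \<chi>2: "\<chi> = (\<lambda>g\<in>carrier G. \<Sum>i<e. \<sigma> g $$ (i, i))"
    using Rc Sc by (auto simp: \<psi>' \<chi>' afforded_character_def mat_trace_def intro!: restrict_ext)
  \<comment> \<open>A nonzero form has a nonzero diagonal contribution; its position
    \<open>(a, b)\<close> is the one at which the entry of \<open>X\<close> will be nonzero.\<close>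
  have "\<exists>a<d. \<exists>b<e. (\<Sum>g\<in>carrier G. \<rho> g $$ (a, a) * \<sigma> (inv\<^bsub>G\<^esub> g) $$ (b, b)) \<noteq> 0"
  proof (rule ccontr)
    assume "\<not> ?thesis"
    then have "char_form G \<psi> \<chi> = 0"
      unfolding char_form_eq_trace[where \<rho> = "\<lambda>g i j. \<rho> g $$ (i, j)" and \<sigma> = "\<lambda>g i j. \<sigma> g $$ (i, j)", OF G \<psi>2 \<chi>2] by (intro sum.neutral) auto
    with ne show False by simp
  qed
  then obtain a b where a: "a < d" and b: "b < e"
    and ab: "(\<Sum>g\<in>carrier G. \<rho> g $$ (a, a) * \<sigma> (inv\<^bsub>G\<^esub> g) $$ (b, b)) \<noteq> 0" by blast
  define X where "X = mat d e (\<lambda>(i, j). \<Sum>g\<in>carrier G. \<rho> g $$ (i, a) * \<sigma> (inv\<^bsub>G\<^esub> g) $$ (b, j))"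
  define Y0 where "Y0 = mat e d (\<lambda>(i, j). \<Sum>g\<in>carrier G. \<sigma> g $$ (i, b) * \<rho> (inv\<^bsub>G\<^esub> g) $$ (a, j))"
  have X: "X \<in> carrier_mat d e" and Y0: "Y0 \<in> carrier_mat e d" by (simp_all add: X_def Y0_def)
  have RX: "\<rho> h * X = X * \<sigma> h" and SY0: "\<sigma> h * Y0 = Y0 * \<rho> h" if "h \<in> carrier G" for h
    unfolding X_def Y0_def
    by (rule averaged_intertwiner[OF G \<rho> \<sigma> a b that], rule averaged_intertwiner[OF G \<sigma> \<rho> b a that])
  define x where "x = X $$ (a, b)"
  have x: "x \<noteq> 0" using ab a b by (simp add: x_def X_def)
  \<comment> \<open>Moving \<open>X\<close> across \<open>\<sigma> g\<close> produces
    \<open>\<rho> (g^-1) \<rho> g X\<close>, so every group element contributes the same entry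
    \<open>x\<close>.\<close>
  have "mat_trace (X * Y0) = (\<Sum>i<d. \<Sum>k<e. \<Sum>g\<in>carrier G. X $$ (i, k) * \<sigma> g $$ (k, b) * \<rho> (inv\<^bsub>G\<^esub> g) $$ (a, i))"
    using carrier_matD[OF X] index_mult_mat_sum[OF X Y0]
    by (simp add: mat_trace_def) (simp add: Y0_def sum_distrib_left mult.assoc)
  also have "\<dots> = (\<Sum>i<d. \<Sum>g\<in>carrier G. \<Sum>k<e. X $$ (i, k) * \<sigma> g $$ (k, b) * \<rho> (inv\<^bsub>G\<^esub> g) $$ (a, i))"
    by (rule sum.cong[OF refl], rule sum.swap)
  also have "\<dots> = (\<Sum>i<d. \<Sum>g\<in>carrier G. (X * \<sigma> g) $$ (i, b) * \<rho> (inv\<^bsub>G\<^esub> g) $$ (a, i))"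
    by (intro sum.cong refl) (simp add: index_mult_mat_sum[OF X Sc] b sum_distrib_right)
  also have "\<dots> = (\<Sum>g\<in>carrier G. \<Sum>i<d. \<rho> (inv\<^bsub>G\<^esub> g) $$ (a, i) * (\<rho> g * X) $$ (i, b))"
    by (subst sum.swap) (simp add: RX mult.commute)
  also have "\<dots> = (\<Sum>g\<in>carrier G. (\<rho> (inv\<^bsub>G\<^esub> g) * (\<rho> g * X)) $$ (a, b))"
    using Rc mult_carrier_mat[OF Rc X] a b
    by (intro sum.cong refl index_mult_mat_sum[symmetric]) auto
  also have "\<dots> = (\<Sum>g\<in>carrier G. x)"
  proof (intro sum.cong refl)
    fix g assume g: "g \<in> carrier G"
    have "\<rho> (inv\<^bsub>G\<^esub> g) * (\<rho> g * X) = \<rho> (inv\<^bsub>G\<^esub> g) * \<rho> g * X"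
      using Rc g X by (intro assoc_mult_mat[symmetric]) auto
    also have "\<rho> (inv\<^bsub>G\<^esub> g) * \<rho> g = 1\<^sub>m d" using R g by (metis G.inv_closed G.l_inv)
    finally show "(\<rho> (inv\<^bsub>G\<^esub> g) * (\<rho> g * X)) $$ (a, b) = x" using X by (simp add: x_def)
  qed
  finally have tr0: "mat_trace (X * Y0) = N * x" by (simp add: N_def)
  \<comment> \<open>The scalar is chosen to make the trace of \<open>X * Y\<close> equal to
    \<open>d\<close>; the scalar supplied by Schur's lemma is then 1.\<close>
  define Y where "Y = (of_nat d / (N * x)) \<cdot>\<^sub>m Y0"
  have Y: "Y \<in> carrier_mat e d" using Y0 by (simp add: Y_def)
  have SY: "\<sigma> h * Y = Y * \<rho> h" if h: "h \<in> carrier G" for h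
    using SY0[OF h] Y0 Sc[OF h] Rc[OF h]
    by (simp add: Y_def mult_smult_distrib[of _ e e] mult_smult_assoc_mat[of _ e d])
  have tr: "mat_trace (X * Y) = of_nat d"
  proof -
    have "mat_trace (X * Y) = of_nat d / (N * x) * mat_trace (X * Y0)"
      using X Y0 by (simp add: Y_def mult_smult_distrib[of _ d e] mat_trace_def sum_distrib_left)
    then show ?thesis using N x by (simp add: tr0)
  qed
  have XYc: "X * Y \<in> carrier_mat d d" using X Y by simp
  have "\<rho> g * (X * Y) = X * Y * \<rho> g" if g: "g \<in> carrier G" for g
  proof -
    have "\<rho> g * (X * Y) = X * \<sigma> g * Y" using assoc_mult_mat[OF Rc[OF g] X Y] RX[OF g] by simp
    also have "\<dots> = X * (Y * \<rho> g)" using assoc_mult_mat[OF X Sc[OF g] Y] SY[OF g] by simp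
    also have "\<dots> = X * Y * \<rho> g" using assoc_mult_mat[OF X Y Rc[OF g]] by simp
    finally show ?thesis .
  qed
  then obtain z where z: "X * Y = z \<cdot>\<^sub>m 1\<^sub>m d"
    by (rule irreducible_commutant_scalar[OF irr G XYc])
  have "of_nat d = z * of_nat d" using tr by (simp add: z mat_trace_def)
  then have "z = 1" using R by simp
  then have XY: "X * Y = 1\<^sub>m d" unfolding z by (intro eq_matI) auto
  define E where "E = Y * X"
  define P where "P = 1\<^sub>m e - E"
  have E: "E \<in> carrier_mat e e" unfolding E_def by (rule mult_carrier_mat[OF Y X])
  have P: "P \<in> carrier_mat e e" unfolding P_def by (rule minus_carrier_mat[OF E])
  have EE: "E * E = E"
  proof -
    have "E * E = Y * (X * Y * X)"
      using assoc_mult_mat[OF Y X E] assoc_mult_mat[OF X Y X] by (simp add: E_def)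
    then show ?thesis using X by (simp add: XY E_def)
  qed
  have PP: "P * P = P"
  proof -
    have "P * P = 1\<^sub>m e * P - E * P" unfolding P_def by (rule minus_mult_distrib_mat) (use E in auto)
    also have "E * P = E * 1\<^sub>m e - E * E" unfolding P_def by (rule mult_minus_distrib_mat) (use E in auto)
    also have "\<dots> = 0\<^sub>m e e" using E by (simp add: EE)
    finally show ?thesis using P by (auto intro!: eq_matI)
  qed
  have SE: "\<sigma> g * E = E * \<sigma> g" if g: "g \<in> carrier G" for g
  proof -
    have "\<sigma> g * E = Y * \<rho> g * X" unfolding E_def using assoc_mult_mat[OF Sc[OF g] Y X] SY[OF g] by simp
    also have "\<dots> = Y * (X * \<sigma> g)" using assoc_mult_mat[OF Y Rc[OF g] X] RX[OF g] by simp
    also have "\<dots> = E * \<sigma> g" unfolding E_def using assoc_mult_mat[OF Y X Sc[OF g]] by simp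
    finally show ?thesis .
  qed
  have SP: "\<sigma> g * P = P * \<sigma> g" if g: "g \<in> carrier G" for g
    unfolding P_def using Sc[OF g] E SE[OF g]
    by (simp add: mult_minus_distrib_mat[of _ e e _ e] minus_mult_distrib_mat[of _ e e _ _ e])
  have trP: "mat_trace (\<sigma> g * P) = \<chi> g - \<psi> g" if g: "g \<in> carrier G" for g
  proof -
    have "\<sigma> g * P = \<sigma> g - \<sigma> g * E"
      unfolding P_def using Sc[OF g] E by (simp add: mult_minus_distrib_mat[of _ e e _ e])
    moreover have "mat_trace (\<sigma> g * E) = mat_trace (\<rho> g)"
    proof -
      have "mat_trace (\<sigma> g * E) = mat_trace (\<sigma> g * Y * X)"
        unfolding E_def using assoc_mult_mat[OF Sc[OF g] Y X] by simp
      also have "\<dots> = mat_trace (X * (\<sigma> g * Y))"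
        by (rule mat_trace_mult_comm) (use X Y Sc[OF g] in auto)
      also have "X * (\<sigma> g * Y) = X * Y * \<rho> g" using assoc_mult_mat[OF X Y Rc[OF g]] SY[OF g] by simp
      finally show ?thesis using Rc[OF g] by (simp add: XY)
    qed
    ultimately show ?thesis
      using Sc[OF g] E g by (simp add: mat_trace_minus[of _ e] \<psi>' \<chi>' afforded_character_def)
  qed
  show ?thesis
  proof (cases "\<exists>i<e. \<exists>j<e. P $$ (i, j) \<noteq> 0")
    case False
    then have P0: "P = 0\<^sub>m e e" using P by (intro eq_matI) auto
    have "\<chi> g = \<psi> g" for g
    proof (cases "g \<in> carrier G")
      case True
      then show ?thesis using trP[OF True] Sc[OF True] by (simp add: P0 mat_trace_def)
    qed (simp add: \<psi>' \<chi>' afforded_character_def)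
    then show ?thesis by (auto simp: constituent_def)
  next
    case True
    define \<phi> where "\<phi> = (\<lambda>g\<in>carrier G. \<Sum>i<e. \<Sum>j<e. \<sigma> g $$ (i, j) * P $$ (j, i))"
    have "is_character G \<phi>"
      unfolding \<phi>_def
    proof (rule is_character_commuting_idempotent[OF G representation_indexed_rep[OF G \<sigma>]])
      fix i j assume ij: "i \<in> {..<e}" "j \<in> {..<e}"
      then show "(\<Sum>k<e. P $$ (i, k) * P $$ (k, j)) = P $$ (i, j)"
        using index_mult_mat_sum[OF P P, of i j] PP by simp
      fix g assume g: "g \<in> carrier G"
      show "(\<Sum>k<e. \<sigma> g $$ (i, k) * P $$ (k, j)) = (\<Sum>k<e. P $$ (i, k) * \<sigma> g $$ (k, j))"
        using ij index_mult_mat_sum[OF P Sc[OF g], of i j] index_mult_mat_sum[OF Sc[OF g] P, of i j] SP[OF g]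
        by simp
    qed (use True in auto)
    moreover have "\<phi> g = \<chi> g - \<psi> g" if g: "g \<in> carrier G" for g
      using trP[OF g] Sc[OF g] P g
      by (simp add: \<phi>_def mat_trace_def index_mult_mat_sum[OF Sc[OF g] P])
    then have "\<chi> = (\<lambda>g\<in>carrier G. \<psi> g + \<phi> g)"
      by (auto simp: \<chi>' afforded_character_def)
    ultimately show ?thesis by (auto simp: constituent_def)
  qed
qed

lemma char_form_add:
  assumes G: "group G"
  shows "char_form G (\<lambda>g\<in>carrier G. \<psi> g + \<phi> g) \<chi> = char_form G \<psi> \<chi> + char_form G \<phi> \<chi>"
    and "char_form G \<chi> (\<lambda>g\<in>carrier G. \<psi> g + \<phi> g) = char_form G \<chi> \<psi> + char_form G \<chi> \<phi>"
  using group.inv_closed[OF G]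
  by (simp_all add: char_form_def algebra_simps sum.distrib add_divide_distrib)

text \<open>All forms involved are natural numbers, so the contribution of the common constituent
  cannot cancel.\<close>

lemma common_constituent:
  assumes G: "group G" and fin: "finite (carrier G)"
    and \<psi>: "is_character G \<psi>" and \<chi>': "is_character G \<chi>'"
    and c: "constituent G \<psi> \<chi>" and c': "constituent G \<psi> \<chi>'"
  shows "char_form G \<chi> \<chi>' \<noteq> 0"
proof -
  note nat_form = char_form_characters[OF G fin]
  obtain r :: nat where r: "char_form G \<psi> \<psi> = of_nat r" "r \<noteq> 0"
    using nat_form[OF \<psi> \<psi>] by metis
  obtain s :: nat where s: "char_form G \<psi> \<chi>' = of_nat (r + s)"
  proof -
    consider "\<chi>' = \<psi>" | \<phi> where "is_character G \<phi>" "\<chi>' = (\<lambda>g\<in>carrier G. \<psi> g + \<phi> g)"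
      using c' by (auto simp: constituent_def)
    then show thesis
    proof cases
      case 1
      then show thesis using that[of 0] r by simp
    next
      case (2 \<phi>)
      obtain t :: nat where "char_form G \<psi> \<phi> = of_nat t"
        using nat_form[OF \<psi> 2(1)] by metis
      then show thesis using that[of t] r by (simp add: 2(2) char_form_add[OF G])
    qed
  qed
  consider "\<chi> = \<psi>" | \<phi> where "is_character G \<phi>" "\<chi> = (\<lambda>g\<in>carrier G. \<psi> g + \<phi> g)"
    using c by (auto simp: constituent_def)
  then show ?thesis
  proof cases
    case 1
    then show ?thesis using s r(2) by (simp del: of_nat_add)
  next
    case (2 \<phi>)
    obtain t :: nat where "char_form G \<phi> \<chi>' = of_nat t"
      using nat_form[OF 2(1) \<chi>'] by metis
    then have "char_form G \<chi> \<chi>' = of_nat (r + s + t)"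
      using s by (simp add: 2(2) char_form_add[OF G])
    then show ?thesis using r(2) by (simp del: of_nat_add)
  qed
qed

section \<open>Finite group actions and induced characters\<close>

locale finite_action = group G for G (structure) +
  fixes X :: "'x set" and \<alpha> :: "'a \<Rightarrow> 'x \<Rightarrow> 'x"
  assumes finite_G: "finite (carrier G)" and finite_X: "finite X"
    and act_closed: "g \<in> carrier G \<Longrightarrow> x \<in> X \<Longrightarrow> \<alpha> g x \<in> X"
    and act_one: "x \<in> X \<Longrightarrow> \<alpha> \<one> x = x"
    and act_mult: "g \<in> carrier G \<Longrightarrow> h \<in> carrier G \<Longrightarrow> x \<in> X \<Longrightarrow> \<alpha> (g \<otimes> h) x = \<alpha> g (\<alpha> h x)"
begin

lemma card_G_pos: "0 < card (carrier G)"
  using finite_G carrier_not_empty by (simp add: card_gt_0_iff)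

lemma act_inv: "g \<in> carrier G \<Longrightarrow> x \<in> X \<Longrightarrow> \<alpha> (inv g) (\<alpha> g x) = x"
  "g \<in> carrier G \<Longrightarrow> x \<in> X \<Longrightarrow> \<alpha> g (\<alpha> (inv g) x) = x"
  by (simp_all add: act_mult[symmetric] act_one)

lemma orbit_subset: "x \<in> X \<Longrightarrow> orbit G \<alpha> x \<subseteq> X"
  by (auto simp: orbit_def act_closed)

lemma finite_orbit: "x \<in> X \<Longrightarrow> finite (orbit G \<alpha> x)"
  using orbit_subset finite_X finite_subset by blast

lemma act_in_orbit: "g \<in> carrier G \<Longrightarrow> \<alpha> g x \<in> orbit G \<alpha> x"
  by (auto simp: orbit_def)

lemma self_in_orbit: "x \<in> X \<Longrightarrow> x \<in> orbit G \<alpha> x"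
  using act_in_orbit[OF one_closed, of x] by (simp add: act_one)

lemma card_orbit_pos: "x \<in> X \<Longrightarrow> 0 < card (orbit G \<alpha> x)"
  using self_in_orbit[of x] finite_orbit[of x] by (auto simp: card_gt_0_iff)

lemma orbit_act:
  assumes "x \<in> X" "g \<in> carrier G"
  shows "orbit G \<alpha> (\<alpha> g x) = orbit G \<alpha> x"
proof
  show "orbit G \<alpha> (\<alpha> g x) \<subseteq> orbit G \<alpha> x"
    using assms by (auto simp: orbit_def act_mult[symmetric])
  have "\<alpha> h x = \<alpha> (h \<otimes> inv g) (\<alpha> g x)" if "h \<in> carrier G" for h
    using assms that by (simp add: act_mult act_closed act_inv)
  then show "orbit G \<alpha> x \<subseteq> orbit G \<alpha> (\<alpha> g x)"
    unfolding orbit_def using assms by (blast intro: m_closed inv_closed)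
qed

lemma orbit_eq:
  assumes x: "x \<in> X" and y: "y \<in> orbit G \<alpha> x"
  shows "orbit G \<alpha> y = orbit G \<alpha> x"
proof -
  obtain g where "g \<in> carrier G" "y = \<alpha> g x" using y by (auto simp: orbit_def)
  then show ?thesis using orbit_act[OF x] by simp
qed

lemma orbit_eq_iff:
  assumes x: "x \<in> X" and y: "y \<in> X"
  shows "orbit G \<alpha> y = orbit G \<alpha> x \<longleftrightarrow> y \<in> orbit G \<alpha> x"
  using orbit_eq[OF x] self_in_orbit[OF y] by auto

lemma orbits_disjoint:
  "x \<in> X \<Longrightarrow> y \<in> X \<Longrightarrow> orbit G \<alpha> x \<noteq> orbit G \<alpha> y \<Longrightarrow> orbit G \<alpha> x \<inter> orbit G \<alpha> y = {}"
  using orbit_eq by (metis disjoint_iff)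

text \<open>Orbit counting with weights: the fibres of \<open>g \<mapsto> \<alpha> g x\<close> are
  cosets of the stabilizer, of equal size \<open>s\<close>. The weight 1 identifies
  \<open>s\<close>; the equation is multiplied out to avoid division.\<close>

lemma sum_action:
  fixes F :: "'x \<Rightarrow> complex"
  assumes x: "x \<in> X"
  shows "of_nat (card (orbit G \<alpha> x)) * (\<Sum>g\<in>carrier G. F (\<alpha> g x))
    = of_nat (card (carrier G)) * (\<Sum>y\<in>orbit G \<alpha> x. F y)"
proof -
  define s where "s = card {g \<in> carrier G. \<alpha> g x = x}"
  have fib: "card {g \<in> carrier G. \<alpha> g x = y} = s" if y: "y \<in> orbit G \<alpha> x" for y
  proof -
    obtain h where h: "h \<in> carrier G" "y = \<alpha> h x" using y by (auto simp: orbit_def)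
    have "bij_betw (\<lambda>g. h \<otimes> g) {g \<in> carrier G. \<alpha> g x = x} {g \<in> carrier G. \<alpha> g x = y}"
      by (rule bij_betw_byWitness[where f' = "\<lambda>g. inv h \<otimes> g"])
        (use h x in \<open>auto simp: m_assoc[symmetric] act_mult act_inv\<close>)
    then show ?thesis by (simp add: s_def bij_betw_same_card)
  qed
  have fin: "finite (orbit G \<alpha> x)" using x by (rule finite_orbit)
  have *: "(\<Sum>g\<in>carrier G. F' (\<alpha> g x)) = of_nat s * (\<Sum>y\<in>orbit G \<alpha> x. F' y)" for F' :: "'x \<Rightarrow> complex"
  proof -
    have "(\<Sum>g\<in>carrier G. F' (\<alpha> g x))
      = (\<Sum>y\<in>orbit G \<alpha> x. \<Sum>g\<in>{g \<in> carrier G. \<alpha> g x = y}. F' (\<alpha> g x))"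
      by (rule sum.group[symmetric]) (use finite_G fin in \<open>auto simp: orbit_def\<close>)
    also have "\<dots> = (\<Sum>y\<in>orbit G \<alpha> x. \<Sum>g\<in>{g \<in> carrier G. \<alpha> g x = y}. F' y)"
      by (intro sum.cong refl) simp
    also have "\<dots> = of_nat s * (\<Sum>y\<in>orbit G \<alpha> x. F' y)"
      by (simp add: fib sum_distrib_left)
    finally show ?thesis .
  qed
  from *[of "\<lambda>_. 1"] have "of_nat (card (carrier G)) = (of_nat s * of_nat (card (orbit G \<alpha> x)) :: complex)"
    by simp
  with *[of F] show ?thesis by simp
qed

lemma sum_act:
  assumes g: "g \<in> carrier G"
  shows "(\<Sum>x\<in>X. F (\<alpha> g x)) = (\<Sum>x\<in>X. F x)"
  by (rule sum.reindex_bij_witness[of _ "\<alpha> (inv g)" "\<alpha> g"])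
    (use g in \<open>auto simp: act_closed act_inv\<close>)

lemma sum_act_orbit:
  assumes x: "x \<in> X" and g: "g \<in> carrier G"
  shows "(\<Sum>y\<in>orbit G \<alpha> x. F (\<alpha> g y)) = (\<Sum>y\<in>orbit G \<alpha> x. F y)"
proof -
  have "\<alpha> h y \<in> orbit G \<alpha> x" if "h \<in> carrier G" "y \<in> orbit G \<alpha> x" for h y
    using that x by (auto simp: orbit_def act_mult[symmetric])
  then show ?thesis
    by (intro sum.reindex_bij_witness[of _ "\<alpha> (inv g)" "\<alpha> g"])
      (use g orbit_subset[OF x] in \<open>auto simp: act_inv\<close>)
qed

text \<open>Burnside's count: the weights \<open>1 / card (orbit G \<alpha> x)\<close> add up to 1
  on each orbit, and orbit counting turns each weight into a number of group elements fixing
  \<open>x\<close>.\<close>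

lemma card_orbits:
  "of_nat (card (carrier G)) * of_nat (card (orbit G \<alpha> ` X))
    = (\<Sum>g\<in>carrier G. of_nat (card {x \<in> X. \<alpha> g x = x}) :: complex)"
proof -
  let ?N = "of_nat (card (carrier G)) :: complex"
  have "(\<Sum>x\<in>X. 1 / of_nat (card (orbit G \<alpha> x)) :: complex)
    = (\<Sum>B\<in>orbit G \<alpha> ` X. \<Sum>x\<in>{x \<in> X. orbit G \<alpha> x = B}. 1 / of_nat (card (orbit G \<alpha> x)))"
    by (rule sum.group[symmetric]) (use finite_X in auto)
  also have "\<dots> = (\<Sum>B\<in>orbit G \<alpha> ` X. 1)"
  proof (rule sum.cong[OF refl])
    fix B assume "B \<in> orbit G \<alpha> ` X"
    then obtain x where x: "x \<in> X" "B = orbit G \<alpha> x" by blast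
    have "{y \<in> X. orbit G \<alpha> y = B} = orbit G \<alpha> x"
      using x orbit_eq_iff orbit_subset by blast
    then have "(\<Sum>y\<in>{y \<in> X. orbit G \<alpha> y = B}. 1 / of_nat (card (orbit G \<alpha> y)) :: complex)
      = (\<Sum>y\<in>orbit G \<alpha> x. 1 / of_nat (card (orbit G \<alpha> x)))"
      using x by (intro sum.cong) (auto simp: orbit_eq)
    then show "(\<Sum>y\<in>{y \<in> X. orbit G \<alpha> y = B}. 1 / of_nat (card (orbit G \<alpha> y)) :: complex) = 1"
      using card_orbit_pos[OF x(1)] by simp
  qed
  finally have "?N * of_nat (card (orbit G \<alpha> ` X)) = (\<Sum>x\<in>X. ?N * (1 / of_nat (card (orbit G \<alpha> x))))"
    unfolding sum_distrib_left[symmetric] by simp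
  also have "\<dots> = (\<Sum>x\<in>X. \<Sum>g\<in>carrier G. of_bool (\<alpha> g x = x))"
  proof (rule sum.cong[OF refl])
    fix x assume x: "x \<in> X"
    have "of_nat (card (orbit G \<alpha> x)) * (\<Sum>g\<in>carrier G. of_bool (\<alpha> g x = x)) = ?N * (\<Sum>y\<in>orbit G \<alpha> x. of_bool (y = x))"
      by (rule sum_action[OF x])
    also have "(\<Sum>y\<in>orbit G \<alpha> x. of_bool (y = x)) = (1 :: complex)"
      using self_in_orbit[OF x] finite_orbit[OF x] by (simp add: of_bool_def)
    finally show "?N * (1 / of_nat (card (orbit G \<alpha> x))) = (\<Sum>g\<in>carrier G. of_bool (\<alpha> g x = x))"
      using card_orbit_pos[OF x] by (simp add: field_simps)
  qed
  also have "\<dots> = (\<Sum>g\<in>carrier G. \<Sum>x\<in>X. of_bool (\<alpha> g x = x))"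
    by (rule sum.swap)
  also have "\<dots> = (\<Sum>g\<in>carrier G. of_nat (card {x \<in> X. \<alpha> g x = x}))"
    using finite_X by (intro sum.cong refl) (simp add: Int_def)
  finally show ?thesis .
qed

end

section \<open>Restricted actions and induced linear characters\<close>

lemma orbit_subgroup:
  "orbit (G\<lparr>carrier := H\<rparr>) \<phi> x = (\<lambda>h. \<phi> h x) ` H"
  by (auto simp: orbit_def)

lemma (in finite_action) subgroup_action:
  assumes "subgroup H G"
  shows "finite_action (G\<lparr>carrier := H\<rparr>) X \<alpha>"
proof -
  interpret H: subgroup H G by fact
  interpret HG: group "G\<lparr>carrier := H\<rparr>" by (rule H.subgroup_is_group[OF is_group])
  show ?thesis
    by unfold_locales
      (use finite_subset[OF H.subset finite_G] finite_X in \<open>auto simp: act_closed act_one act_mult\<close>)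
qed

text \<open>On the regular representation, right convolution with \<phi> extended by zero and
  divided by \<open>card L\<close> is an idempotent commuting with left translations. Its image is
  the induced representation, and the trace on it is the Frobenius formula.\<close>

lemma induced_character:
  fixes \<phi> :: "'a \<Rightarrow> complex"
  assumes G: "group G" and fin: "finite (carrier G)" and L: "subgroup L G"
    and hom: "\<And>x y. x \<in> L \<Longrightarrow> y \<in> L \<Longrightarrow> \<phi> (x \<otimes>\<^bsub>G\<^esub> y) = \<phi> x * \<phi> y"
    and ne: "\<And>x. x \<in> L \<Longrightarrow> \<phi> x \<noteq> 0"
  shows "is_character G (\<lambda>v\<in>carrier G. (\<Sum>u\<in>carrier G.
    if u \<otimes>\<^bsub>G\<^esub> v \<otimes>\<^bsub>G\<^esub> inv\<^bsub>G\<^esub> u \<in> L then \<phi> (u \<otimes>\<^bsub>G\<^esub> v \<otimes>\<^bsub>G\<^esub> inv\<^bsub>G\<^esub> u) else 0) / of_nat (card L))"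
proof -
  interpret G: group G by fact
  interpret L: subgroup L G by fact
  note [simp] = G.m_assoc
  define \<phi>0 where "\<phi>0 x = (if x \<in> L then \<phi> x else 0)" for x
  have finL: "finite L" using finite_subset[OF L.subset fin] .
  have L0: "of_nat (card L) \<noteq> (0 :: complex)" using finL L.one_closed
    by (metis card_0_eq empty_iff of_nat_eq_0_iff)
  have \<phi>1: "\<phi> \<one>\<^bsub>G\<^esub> = 1" using hom[of "\<one>\<^bsub>G\<^esub>" "\<one>\<^bsub>G\<^esub>"] ne[OF L.one_closed] by simp
  let ?c = "\<lambda>x y. inv\<^bsub>G\<^esub> x \<otimes>\<^bsub>G\<^esub> y"
  define \<rho> where "\<rho> g x y = (of_bool (x = g \<otimes>\<^bsub>G\<^esub> y) :: complex)" for g x y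
  define P where "P x y = \<phi>0 (?c x y) / of_nat (card L)" for x y
  have split: "(\<Sum>k\<in>carrier G. \<rho> g i k * F k) = F (?c g i)"
    if "g \<in> carrier G" "i \<in> carrier G" for g i F
  proof -
    have "(\<Sum>k\<in>carrier G. \<rho> g i k * F k) = (\<Sum>k\<in>carrier G. if k = ?c g i then F k else 0)"
      by (intro sum.cong refl) (use that in \<open>auto simp: \<rho>_def G.m_assoc[symmetric] simp del: G.m_assoc\<close>)
    also have "\<dots> = F (?c g i)" using fin that by simp
    finally show ?thesis .
  qed
  have split': "(\<Sum>k\<in>carrier G. F k * \<rho> g k j) = F (g \<otimes>\<^bsub>G\<^esub> j)"
    if "g \<in> carrier G" "j \<in> carrier G" for g j F
    using fin that by (simp add: \<rho>_def of_bool_def if_distrib cong: if_cong)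
  have "is_character G (\<lambda>v\<in>carrier G. \<Sum>x\<in>carrier G. \<Sum>y\<in>carrier G. \<rho> v x y * P y x)"
  proof (rule is_character_commuting_idempotent[OF G])
    show "indexed_rep G (carrier G) \<rho>"
      unfolding indexed_rep_def using fin by (auto simp: split') (auto simp: \<rho>_def)
    fix x y assume x: "x \<in> carrier G" and y: "y \<in> carrier G"
    have "(\<Sum>k\<in>carrier G. \<phi>0 (?c x k) * \<phi>0 (?c k y)) = (\<Sum>k\<in>carrier G. \<phi>0 k * \<phi>0 (?c k (?c x y)))"
      using G.sum_left_translation[OF x, of "\<lambda>k. \<phi>0 (?c x k) * \<phi>0 (?c k y)"] x y
      by (simp add: G.inv_mult_group G.m_assoc[symmetric] del: G.m_assoc cong: sum.cong)
    also have "\<dots> = (\<Sum>k\<in>L. \<phi>0 k * \<phi>0 (?c k (?c x y)))"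
      by (rule sum.mono_neutral_right) (use fin in \<open>auto simp: \<phi>0_def\<close>)
    \<comment> \<open>For \<open>k\<close> in \<open>L\<close>, the elements \<open>z\<close> and
      \<open>k^-1 z\<close> lie in \<open>L\<close> together, and multiplicativity gives the same
      product for every \<open>k\<close>.\<close>
    also have "\<dots> = (\<Sum>k\<in>L. \<phi>0 (?c x y))"
    proof (rule sum.cong[OF refl])
      fix k assume k: "k \<in> L"
      then have kG: "k \<in> carrier G" by simp
      let ?z = "?c x y"
      have z: "?z \<in> carrier G" using x y by simp
      have e: "k \<otimes>\<^bsub>G\<^esub> ?c k ?z = ?z" using kG z by (simp add: G.m_assoc[symmetric] del: G.m_assoc)
      have iff: "?c k ?z \<in> L \<longleftrightarrow> ?z \<in> L"
        using k e by (metis L.m_closed L.m_inv_closed)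
      show "\<phi>0 k * \<phi>0 (?c k ?z) = \<phi>0 ?z"
        using hom[of k "?c k ?z"] k iff unfolding \<phi>0_def e by simp
    qed
    finally have "(\<Sum>k\<in>carrier G. \<phi>0 (?c x k) * \<phi>0 (?c k y)) = of_nat (card L) * \<phi>0 (?c x y)" by simp
    then show "(\<Sum>k\<in>carrier G. P x k * P k y) = P x y"
      using L0 by (simp add: P_def sum_divide_distrib[symmetric])
    fix g assume g: "g \<in> carrier G"
    show "(\<Sum>k\<in>carrier G. \<rho> g x k * P k y) = (\<Sum>k\<in>carrier G. P x k * \<rho> g k y)"
      unfolding split[OF g x, of "\<lambda>k. P k y"] split'[OF g y]
      using g x y by (simp add: P_def G.inv_mult_group)
  next
    show "\<exists>x\<in>carrier G. \<exists>y\<in>carrier G. P x y \<noteq> 0"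
      by (rule bexI[of _ "\<one>\<^bsub>G\<^esub>"], rule bexI[of _ "\<one>\<^bsub>G\<^esub>"]) (use L0 \<phi>1 in \<open>simp_all add: P_def \<phi>0_def\<close>)
  qed
  moreover have "(\<Sum>x\<in>carrier G. \<Sum>y\<in>carrier G. \<rho> v x y * P y x)
    = (\<Sum>u\<in>carrier G. if u \<otimes>\<^bsub>G\<^esub> v \<otimes>\<^bsub>G\<^esub> inv\<^bsub>G\<^esub> u \<in> L then \<phi> (u \<otimes>\<^bsub>G\<^esub> v \<otimes>\<^bsub>G\<^esub> inv\<^bsub>G\<^esub> u) else 0)
      / of_nat (card L)" if v: "v \<in> carrier G" for v
  proof -
    have "(\<Sum>x\<in>carrier G. \<Sum>y\<in>carrier G. \<rho> v x y * P y x) = (\<Sum>x\<in>carrier G. \<phi>0 (?c x (v \<otimes>\<^bsub>G\<^esub> x))) / of_nat (card L)"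
    proof -
      have "(\<Sum>y\<in>carrier G. \<rho> v x y * P y x) = \<phi>0 (?c x (v \<otimes>\<^bsub>G\<^esub> x)) / of_nat (card L)"
        if x: "x \<in> carrier G" for x
        unfolding split[OF v x, of "\<lambda>y. P y x"] using v x by (simp add: P_def G.inv_mult_group)
      then show ?thesis by (simp add: sum_divide_distrib)
    qed
    also have "(\<Sum>x\<in>carrier G. \<phi>0 (?c x (v \<otimes>\<^bsub>G\<^esub> x)))
      = (\<Sum>x\<in>carrier G. \<phi>0 (x \<otimes>\<^bsub>G\<^esub> v \<otimes>\<^bsub>G\<^esub> inv\<^bsub>G\<^esub> x))"
      using G.sum_inv[of "\<lambda>x. \<phi>0 (x \<otimes>\<^bsub>G\<^esub> v \<otimes>\<^bsub>G\<^esub> inv\<^bsub>G\<^esub> x)"] v by (simp cong: sum.cong)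
    finally show ?thesis by (simp add: \<phi>0_def)
  qed
  ultimately show ?thesis by (simp cong: restrict_cong)
qed

section \<open>Supercharacter theories from a pair of dual actions\<close>

text \<open>Both images are in bijection with the classes of the common kernel; this reduces
  counting supercharacters and superclasses to counting orbits.\<close>

lemma card_image_cong_kernel:
  assumes "\<And>x y. x \<in> A \<Longrightarrow> y \<in> A \<Longrightarrow> F x = F y \<longleftrightarrow> F' x = F' y"
  shows "card (F ` A) = card (F' ` A)"
proof -
  define r where "r y = (SOME x. x \<in> A \<and> F x = y)" for y
  have r: "r (F x) \<in> A" "F (r (F x)) = F x" if "x \<in> A" for x
    using someI[of "\<lambda>z. z \<in> A \<and> F z = F x" x] that by (auto simp: r_def)
  have "bij_betw (\<lambda>y. F' (r y)) (F ` A) (F' ` A)"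
    unfolding bij_betw_def
  proof
    show "inj_on (\<lambda>y. F' (r y)) (F ` A)"
    proof (rule inj_onI)
      fix y z assume "y \<in> F ` A" "z \<in> F ` A" and e: "F' (r y) = F' (r z)"
      then obtain a b where ab: "a \<in> A" "b \<in> A" "y = F a" "z = F b" by blast
      then show "y = z" using e assms[of "r y" "r z"] r by metis
    qed
    have "F' (r (F x)) = F' x" if "x \<in> A" for x using assms r that by blast
    then show "(\<lambda>y. F' (r y)) ` F ` A = F' ` A" by (simp add: image_image)
  qed
  then show ?thesis by (rule bij_betw_same_card)
qed

lemma sum_mult_of_bool:
  fixes a :: "'b :: semiring_1"
  assumes "finite A"
  shows "(\<Sum>x\<in>A. a * of_bool (P x)) = a * of_nat (card {x \<in> A. P x})"
  using assms unfolding sum_distrib_left[symmetric] by (simp add: Int_def)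

text \<open>Everything specific to matrices is isolated in these assumptions. \<open>pair\<close>
  plays the role of \<theta> applied to the value of a functional, and quotients of pairings replace
  conjugates as in \<open>char_form\<close>. Bijectivity is required of \<open>f\<close>, oddness
  under inversion of \<open>c\<close>; \<open>polarization\<close> states that an
  \<open>H\<close>-orbit sum, evaluated through \<open>c\<close>, is a multiple of a linear
  character of a subgroup extended by zero.\<close>

locale orbit_character_theory = group G +
  V: finite_action G V \<alpha> + D: finite_action G D \<beta>
  for G (structure) and V :: "'v set" and \<alpha> and D :: "'d set" and \<beta> +
  fixes U H :: "'a set" and pair :: "'d \<Rightarrow> 'v \<Rightarrow> complex" and f c :: "'a \<Rightarrow> 'v"
  assumes subgroup_U: "subgroup U G" and normal_H: "normal H G"
    and pair_act: "\<lbrakk>g \<in> carrier G; \<delta> \<in> D; x \<in> V\<rbrakk> \<Longrightarrow> pair (\<beta> g \<delta>) x = pair \<delta> (\<alpha> (inv g) x)"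
    and sum_pair_V: "\<lbrakk>\<delta> \<in> D; \<epsilon> \<in> D\<rbrakk> \<Longrightarrow>
      (\<Sum>x\<in>V. pair \<delta> x / pair \<epsilon> x) = of_nat (card V) * of_bool (\<delta> = \<epsilon>)"
    and sum_pair_D: "\<lbrakk>x \<in> V; y \<in> V\<rbrakk> \<Longrightarrow>
      (\<Sum>\<delta>\<in>D. pair \<delta> x / pair \<delta> y) = of_nat (card D) * of_bool (x = y)"
    and card_V_D: "card V = card D"
    and pair_f_one: "\<delta> \<in> D \<Longrightarrow> pair \<delta> (f \<one>) = 1"
    and bij_f: "bij_betw f U V"
    and c_closed: "v \<in> U \<Longrightarrow> c v \<in> V"
    and f_conj: "\<lbrakk>u \<in> U; v \<in> U\<rbrakk> \<Longrightarrow> f (u \<otimes> v \<otimes> inv u) = \<alpha> u (f v)"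
    and c_conj: "\<lbrakk>u \<in> U; v \<in> U\<rbrakk> \<Longrightarrow> c (u \<otimes> v \<otimes> inv u) = \<alpha> u (c v)"
    and f_orbit_c: "v \<in> U \<Longrightarrow> f v \<in> orbit G \<alpha> (c v)"
    and pair_c_inv: "\<lbrakk>\<delta> \<in> D; v \<in> U\<rbrakk> \<Longrightarrow> pair \<delta> (c (inv v)) = inverse (pair \<delta> (c v))"
    and factorization: "g \<in> carrier G \<Longrightarrow> \<exists>h\<in>H. \<exists>u\<in>U. g = h \<otimes> u"
    and polarization: "\<nu> \<in> D \<Longrightarrow> \<exists>L \<phi>. subgroup L (G\<lparr>carrier := U\<rparr>) \<and>
      (\<forall>x\<in>L. \<forall>y\<in>L. \<phi> (x \<otimes> y) = \<phi> x * \<phi> y) \<and> (\<forall>x\<in>L. \<phi> x \<noteq> 0) \<and>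
      card (orbit (G\<lparr>carrier := H\<rparr>) \<beta> \<nu>) * card L = card U \<and>
      (\<forall>v\<in>U. (\<Sum>\<mu>\<in>orbit (G\<lparr>carrier := H\<rparr>) \<beta> \<nu>. pair \<mu> (c v)) =
        of_nat (card (orbit (G\<lparr>carrier := H\<rparr>) \<beta> \<nu>)) * (if v \<in> L then \<phi> v else 0))"
begin

section \<open>Supercharacters and superclasses in the abstract setting\<close>

abbreviation "UG \<equiv> G\<lparr>carrier := U\<rparr>"
abbreviation "HG \<equiv> G\<lparr>carrier := H\<rparr>"

definition \<chi> where "\<chi> \<nu> = (\<lambda>v\<in>U. of_nat (card (orbit HG \<beta> \<nu>)) / of_nat (card (orbit G \<beta> \<nu>)) *
  (\<Sum>\<mu>\<in>orbit G \<beta> \<nu>. pair \<mu> (f v)))"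

definition \<kappa> where "\<kappa> u = {v \<in> U. f v \<in> orbit G \<alpha> (f u)}"

sublocale U: subgroup U G by (rule subgroup_U)
sublocale H: normal H G by (rule normal_H)

lemma group_UG: "group UG" by (rule U.subgroup_is_group[OF is_group])

lemma inv_UG: "u \<in> U \<Longrightarrow> inv\<^bsub>UG\<^esub> u = inv u"
  by (rule m_inv_consistent[OF subgroup_U])

lemma finite_U: "finite U" by (rule finite_subset[OF U.subset V.finite_G])
lemma finite_UG: "finite (carrier UG)" using finite_U by simp

lemma card_U_pos: "0 < card U" using finite_U U.one_closed by (metis card_gt_0_iff empty_iff)

lemma f_closed: "v \<in> U \<Longrightarrow> f v \<in> V" using bij_f by (auto simp: bij_betw_def)

lemma card_D_pos: "0 < card D"
  using f_closed[OF U.one_closed] V.finite_X unfolding card_V_D[symmetric]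
  by (metis card_gt_0_iff empty_iff)

lemma HD: "finite_action HG D \<beta>" by (rule D.subgroup_action[OF H.subgroup_axioms])
sublocale HD: finite_action HG D \<beta> by (rule HD)

lemma pair_act': "\<lbrakk>g \<in> carrier G; \<delta> \<in> D; x \<in> V\<rbrakk> \<Longrightarrow> pair \<delta> (\<alpha> g x) = pair (\<beta> (inv g) \<delta>) x"
  by (simp add: pair_act)

text \<open>Moving \<open>x\<close> permutes the functionals of the orbit. The function
  \<open>F\<close> is left general because the orthogonality computation needs the inverse of the
  pairing as well as the pairing.\<close>

lemma sum_orbit_invariant:
  assumes \<nu>: "\<nu> \<in> D" and x: "x \<in> V" and g: "g \<in> carrier G"
  shows "(\<Sum>\<mu>\<in>orbit G \<beta> \<nu>. F (pair \<mu> (\<alpha> g x))) = (\<Sum>\<mu>\<in>orbit G \<beta> \<nu>. F (pair \<mu> x))"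
proof -
  have "(\<Sum>\<mu>\<in>orbit G \<beta> \<nu>. F (pair \<mu> (\<alpha> g x))) = (\<Sum>\<mu>\<in>orbit G \<beta> \<nu>. F (pair (\<beta> (inv g) \<mu>) x))"
    by (rule sum.cong[OF refl]) (use D.orbit_subset[OF \<nu>] g x in \<open>auto simp: pair_act'\<close>)
  also have "\<dots> = (\<Sum>\<mu>\<in>orbit G \<beta> \<nu>. F (pair \<mu> x))"
    by (rule D.sum_act_orbit[OF \<nu>]) (use g in simp)
  finally show ?thesis .
qed

lemma sum_orbit_const:
  assumes "\<nu> \<in> D" "x \<in> V" "y \<in> orbit G \<alpha> x"
  shows "(\<Sum>\<mu>\<in>orbit G \<beta> \<nu>. F (pair \<mu> y)) = (\<Sum>\<mu>\<in>orbit G \<beta> \<nu>. F (pair \<mu> x))"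
  using assms sum_orbit_invariant by (auto simp: orbit_def)

lemma \<chi>_c:
  assumes "\<nu> \<in> D" "v \<in> U"
  shows "\<chi> \<nu> v = of_nat (card (orbit HG \<beta> \<nu>)) / of_nat (card (orbit G \<beta> \<nu>)) *
    (\<Sum>\<mu>\<in>orbit G \<beta> \<nu>. pair \<mu> (c v))"
  using sum_orbit_const[OF assms(1) c_closed[OF assms(2)] f_orbit_c[OF assms(2)], of "\<lambda>z. z"] assms
  by (simp add: \<chi>_def)

text \<open>Averaging over \<open>G = H U\<close> turns the sum over the \<open>G\<close>-orbit into a sum over \<open>U\<close>-conjugates
  of a sum over the \<open>H\<close>-orbit; the latter is a multiple of a linear character of \<open>L\<close>, extended by zero.\<close>

lemma sum_orbit_average:
  assumes \<nu>: "\<nu> \<in> D" and x: "x \<in> V"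
  shows "of_nat (card (orbit HG \<beta> \<nu>)) / of_nat (card (orbit G \<beta> \<nu>)) * (\<Sum>\<mu>\<in>orbit G \<beta> \<nu>. pair \<mu> x)
    = (\<Sum>u\<in>U. \<Sum>\<mu>\<in>orbit HG \<beta> \<nu>. pair \<mu> (\<alpha> u x)) / of_nat (card U)"
proof -
  define S where "S y = (\<Sum>\<mu>\<in>orbit HG \<beta> \<nu>. pair \<mu> y)" for y
  let ?h = "of_nat (card (orbit HG \<beta> \<nu>)) :: complex" and ?o = "of_nat (card (orbit G \<beta> \<nu>)) :: complex"
    and ?G = "of_nat (card (carrier G)) :: complex" and ?U = "of_nat (card U) :: complex"
    and ?H = "of_nat (card H) :: complex"
  have o: "?o \<noteq> 0" using D.card_orbit_pos[OF \<nu>] by simp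
  have G0: "?G \<noteq> 0" using V.card_G_pos by simp
  have U0: "?U \<noteq> 0" using card_U_pos by simp
  have H0: "?H \<noteq> 0" using HD.card_G_pos by simp
  have S_inv: "S (\<alpha> h y) = S y" if h: "h \<in> H" and y: "y \<in> V" for h y
  proof -
    have hG: "h \<in> carrier G" "inv h \<in> carrier HG" using h by auto
    have "S (\<alpha> h y) = (\<Sum>\<mu>\<in>orbit HG \<beta> \<nu>. pair (\<beta> (inv h) \<mu>) y)"
      unfolding S_def
      by (rule sum.cong[OF refl]) (use HD.orbit_subset[OF \<nu>] hG y in \<open>auto simp: pair_act'\<close>)
    also have "\<dots> = S y" unfolding S_def by (rule HD.sum_act_orbit[OF \<nu> hG(2)])
    finally show ?thesis .
  qed
  have "?o * (\<Sum>g\<in>carrier G. pair (\<beta> g \<nu>) x) = ?G * (\<Sum>\<mu>\<in>orbit G \<beta> \<nu>. pair \<mu> x)"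
    by (rule D.sum_action[OF \<nu>, of "\<lambda>\<mu>. pair \<mu> x"])
  moreover have "(\<Sum>g\<in>carrier G. pair (\<beta> g \<nu>) x) = (\<Sum>g\<in>carrier G. pair \<nu> (\<alpha> g x))"
    using sum_inv[of "\<lambda>g. pair \<nu> (\<alpha> g x)"] \<nu> x by (simp add: pair_act cong: sum.cong)
  ultimately have 1: "(\<Sum>\<mu>\<in>orbit G \<beta> \<nu>. pair \<mu> x) = ?o / ?G * (\<Sum>g\<in>carrier G. pair \<nu> (\<alpha> g x))"
    using G0 by (simp add: field_simps)
  \<comment> \<open>Expanding \<open>S\<close> as an average over \<open>H\<close> turns each
    summand into a translate of the sum over \<open>G\<close>, and the translation by an element of
    \<open>H\<close> can be absorbed.\<close>
  have 2: "?H * (\<Sum>g\<in>carrier G. S (\<alpha> g x)) = ?h * ?H * (\<Sum>g\<in>carrier G. pair \<nu> (\<alpha> g x))"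
  proof -
    have "?H * (\<Sum>g\<in>carrier G. S (\<alpha> g x)) = (\<Sum>g\<in>carrier G. ?h * (\<Sum>h\<in>H. pair (\<beta> h \<nu>) (\<alpha> g x)))"
    proof -
      have "?H * S y = ?h * (\<Sum>h\<in>H. pair (\<beta> h \<nu>) y)" for y
        using HD.sum_action[OF \<nu>, of "\<lambda>\<mu>. pair \<mu> y"] by (simp add: S_def)
      then show ?thesis by (simp add: sum_distrib_left[of ?H])
    qed
    also have "\<dots> = ?h * (\<Sum>h\<in>H. \<Sum>g\<in>carrier G. pair (\<beta> h \<nu>) (\<alpha> g x))"
      by (simp add: sum_distrib_left[symmetric] sum.swap[of _ "carrier G" H])
    also have "\<dots> = ?h * (\<Sum>h\<in>H. \<Sum>g\<in>carrier G. pair \<nu> (\<alpha> g x))"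
    proof -
      have "(\<Sum>g\<in>carrier G. pair (\<beta> h \<nu>) (\<alpha> g x)) = (\<Sum>g\<in>carrier G. pair \<nu> (\<alpha> g x))"
        if h: "h \<in> H" for h
      proof -
        have "pair (\<beta> h \<nu>) (\<alpha> g x) = pair \<nu> (\<alpha> (inv h \<otimes> g) x)" if "g \<in> carrier G" for g
          using h that \<nu> x by (simp add: pair_act V.act_mult V.act_closed)
        then show ?thesis
          using sum_left_translation[of "inv h" "\<lambda>g. pair \<nu> (\<alpha> g x)"] h by (simp cong: sum.cong)
      qed
      then show ?thesis by simp
    qed
    also have "\<dots> = ?h * ?H * (\<Sum>g\<in>carrier G. pair \<nu> (\<alpha> g x))" by simp
    finally show ?thesis .
  qed
  \<comment> \<open>A sum over \<open>G\<close> and \<open>U\<close> is computed in two ways. With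
    \<open>g = h w\<close>, the factor \<open>h\<close> is invisible to \<open>S\<close> and
    \<open>w\<close> permutes \<open>U\<close>; on the other side \<open>u\<close> is absorbed by
    right translation in \<open>G\<close>.\<close>
  have 3: "?U * (\<Sum>g\<in>carrier G. S (\<alpha> g x)) = ?G * (\<Sum>u\<in>U. S (\<alpha> u x))"
  proof -
    have "(\<Sum>u\<in>U. S (\<alpha> (g \<otimes> u) x)) = (\<Sum>u\<in>U. S (\<alpha> u x))" if g: "g \<in> carrier G" for g
    proof -
      obtain h w where hw: "h \<in> H" "w \<in> U" "g = h \<otimes> w" using factorization[OF g] by blast
      have "S (\<alpha> (g \<otimes> u) x) = S (\<alpha> (w \<otimes> u) x)" if "u \<in> U" for u
        using hw that x S_inv[OF hw(1), of "\<alpha> (w \<otimes> u) x"]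
        by (simp add: m_assoc V.act_mult V.act_closed)
      then show ?thesis
        using group.sum_left_translation[OF group_UG, of w "\<lambda>u. S (\<alpha> u x)"] hw by simp
    qed
    then have "?G * (\<Sum>u\<in>U. S (\<alpha> u x)) = (\<Sum>g\<in>carrier G. \<Sum>u\<in>U. S (\<alpha> (g \<otimes> u) x))" by simp
    also have "\<dots> = (\<Sum>u\<in>U. \<Sum>g\<in>carrier G. S (\<alpha> (g \<otimes> u) x))" by (rule sum.swap)
    also have "\<dots> = (\<Sum>u\<in>U. \<Sum>g\<in>carrier G. S (\<alpha> g x))"
      by (rule sum.cong[OF refl], rule sum_right_translation) simp
    finally show ?thesis by simp
  qed
  have "?h * (\<Sum>g\<in>carrier G. pair \<nu> (\<alpha> g x)) = (\<Sum>g\<in>carrier G. S (\<alpha> g x))"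
    using 2 H0 by (simp add: mult.assoc mult.left_commute[of _ ?H])
  also have "\<dots> = ?G * (\<Sum>u\<in>U. S (\<alpha> u x)) / ?U" using 3 U0 by (simp add: field_simps)
  finally have "?h / ?o * (\<Sum>\<mu>\<in>orbit G \<beta> \<nu>. pair \<mu> x) = (\<Sum>u\<in>U. S (\<alpha> u x)) / ?U"
    unfolding 1 using o G0 by simp
  then show ?thesis by (simp add: S_def)
qed

text \<open>By the average over \<open>U\<close> and the equivariance of \<open>c\<close>, the value
  becomes a Frobenius sum for the linear character of \<open>L\<close>; the identity
  \<open>card (orbit HG \<beta> \<nu>) * card L = card U\<close> matches the normalizing
  factors.\<close>

lemma is_character_\<chi>:
  assumes \<nu>: "\<nu> \<in> D"
  shows "is_character UG (\<chi> \<nu>)"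
proof -
  interpret UG: group UG by (rule group_UG)
  let ?h = "of_nat (card (orbit HG \<beta> \<nu>)) :: complex"
  obtain L \<phi> where L: "subgroup L UG"
    and hom: "\<And>x y. x \<in> L \<Longrightarrow> y \<in> L \<Longrightarrow> \<phi> (x \<otimes> y) = \<phi> x * \<phi> y" and ne: "\<And>x. x \<in> L \<Longrightarrow> \<phi> x \<noteq> 0"
    and card: "card (orbit HG \<beta> \<nu>) * card L = card U"
    and S: "\<And>v. v \<in> U \<Longrightarrow> (\<Sum>\<mu>\<in>orbit HG \<beta> \<nu>. pair \<mu> (c v)) = ?h * (if v \<in> L then \<phi> v else 0)"
    using polarization[OF \<nu>] by blast
  have card': "?h * of_nat (card L) = of_nat (card U)" unfolding card[symmetric] by simp
  have ind: "is_character UG (\<lambda>v\<in>U. (\<Sum>u\<in>U. if u \<otimes> v \<otimes> inv\<^bsub>UG\<^esub> u \<in> L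
      then \<phi> (u \<otimes> v \<otimes> inv\<^bsub>UG\<^esub> u) else 0) / of_nat (card L))"
    using induced_character[OF group_UG _ L, of \<phi>] hom ne finite_U by (simp cong: if_cong)
  have "\<chi> \<nu> = (\<lambda>v\<in>U. (\<Sum>u\<in>U. if u \<otimes> v \<otimes> inv\<^bsub>UG\<^esub> u \<in> L
      then \<phi> (u \<otimes> v \<otimes> inv\<^bsub>UG\<^esub> u) else 0) / of_nat (card L))"
  proof
    fix v
    show "\<chi> \<nu> v = (\<lambda>v\<in>U. (\<Sum>u\<in>U. if u \<otimes> v \<otimes> inv\<^bsub>UG\<^esub> u \<in> L
      then \<phi> (u \<otimes> v \<otimes> inv\<^bsub>UG\<^esub> u) else 0) / of_nat (card L)) v"
    proof (cases "v \<in> U")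
      case v: True
      have "\<chi> \<nu> v = (\<Sum>u\<in>U. \<Sum>\<mu>\<in>orbit HG \<beta> \<nu>. pair \<mu> (\<alpha> u (c v))) / of_nat (card U)"
        using \<chi>_c[OF \<nu> v] sum_orbit_average[OF \<nu> c_closed[OF v]] by simp
      also have "\<dots> = (\<Sum>u\<in>U. \<Sum>\<mu>\<in>orbit HG \<beta> \<nu>. pair \<mu> (c (u \<otimes> v \<otimes> inv u))) / of_nat (card U)"
        using v by (simp add: c_conj)
      also have "\<dots> = (\<Sum>u\<in>U. ?h * (if u \<otimes> v \<otimes> inv u \<in> L then \<phi> (u \<otimes> v \<otimes> inv u) else 0)) / of_nat (card U)"
        using v by (simp add: S)
      also have "\<dots> = ?h * (\<Sum>u\<in>U. if u \<otimes> v \<otimes> inv\<^bsub>UG\<^esub> u \<in> L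
        then \<phi> (u \<otimes> v \<otimes> inv\<^bsub>UG\<^esub> u) else 0) / of_nat (card U)"
        by (simp only: sum_distrib_left[symmetric] inv_UG cong: sum.cong)
      finally show ?thesis
        using v HD.card_orbit_pos[OF \<nu>] by (simp add: card'[symmetric])
    qed (simp add: \<chi>_def)
  qed
  with ind show ?thesis by simp
qed

text \<open>Oddness of \<open>c\<close> rewrites the value at an inverse, and invariance of orbit
  sums passes back to \<open>f\<close>. Bijectivity of \<open>f\<close> then gives a double sum of
  Fourier pairings over \<open>V\<close>, all between different functionals because the orbits are
  disjoint.\<close>

lemma char_form_\<chi>:
  assumes \<nu>: "\<nu> \<in> D" and \<mu>: "\<mu> \<in> D" and ne: "orbit G \<beta> \<nu> \<noteq> orbit G \<beta> \<mu>"
  shows "char_form UG (\<chi> \<nu>) (\<chi> \<mu>) = 0"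
proof -
  let ?k = "\<lambda>\<nu>. of_nat (card (orbit HG \<beta> \<nu>)) / of_nat (card (orbit G \<beta> \<nu>)) :: complex"
  have inv: "\<chi> \<mu> (inv v) = ?k \<mu> * (\<Sum>\<epsilon>\<in>orbit G \<beta> \<mu>. inverse (pair \<epsilon> (f v)))" if v: "v \<in> U" for v
  proof -
    have "\<chi> \<mu> (inv v) = ?k \<mu> * (\<Sum>\<epsilon>\<in>orbit G \<beta> \<mu>. pair \<epsilon> (c (inv v)))"
      using v by (simp add: \<chi>_c[OF \<mu>])
    also have "(\<Sum>\<epsilon>\<in>orbit G \<beta> \<mu>. pair \<epsilon> (c (inv v))) = (\<Sum>\<epsilon>\<in>orbit G \<beta> \<mu>. inverse (pair \<epsilon> (c v)))"
      using D.orbit_subset[OF \<mu>] v by (intro sum.cong refl pair_c_inv) auto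
    also have "\<dots> = (\<Sum>\<epsilon>\<in>orbit G \<beta> \<mu>. inverse (pair \<epsilon> (f v)))"
      by (rule sum_orbit_const[OF \<mu> c_closed[OF v] f_orbit_c[OF v], symmetric])
    finally show ?thesis .
  qed
  have "(\<Sum>v\<in>U. \<chi> \<nu> v * \<chi> \<mu> (inv v))
    = (\<Sum>v\<in>U. ?k \<nu> * ?k \<mu> * (\<Sum>\<delta>\<in>orbit G \<beta> \<nu>. \<Sum>\<epsilon>\<in>orbit G \<beta> \<mu>. pair \<delta> (f v) / pair \<epsilon> (f v)))"
  proof (rule sum.cong[OF refl])
    fix v assume v: "v \<in> U"
    have "(\<Sum>\<delta>\<in>orbit G \<beta> \<nu>. \<Sum>\<epsilon>\<in>orbit G \<beta> \<mu>. pair \<delta> (f v) / pair \<epsilon> (f v))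
      = (\<Sum>\<delta>\<in>orbit G \<beta> \<nu>. pair \<delta> (f v)) * (\<Sum>\<epsilon>\<in>orbit G \<beta> \<mu>. inverse (pair \<epsilon> (f v)))"
      by (simp add: sum_product divide_inverse)
    moreover have "\<chi> \<nu> v = ?k \<nu> * (\<Sum>\<delta>\<in>orbit G \<beta> \<nu>. pair \<delta> (f v))" using v by (simp add: \<chi>_def)
    ultimately show "\<chi> \<nu> v * \<chi> \<mu> (inv v)
      = ?k \<nu> * ?k \<mu> * (\<Sum>\<delta>\<in>orbit G \<beta> \<nu>. \<Sum>\<epsilon>\<in>orbit G \<beta> \<mu>. pair \<delta> (f v) / pair \<epsilon> (f v))"
      by (simp only: inv[OF v] mult_ac)
  qed
  also have "\<dots> = ?k \<nu> * ?k \<mu> * (\<Sum>x\<in>V. \<Sum>\<delta>\<in>orbit G \<beta> \<nu>. \<Sum>\<epsilon>\<in>orbit G \<beta> \<mu>. pair \<delta> x / pair \<epsilon> x)"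
    unfolding sum_distrib_left[symmetric]
    by (simp only: sum.reindex_bij_betw[OF bij_f, of "\<lambda>x. \<Sum>\<delta>\<in>orbit G \<beta> \<nu>. \<Sum>\<epsilon>\<in>orbit G \<beta> \<mu>. pair \<delta> x / pair \<epsilon> x"])
  also have "(\<Sum>x\<in>V. \<Sum>\<delta>\<in>orbit G \<beta> \<nu>. \<Sum>\<epsilon>\<in>orbit G \<beta> \<mu>. pair \<delta> x / pair \<epsilon> x)
    = (\<Sum>\<delta>\<in>orbit G \<beta> \<nu>. \<Sum>\<epsilon>\<in>orbit G \<beta> \<mu>. \<Sum>x\<in>V. pair \<delta> x / pair \<epsilon> x)"
    by (subst sum.swap, rule sum.cong[OF refl], rule sum.swap)
  also have "\<dots> = 0"
  proof -
    have "(\<Sum>x\<in>V. pair \<delta> x / pair \<epsilon> x) = 0" if "\<delta> \<in> orbit G \<beta> \<nu>" "\<epsilon> \<in> orbit G \<beta> \<mu>" for \<delta> \<epsilon>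
    proof -
      have "\<delta> \<in> D" "\<epsilon> \<in> D" "\<delta> \<noteq> \<epsilon>"
        using that D.orbit_subset[OF \<nu>] D.orbit_subset[OF \<mu>] D.orbits_disjoint[OF \<nu> \<mu> ne] by blast+
      then show ?thesis by (simp add: sum_pair_V)
    qed
    then show ?thesis by simp
  qed
  finally show ?thesis by (simp add: char_form_def inv_UG)
qed

text \<open>Normality of \<open>H\<close> makes \<open>g\<close> carry \<open>H\<close>-orbits to
  \<open>H\<close>-orbits, so the prefactor of a supercharacter depends on the
  \<open>G\<close>-orbit only.\<close>

lemma card_H_orbit_act:
  assumes \<nu>: "\<nu> \<in> D" and g: "g \<in> carrier G"
  shows "card (orbit HG \<beta> (\<beta> g \<nu>)) = card (orbit HG \<beta> \<nu>)"
proof -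
  have le: "card (orbit HG \<beta> (\<beta> g \<nu>)) \<le> card (orbit HG \<beta> \<nu>)" if \<nu>: "\<nu> \<in> D" and g: "g \<in> carrier G" for \<nu> g
  proof -
    have "\<beta> h (\<beta> g \<nu>) \<in> \<beta> g ` orbit HG \<beta> \<nu>" if h: "h \<in> H" for h
    proof -
      have hG: "h \<in> carrier G" using h by simp
      have "\<beta> h (\<beta> g \<nu>) = \<beta> (h \<otimes> g) \<nu>" using g hG \<nu> by (simp add: D.act_mult)
      also have "h \<otimes> g = g \<otimes> (inv g \<otimes> h \<otimes> g)" using g hG by (simp add: m_assoc[symmetric])
      also have "\<beta> \<dots> \<nu> = \<beta> g (\<beta> (inv g \<otimes> h \<otimes> g) \<nu>)" using g hG \<nu> by (simp add: D.act_mult)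
      finally have "\<beta> h (\<beta> g \<nu>) = \<beta> g (\<beta> (inv g \<otimes> h \<otimes> g) \<nu>)" .
      moreover have "inv g \<otimes> h \<otimes> g \<in> H" using H.inv_op_closed1[OF g h] .
      ultimately show ?thesis by (auto simp: orbit_subgroup)
    qed
    then have "orbit HG \<beta> (\<beta> g \<nu>) \<subseteq> \<beta> g ` orbit HG \<beta> \<nu>" by (auto simp: orbit_subgroup)
    then have "card (orbit HG \<beta> (\<beta> g \<nu>)) \<le> card (\<beta> g ` orbit HG \<beta> \<nu>)"
      using HD.finite_orbit[OF \<nu>] by (intro card_mono) auto
    also have "\<dots> \<le> card (orbit HG \<beta> \<nu>)" by (rule card_image_le[OF HD.finite_orbit[OF \<nu>]])
    finally show ?thesis .
  qed
  show ?thesis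
    using le[OF \<nu> g] le[OF D.act_closed[OF g \<nu>], of "inv g"] g \<nu> by (simp add: D.act_inv)
qed

text \<open>Supercharacters of distinct orbits are orthogonal, whereas \<open>char_form\<close> of a
  character with itself is never zero.\<close>

lemma \<chi>_eq_iff:
  assumes \<nu>: "\<nu> \<in> D" and \<mu>: "\<mu> \<in> D"
  shows "\<chi> \<nu> = \<chi> \<mu> \<longleftrightarrow> orbit G \<beta> \<nu> = orbit G \<beta> \<mu>"
proof
  assume eq: "\<chi> \<nu> = \<chi> \<mu>"
  show "orbit G \<beta> \<nu> = orbit G \<beta> \<mu>"
  proof (rule ccontr)
    assume "orbit G \<beta> \<nu> \<noteq> orbit G \<beta> \<mu>"
    from char_form_\<chi>[OF \<nu> \<mu> this] have "char_form UG (\<chi> \<mu>) (\<chi> \<mu>) = 0" by (simp add: eq)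
    moreover obtain r where "char_form UG (\<chi> \<mu>) (\<chi> \<mu>) = of_nat r" "r \<noteq> 0"
      using char_form_characters[OF group_UG finite_UG is_character_\<chi>[OF \<mu>] is_character_\<chi>[OF \<mu>]]
      by metis
    ultimately show False by simp
  qed
next
  assume o: "orbit G \<beta> \<nu> = orbit G \<beta> \<mu>"
  then obtain g where g: "g \<in> carrier G" "\<nu> = \<beta> g \<mu>"
    using D.self_in_orbit[OF \<nu>] by (auto simp: orbit_def)
  have "card (orbit HG \<beta> \<nu>) = card (orbit HG \<beta> \<mu>)" using card_H_orbit_act[OF \<mu> g(1)] g(2) by simp
  with o show "\<chi> \<nu> = \<chi> \<mu>" by (simp add: \<chi>_def)
qed

text \<open>The double sum of \<open>pair \<delta> (\<alpha> g x) / pair \<delta> x\<close> counts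
  the fixed points of \<open>g\<close> on \<open>V\<close> when summed over \<delta> first, and
  those of its inverse on \<open>D\<close> when summed over \<open>x\<close> first. Equal
  fixed-point numbers give equally many orbits.\<close>

lemma card_orbits_eq: "card (orbit G \<alpha> ` V) = card (orbit G \<beta> ` D)"
proof -
  let ?G = "of_nat (card (carrier G)) :: complex" and ?D = "of_nat (card D) :: complex"
  have D0: "?D \<noteq> 0" using card_D_pos by simp
  have "of_nat (card {x \<in> V. \<alpha> g x = x}) = (of_nat (card {\<delta> \<in> D. \<beta> (inv g) \<delta> = \<delta>}) :: complex)"
    if g: "g \<in> carrier G" for g
  proof -
    have "?D * of_nat (card {x \<in> V. \<alpha> g x = x}) = (\<Sum>x\<in>V. ?D * of_bool (\<alpha> g x = x))"
      by (rule sum_mult_of_bool[OF V.finite_X, symmetric])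
    also have "\<dots> = (\<Sum>x\<in>V. \<Sum>\<delta>\<in>D. pair \<delta> (\<alpha> g x) / pair \<delta> x)"
      by (rule sum.cong[OF refl], rule sum_pair_D[symmetric]) (use g V.act_closed in auto)
    also have "\<dots> = (\<Sum>\<delta>\<in>D. \<Sum>x\<in>V. pair (\<beta> (inv g) \<delta>) x / pair \<delta> x)"
      using g by (subst sum.swap) (simp add: pair_act' cong: sum.cong)
    also have "\<dots> = (\<Sum>\<delta>\<in>D. ?D * of_bool (\<beta> (inv g) \<delta> = \<delta>))"
      unfolding card_V_D[symmetric]
      by (rule sum.cong[OF refl], rule sum_pair_V) (use g D.act_closed in auto)
    also have "\<dots> = ?D * of_nat (card {\<delta> \<in> D. \<beta> (inv g) \<delta> = \<delta>})"
      by (rule sum_mult_of_bool[OF D.finite_X])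
    finally show ?thesis using D0 by simp
  qed
  then have "?G * of_nat (card (orbit G \<alpha> ` V)) = (\<Sum>g\<in>carrier G. of_nat (card {\<delta> \<in> D. \<beta> (inv g) \<delta> = \<delta>}))"
    by (simp add: V.card_orbits)
  also have "\<dots> = ?G * of_nat (card (orbit G \<beta> ` D))"
    unfolding D.card_orbits by (rule sum_inv)
  finally have "(of_nat (card (orbit G \<alpha> ` V)) :: complex) = of_nat (card (orbit G \<beta> ` D))"
    using V.card_G_pos by simp
  then show ?thesis by (simp only: of_nat_eq_iff)
qed

lemma \<kappa>_eq_iff:
  assumes "u \<in> U" "v \<in> U"
  shows "\<kappa> u = \<kappa> v \<longleftrightarrow> orbit G \<alpha> (f u) = orbit G \<alpha> (f v)"
proof
  assume "\<kappa> u = \<kappa> v"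
  moreover have "u \<in> \<kappa> u" using assms V.self_in_orbit f_closed by (simp add: \<kappa>_def)
  ultimately have "f u \<in> orbit G \<alpha> (f v)" by (auto simp: \<kappa>_def)
  then show "orbit G \<alpha> (f u) = orbit G \<alpha> (f v)" using V.orbit_eq f_closed assms by blast
qed (simp add: \<kappa>_def)

lemma card_\<kappa>: "card (\<kappa> ` U) = card (orbit G \<alpha> ` V)"
proof -
  have "card (\<kappa> ` U) = card ((\<lambda>u. orbit G \<alpha> (f u)) ` U)"
    by (rule card_image_cong_kernel) (rule \<kappa>_eq_iff)
  also have "(\<lambda>u. orbit G \<alpha> (f u)) ` U = orbit G \<alpha> ` V"
    using bij_f by (auto simp: bij_betw_def)
  finally show ?thesis .
qed

text \<open>Weighting each \<open>\<chi> \<nu>\<close> by the inverse size of its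
  \<open>H\<close>-orbit gives \<open>card D\<close> times the indicator of the identity. Pairing
  this with \<psi> yields a nonzero multiple of its degree, so some single pairing is
  nonzero.\<close>

lemma exists_constituent:
  assumes \<psi>: "is_irreducible_character UG \<psi>"
  shows "\<exists>\<nu>\<in>D. constituent UG \<psi> (\<chi> \<nu>)"
proof -
  interpret UG: group UG by (rule group_UG)
  have "is_character UG \<psi>"
    using \<psi> by (auto simp: is_irreducible_character_def is_character_def irreducible_representation_def)
  then obtain d \<rho> where d: "0 < d" and \<rho>: "indexed_rep UG {..<d::nat} \<rho>"
    and \<psi>': "\<psi> = (\<lambda>g\<in>carrier UG. \<Sum>i<d. \<rho> g i i)"
    by (rule is_characterE[OF group_UG])
  have \<psi>1: "\<psi> \<one> = of_nat d" using indexed_repD(2)[OF \<rho>] by (simp add: \<psi>')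
  have card_D: "of_nat (card D) \<noteq> (0 :: complex)" using card_D_pos by simp
  have reg: "(\<Sum>\<nu>\<in>D. \<chi> \<nu> v / of_nat (card (orbit HG \<beta> \<nu>))) = of_nat (card D) * of_bool (v = \<one>)"
    if v: "v \<in> U" for v
  proof -
    let ?G = "of_nat (card (carrier G)) :: complex"
    have fv: "f v \<in> V" and f1: "f \<one> \<in> V" using f_closed v by auto
    \<comment> \<open>The average over an orbit is written as an average over \<open>G\<close>; each
      group element then permutes \<open>D\<close>, so the orbits disappear from the sum.\<close>
    have "(\<Sum>\<nu>\<in>D. \<chi> \<nu> v / of_nat (card (orbit HG \<beta> \<nu>))) = (\<Sum>\<nu>\<in>D. (\<Sum>g\<in>carrier G. pair (\<beta> g \<nu>) (f v)) / ?G)"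
    proof (rule sum.cong[OF refl])
      fix \<nu> assume \<nu>: "\<nu> \<in> D"
      have "\<chi> \<nu> v / of_nat (card (orbit HG \<beta> \<nu>)) = (\<Sum>\<mu>\<in>orbit G \<beta> \<nu>. pair \<mu> (f v)) / of_nat (card (orbit G \<beta> \<nu>))"
        using v HD.card_orbit_pos[OF \<nu>] by (simp add: \<chi>_def)
      also have "\<dots> = (\<Sum>g\<in>carrier G. pair (\<beta> g \<nu>) (f v)) / ?G"
        using D.sum_action[OF \<nu>, of "\<lambda>\<mu>. pair \<mu> (f v)"] D.card_orbit_pos[OF \<nu>] V.card_G_pos
        by (simp add: field_simps)
      finally show "\<chi> \<nu> v / of_nat (card (orbit HG \<beta> \<nu>)) = (\<Sum>g\<in>carrier G. pair (\<beta> g \<nu>) (f v)) / ?G" .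
    qed
    also have "\<dots> = (\<Sum>g\<in>carrier G. \<Sum>\<nu>\<in>D. pair (\<beta> g \<nu>) (f v)) / ?G"
      unfolding sum_divide_distrib[symmetric] by (subst sum.swap) simp
    also have "(\<Sum>g\<in>carrier G. \<Sum>\<nu>\<in>D. pair (\<beta> g \<nu>) (f v)) = ?G * (\<Sum>\<nu>\<in>D. pair \<nu> (f v))"
      by (simp add: D.sum_act[of _ "\<lambda>\<nu>. pair \<nu> (f v)"])
    also have "(\<Sum>\<nu>\<in>D. pair \<nu> (f v)) = (\<Sum>\<nu>\<in>D. pair \<nu> (f v) / pair \<nu> (f \<one>))"
      by (simp add: pair_f_one)
    also have "\<dots> = of_nat (card D) * of_bool (f v = f \<one>)"
      using sum_pair_D[OF fv f1] .
    also have "f v = f \<one> \<longleftrightarrow> v = \<one>"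
      using bij_f v by (auto simp: bij_betw_def inj_on_eq_iff)
    finally show ?thesis using V.card_G_pos by simp
  qed
  have "\<exists>\<nu>\<in>D. char_form UG \<psi> (\<chi> \<nu>) \<noteq> 0"
  proof (rule ccontr)
    assume "\<not> ?thesis"
    then have 0: "(\<Sum>v\<in>U. \<psi> v * \<chi> \<nu> (inv v)) = 0" if "\<nu> \<in> D" for \<nu>
      using that card_U_pos by (auto simp: char_form_def inv_UG)
    have "of_nat (card D) * \<psi> \<one> = (\<Sum>v\<in>U. \<psi> v * (of_nat (card D) * of_bool (inv v = \<one>)))"
      using finite_U by (simp add: of_bool_def if_distrib[of "\<lambda>x. _ * x"] cong: if_cong)
    also have "\<dots> = (\<Sum>v\<in>U. \<Sum>\<nu>\<in>D. \<psi> v * (\<chi> \<nu> (inv v) / of_nat (card (orbit HG \<beta> \<nu>))))"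
      unfolding sum_distrib_left[symmetric] by (simp add: reg)
    also have "\<dots> = (\<Sum>\<nu>\<in>D. (\<Sum>v\<in>U. \<psi> v * \<chi> \<nu> (inv v)) / of_nat (card (orbit HG \<beta> \<nu>)))"
      by (subst sum.swap) (simp add: sum_divide_distrib)
    also have "\<dots> = 0" by (simp add: 0)
    finally show False using card_D d \<psi>1 by simp
  qed
  then show ?thesis
    using irreducible_constituent[OF group_UG finite_UG \<psi> is_character_\<chi>] by blast
qed

lemma conjugacy_class_\<kappa>:
  assumes u: "u \<in> U" and v: "v \<in> \<kappa> u"
  shows "conjugacy_class UG v \<subseteq> \<kappa> u"
proof
  fix w assume "w \<in> conjugacy_class UG v"
  then obtain g where "g \<in> U" "w = g \<otimes> v \<otimes> inv\<^bsub>UG\<^esub> g"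
    unfolding conjugacy_class_def orbit_def by auto
  then have g: "g \<in> U" "w = g \<otimes> v \<otimes> inv g" by (simp_all add: inv_UG)
  have vU: "v \<in> U" and fv: "f v \<in> orbit G \<alpha> (f u)" using v by (auto simp: \<kappa>_def)
  have "f w = \<alpha> g (f v)" using g vU by (simp add: f_conj)
  also have "\<dots> \<in> orbit G \<alpha> (f v)" using g by (intro V.act_in_orbit) simp
  also have "\<dots> = orbit G \<alpha> (f u)" by (rule V.orbit_eq[OF f_closed[OF u] fv])
  finally show "w \<in> \<kappa> u" using g vU by (simp add: \<kappa>_def)
qed

lemma supercharacter_theory: "supercharacter_theory UG (\<kappa> ` U) (\<chi> ` D)"
  unfolding supercharacter_theory_def
proof (intro conjI ballI allI impI)
  interpret UG: group UG by (rule group_UG)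
  show "Group.group UG" by (rule group_UG)
  show "finite (carrier UG)" using finite_U by simp
  have self: "u \<in> \<kappa> u" if "u \<in> U" for u
    using that V.self_in_orbit f_closed by (simp add: \<kappa>_def)
  show "partition_on (carrier UG) (\<kappa> ` U)"
  proof (rule partition_onI)
    show "\<Union> (\<kappa> ` U) = carrier UG" using self by (auto simp: \<kappa>_def)
    show "{} \<notin> \<kappa> ` U" using self by blast
  next
    fix p p' assume "p \<in> \<kappa> ` U" "p' \<in> \<kappa> ` U" and ne: "p \<noteq> p'"
    then obtain u u' where u: "u \<in> U" "u' \<in> U" "p = \<kappa> u" "p' = \<kappa> u'" by blast
    then show "disjnt p p'"
      using ne V.orbits_disjoint[OF f_closed[OF u(1)] f_closed[OF u(2)]] \<kappa>_eq_iff[OF u(1,2)]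
      by (auto simp: disjnt_def \<kappa>_def)
  qed
  show "\<exists>S\<subseteq>conjugacy_class UG ` carrier UG. K = \<Union> S" if K: "K \<in> \<kappa> ` U" for K
  proof -
    obtain u where u: "u \<in> U" "K = \<kappa> u" using K by blast
    have sub: "\<kappa> u \<subseteq> U" by (auto simp: \<kappa>_def)
    have "v \<in> conjugacy_class UG v" if v: "v \<in> U" for v
    proof -
      have "v = \<one> \<otimes> v \<otimes> inv\<^bsub>UG\<^esub> \<one>" using v by (simp add: inv_UG)
      then show ?thesis unfolding conjugacy_class_def orbit_def by auto
    qed
    then have "K = \<Union> (conjugacy_class UG ` K)"
      using conjugacy_class_\<kappa>[OF u(1)] sub unfolding u(2) by blast
    with sub show ?thesis unfolding u(2) by (intro exI[of _ "conjugacy_class UG ` \<kappa> u"]) auto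
  qed
  show "finite (\<chi> ` D)" using D.finite_X by simp
  show "is_character UG \<xi>" if "\<xi> \<in> \<chi> ` D" for \<xi> using that is_character_\<chi> by blast
  have "card (\<chi> ` D) = card (orbit G \<beta> ` D)" by (rule card_image_cong_kernel) (rule \<chi>_eq_iff)
  then show "card (\<chi> ` D) = card (\<kappa> ` U)" by (simp add: card_\<kappa> card_orbits_eq)
  show "\<xi> x = \<xi> y" if \<xi>: "\<xi> \<in> \<chi> ` D" and K: "K \<in> \<kappa> ` U" and xy: "x \<in> K" "y \<in> K" for \<xi> K x y
  proof -
    obtain \<nu> u where \<nu>: "\<nu> \<in> D" "\<xi> = \<chi> \<nu>" and u: "u \<in> U" "K = \<kappa> u" using \<xi> K by blast
    have "\<xi> x = of_nat (card (orbit HG \<beta> \<nu>)) / of_nat (card (orbit G \<beta> \<nu>)) *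
      (\<Sum>\<mu>\<in>orbit G \<beta> \<nu>. pair \<mu> (f u))" if "x \<in> K" for x
      using that sum_orbit_const[OF \<nu>(1) f_closed[OF u(1)], of "f x" "\<lambda>z. z"] by (simp add: \<nu>(2) u(2) \<chi>_def \<kappa>_def)
    then show ?thesis using xy by simp
  qed
  fix \<psi> assume \<psi>: "is_irreducible_character UG \<psi>"
  then have \<psi>': "is_character UG \<psi>"
    by (auto simp: is_irreducible_character_def is_character_def irreducible_representation_def)
  obtain \<nu> where \<nu>: "\<nu> \<in> D" "constituent UG \<psi> (\<chi> \<nu>)" using exists_constituent[OF \<psi>] by blast
  show "\<exists>!\<xi>. \<xi> \<in> \<chi> ` D \<and> constituent UG \<psi> \<xi>"
  proof (rule ex1I[of _ "\<chi> \<nu>"])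
    show "\<chi> \<nu> \<in> \<chi> ` D \<and> constituent UG \<psi> (\<chi> \<nu>)" using \<nu> by simp
    fix \<xi> assume "\<xi> \<in> \<chi> ` D \<and> constituent UG \<psi> \<xi>"
    then obtain \<mu> where \<mu>: "\<mu> \<in> D" "\<xi> = \<chi> \<mu>" "constituent UG \<psi> (\<chi> \<mu>)" by blast
    have "char_form UG (\<chi> \<mu>) (\<chi> \<nu>) \<noteq> 0"
      by (rule common_constituent[OF group_UG finite_UG \<psi>' is_character_\<chi>[OF \<nu>(1)] \<mu>(3) \<nu>(2)])
    then have "orbit G \<beta> \<mu> = orbit G \<beta> \<nu>" using char_form_\<chi>[OF \<mu>(1) \<nu>(1)] by blast
    then show "\<xi> = \<chi> \<nu>" using \<chi>_eq_iff[OF \<mu>(1) \<nu>(1)] \<mu>(2) by simp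
  qed
qed

end

section \<open>Pattern groups with an anti-involution\<close>

text \<open>Used to recast \<open>dag_group\<close> and \<open>half_group\<close> as the pattern
  group with a replaced carrier field, the shape in which subgroup facts apply.\<close>

lemma carrier_update_carrier: "X\<lparr>carrier := S\<rparr> = X\<lparr>carrier := carrier (X\<lparr>carrier := S\<rparr>)\<rparr>"
  by simp

text \<open>Odd characteristic is recorded as \<open>2 \<noteq> 0\<close>, the form in which it
  permits halving and square roots. The anti-involution is linear over \<open>F\<close>, while
  matrix entries live in the whole field.\<close>

locale dag_pattern =
  fixes n :: nat and r :: "nat rel" and F :: "'a::{field, finite} set" and dag :: "'a mat \<Rightarrow> 'a mat"
  assumes order: "pattern_order n r"
    and anti: "anti_involution F (pattern_algebra n r) dag"
    and elementary: "\<And>\<alpha> i j. \<alpha> \<noteq> 0 \<Longrightarrow> i < n \<Longrightarrow> j < n \<Longrightarrow>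
           (elementary_mat n i j :: 'a mat) \<in> pattern_algebra n r \<Longrightarrow>
           \<exists>\<beta>. \<beta> \<noteq> 0 \<and> dag (\<alpha> \<cdot>\<^sub>m elementary_mat n i j)
                       = \<beta> \<cdot>\<^sub>m elementary_mat n (n - 1 - j) (n - 1 - i)"
    and two: "(2 :: 'a) \<noteq> 0"
begin

abbreviation "C \<equiv> carrier_mat n n :: 'a mat set"
abbreviation "A \<equiv> pattern_algebra n r :: 'a mat set"
abbreviation "P \<equiv> pattern_group n r :: 'a mat monoid"
abbreviation "G \<equiv> carrier P"

lemma mult_C [simp]: "x \<in> C \<Longrightarrow> y \<in> C \<Longrightarrow> x * y \<in> C" by (rule mult_carrier_mat)
lemma minus_C [simp]: "y \<in> C \<Longrightarrow> x - y \<in> C" by (rule minus_carrier_mat)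

lemma dim_C [simp]: "x \<in> C \<Longrightarrow> dim_row x = n" "x \<in> C \<Longrightarrow> dim_col x = n" by auto

lemmas mat_algebra = add_mult_distrib_mat[of _ n n _ _ n] mult_add_distrib_mat[of _ n n _ n]
  minus_mult_distrib_mat[of _ n n _ _ n] mult_minus_distrib_mat[of _ n n _ n]
  assoc_mult_mat[of _ n n _ n _ n] mult_smult_distrib[of _ n n _ n] mult_smult_assoc_mat[of _ n n _ n]

lemma A_iff: "x \<in> A \<longleftrightarrow> x \<in> C \<and> (\<forall>i<n. \<forall>j<n. x $$ (i, j) \<noteq> 0 \<longrightarrow> i < j \<and> (i, j) \<in> r)"
  unfolding pattern_algebra_def by blast

lemma A_C [simp]: "x \<in> A \<Longrightarrow> x \<in> C" unfolding A_iff by blast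

lemma A_support: "x \<in> A \<Longrightarrow> i < n \<Longrightarrow> j < n \<Longrightarrow> x $$ (i, j) \<noteq> 0 \<Longrightarrow> i < j \<and> (i, j) \<in> r"
  unfolding pattern_algebra_def by blast

lemma r_trans: "(i, j) \<in> r \<Longrightarrow> (j, k) \<in> r \<Longrightarrow> (i, k) \<in> r"
  using order unfolding pattern_order_def partial_order_on_def preorder_on_def by (meson transD)

lemma A_zero [simp]: "0\<^sub>m n n \<in> A" unfolding A_iff by simp

lemma A_I:
  "x \<in> C \<Longrightarrow> (\<And>i j. i < n \<Longrightarrow> j < n \<Longrightarrow> x $$ (i, j) \<noteq> 0 \<Longrightarrow> i < j \<and> (i, j) \<in> r) \<Longrightarrow> x \<in> A"
  unfolding A_iff by blast

lemma A_add [simp]: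
  assumes x: "x \<in> A" and y: "y \<in> A"
  shows "x + y \<in> A"
proof (rule A_I)
  show "x + y \<in> C" using x y by simp
  fix i j assume ij: "i < n" "j < n" and "(x + y) $$ (i, j) \<noteq> 0"
  then have "x $$ (i, j) \<noteq> 0 \<or> y $$ (i, j) \<noteq> 0" using A_C[OF x] A_C[OF y] by auto
  then show "i < j \<and> (i, j) \<in> r" using A_support[OF x ij] A_support[OF y ij] by blast
qed

lemma A_smult [simp]: assumes x: "x \<in> A" shows "a \<cdot>\<^sub>m x \<in> A"
proof (rule A_I)
  show "a \<cdot>\<^sub>m x \<in> C" using x by simp
  fix i j assume ij: "i < n" "j < n" and "(a \<cdot>\<^sub>m x) $$ (i, j) \<noteq> 0"
  then have "x $$ (i, j) \<noteq> 0" using A_C[OF x] by auto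
  then show "i < j \<and> (i, j) \<in> r" by (rule A_support[OF x ij])
qed

lemma A_uminus [simp]: assumes x: "x \<in> A" shows "- x \<in> A"
proof (rule A_I)
  show "- x \<in> C" using x by simp
  fix i j assume ij: "i < n" "j < n" and "(- x) $$ (i, j) \<noteq> 0"
  then have "x $$ (i, j) \<noteq> 0" using A_C[OF x] by auto
  then show "i < j \<and> (i, j) \<in> r" by (rule A_support[OF x ij])
qed

lemma A_minus [simp]: assumes "x \<in> A" "y \<in> A" shows "x - y \<in> A"
  using A_add[OF assms(1) A_uminus[OF assms(2)]] assms by (simp add: add_uminus_minus_mat[of _ n n])

lemma mult_nonzero_entry:
  assumes "x \<in> C" "y \<in> C" "i < n" "j < n" "(x * y) $$ (i, j) \<noteq> 0"
  obtains k where "k < n" "x $$ (i, k) \<noteq> 0" "y $$ (k, j) \<noteq> 0"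
proof -
  have "(\<Sum>k<n. x $$ (i, k) * y $$ (k, j)) \<noteq> 0" using assms by (simp add: index_mult_mat_sum[of _ n n _ n])
  then obtain k where "k < n" "x $$ (i, k) * y $$ (k, j) \<noteq> 0"
    using sum.neutral[of "{..<n}" "\<lambda>k. x $$ (i, k) * y $$ (k, j)"] by blast
  then show thesis using that[of k] by simp
qed

lemma A_mult [simp]:
  assumes x: "x \<in> A" and y: "y \<in> A"
  shows "x * y \<in> A"
proof (rule A_I)
  fix i j assume ij: "i < n" "j < n" and ne: "(x * y) $$ (i, j) \<noteq> 0"
  obtain k where k: "k < n" "x $$ (i, k) \<noteq> 0" "y $$ (k, j) \<noteq> 0"
    by (rule mult_nonzero_entry[OF A_C[OF x] A_C[OF y] ij ne])
  show "i < j \<and> (i, j) \<in> r"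
    using A_support[OF x ij(1) k(1,2)] A_support[OF y k(1) ij(2) k(3)] r_trans by auto
qed (use x y in simp)

section \<open>Finiteness and the group structure of the pattern group\<close>

lemma finite_C: "finite C"
proof (rule finite_subset)
  show "C \<subseteq> mat n n ` (({..<n} \<times> {..<n}) \<rightarrow>\<^sub>E UNIV)"
  proof
    fix x :: "'a mat" assume "x \<in> C"
    then have "x = mat n n (restrict (\<lambda>ij. x $$ ij) ({..<n} \<times> {..<n}))"
      by (intro eq_matI) auto
    moreover have "restrict (\<lambda>ij. x $$ ij) ({..<n} \<times> {..<n}) \<in> ({..<n} \<times> {..<n}) \<rightarrow>\<^sub>E UNIV" by simp
    ultimately show "x \<in> mat n n ` (({..<n} \<times> {..<n}) \<rightarrow>\<^sub>E UNIV)" by (metis imageI)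
  qed
qed (intro finite_imageI finite_PiE, auto)

lemma finite_A: "finite A" by (rule finite_subset[OF _ finite_C]) auto

lemma mult_P [simp]: "monoid.mult P = (*)" and one_P [simp]: "monoid.one P = 1\<^sub>m n"
  by (simp_all add: pattern_group_def)

lemma G_iff: "g \<in> G \<longleftrightarrow> g \<in> C \<and> g - 1\<^sub>m n \<in> A"
proof
  assume "g \<in> G"
  then obtain x where x: "x \<in> A" "g = 1\<^sub>m n + x" by (auto simp: pattern_group_def)
  then have "g - 1\<^sub>m n = x" using A_C[OF x(1)] by (intro eq_matI) auto
  then show "g \<in> C \<and> g - 1\<^sub>m n \<in> A" using x by simp
next
  assume g: "g \<in> C \<and> g - 1\<^sub>m n \<in> A"
  then have "g = 1\<^sub>m n + (g - 1\<^sub>m n)" by (intro eq_matI) auto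
  then show "g \<in> G" using g by (auto simp: pattern_group_def)
qed

lemma G_C [simp]: "g \<in> G \<Longrightarrow> g \<in> C" unfolding G_iff by blast
lemma G_minus_one [simp]: "g \<in> G \<Longrightarrow> g - 1\<^sub>m n \<in> A" unfolding G_iff by blast
lemma one_plus_A [simp]: "x \<in> A \<Longrightarrow> 1\<^sub>m n + x \<in> G" by (simp add: pattern_group_def)
lemma one_plus_minus_one [simp]: "x \<in> C \<Longrightarrow> 1\<^sub>m n + x - 1\<^sub>m n = x" by (intro eq_matI) auto
lemma G_eq: "g \<in> C \<Longrightarrow> 1\<^sub>m n + (g - 1\<^sub>m n) = g" by (intro eq_matI) auto

lemma G_E:
  assumes "g \<in> G" obtains x where "x \<in> A" "g = 1\<^sub>m n + x"
  using assms by (auto simp: pattern_group_def)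

lemma G_mult_A [simp]: assumes "g \<in> G" "x \<in> A" shows "g * x \<in> A"
proof -
  obtain y where y: "y \<in> A" "g = 1\<^sub>m n + y" using assms by (auto elim: G_E)
  then have "g * x = x + y * x" using assms by (simp add: mat_algebra)
  then show ?thesis using y assms by simp
qed

lemma A_mult_G [simp]: assumes "g \<in> G" "x \<in> A" shows "x * g \<in> A"
proof -
  obtain y where y: "y \<in> A" "g = 1\<^sub>m n + y" using assms by (auto elim: G_E)
  then have "x * g = x + x * y" using assms by (simp add: mat_algebra)
  then show ?thesis using y assms by simp
qed

lemma G_mult [simp]: assumes "g \<in> G" "h \<in> G" shows "g * h \<in> G"
proof -
  obtain y where y: "y \<in> A" "h = 1\<^sub>m n + y" using assms by (auto elim: G_E)
  have "g * h = 1\<^sub>m n + ((g - 1\<^sub>m n) + g * y)"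
    using y assms by (simp add: mat_algebra, intro eq_matI) auto
  then show ?thesis using y assms by simp
qed

text \<open>\<open>w * g = 0\<close> reads \<open>w = - w * x\<close> with \<open>x\<close> strictly
  upper triangular, so column \<open>j\<close> of \<open>w\<close> depends on earlier columns
  only.\<close>

lemma G_right_cancel_zero:
  assumes g: "g \<in> G" and w: "w \<in> C" and wg: "w * g = 0\<^sub>m n n"
  shows "w = 0\<^sub>m n n"
proof -
  obtain x where x: "x \<in> A" "g = 1\<^sub>m n + x" using g by (auto elim: G_E)
  have "w $$ (i, j) = 0" if i: "i < n" and "j < n" for i j
    using that(2)
  proof (induction j rule: less_induct)
    case (less j)
    have "w * g = w + w * x" using w x by (simp add: mat_algebra)
    then have "(w + w * x) $$ (i, j) = 0" using i less.prems unfolding wg by (metis index_zero_mat(1))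
    then have "w $$ (i, j) + (\<Sum>k<n. w $$ (i, k) * x $$ (k, j)) = 0"
      using w x i less.prems by (simp add: index_mult_mat_sum[of _ n n _ n])
    moreover have "(\<Sum>k<n. w $$ (i, k) * x $$ (k, j)) = 0"
    proof (intro sum.neutral ballI)
      fix k assume "k \<in> {..<n}"
      then show "w $$ (i, k) * x $$ (k, j) = 0"
        using less A_support[OF x(1), of k j] by auto
    qed
    ultimately show ?case by simp
  qed
  then show ?thesis using w by (intro eq_matI) auto
qed

text \<open>Inverses come from finiteness: right multiplication is injective by cancellation, hence
  surjective, and thus reaches the identity.\<close>

lemma group_P: "group P"
proof (rule groupI)
  fix g assume g: "g \<in> G"
  have "inj_on (\<lambda>h. h * g) G"
  proof (rule inj_onI)
    fix h k assume hk: "h \<in> G" "k \<in> G" "h * g = k * g"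
    have "(h - k) * g = 0\<^sub>m n n" using hk g by (simp add: mat_algebra)
    then have "h - k = 0\<^sub>m n n" using G_right_cancel_zero[OF g] hk by simp
    then have "(h - k) $$ (i, j) = 0" if "i < n" "j < n" for i j using that by simp
    then show "h = k" using hk by (intro eq_matI) auto
  qed
  moreover have "(\<lambda>h. h * g) ` G \<subseteq> G" using G_mult g by auto
  moreover have "finite G" by (rule finite_subset[OF _ finite_C]) auto
  ultimately have "(\<lambda>h. h * g) ` G = G" by (simp add: endo_inj_surj)
  moreover have "1\<^sub>m n \<in> G" using one_plus_A[OF A_zero] by simp
  ultimately show "\<exists>h\<in>G. h \<otimes>\<^bsub>P\<^esub> g = \<one>\<^bsub>P\<^esub>" by (metis imageE mult_P one_P)
next
  show "\<one>\<^bsub>P\<^esub> \<in> G" using one_plus_A[OF A_zero] by simp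
qed (auto simp: mat_algebra intro: G_mult)

sublocale P: group P by (rule group_P)

lemma finite_G: "finite G" by (rule finite_subset[OF _ finite_C]) auto

abbreviation "iv \<equiv> m_inv P"

lemma iv_mult: "g \<in> G \<Longrightarrow> iv g * g = 1\<^sub>m n" "g \<in> G \<Longrightarrow> g * iv g = 1\<^sub>m n"
  using P.l_inv P.r_inv by simp_all

lemma iv_mult_left [simp]:
  assumes "g \<in> G" "x \<in> C"
  shows "iv g * (g * x) = x" "g * (iv g * x) = x"
  using assms P.inv_closed[OF assms(1)]
  by (simp_all add: assoc_mult_mat[of _ n n _ n _ n, symmetric] iv_mult)

lemma G_one [simp]: "1\<^sub>m n \<in> G" using P.one_closed by simp
lemma iv_G [simp]: "g \<in> G \<Longrightarrow> iv g \<in> G" by (rule P.inv_closed)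
lemma iv_C [simp]: "g \<in> G \<Longrightarrow> iv g \<in> C" by (rule G_C) simp

abbreviation half :: "'a mat \<Rightarrow> 'a mat" where "half x \<equiv> (1 / 2) \<cdot>\<^sub>m x"

lemma half_add_half: "(1 / 2) * y + (1 / 2) * y = (y :: 'a)"
proof -
  have "(1 / 2 + 1 / 2 :: 'a) = 1" using two by (simp only: add_divide_distrib[symmetric] one_add_one divide_self[OF two])
  then show ?thesis by (simp only: distrib_right[symmetric] mult_1_left)
qed

lemma half_double [simp]: "x \<in> C \<Longrightarrow> half x + half x = x"
  using half_add_half by (intro eq_matI) auto

section \<open>The anti-involution\<close>

lemma dag_A [simp]: "x \<in> A \<Longrightarrow> dag x \<in> A"
  using anti by (auto simp: anti_involution_def bij_betw_def)
lemma dag_add: "x \<in> A \<Longrightarrow> y \<in> A \<Longrightarrow> dag (x + y) = dag x + dag y"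
  using anti by (simp add: anti_involution_def)
lemma dag_mult: "x \<in> A \<Longrightarrow> y \<in> A \<Longrightarrow> dag (x * y) = dag y * dag x"
  using anti by (simp add: anti_involution_def)
lemma dag_dag [simp]: "x \<in> A \<Longrightarrow> dag (dag x) = x"
  using anti by (simp add: anti_involution_def)
lemma dag_smult_F: "c \<in> F \<Longrightarrow> x \<in> A \<Longrightarrow> dag (c \<cdot>\<^sub>m x) = c \<cdot>\<^sub>m dag x"
  using anti by (simp add: anti_involution_def)

lemma add_self_cancel: "x \<in> C \<Longrightarrow> y \<in> C \<Longrightarrow> x + y = x \<Longrightarrow> y = 0\<^sub>m n n"
proof (rule eq_matI)
  fix i j assume *: "x \<in> C" "y \<in> C" "x + y = x" "i < dim_row (0\<^sub>m n n :: 'a mat)" "j < dim_col (0\<^sub>m n n :: 'a mat)"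
  from arg_cong[OF *(3), of "\<lambda>m. m $$ (i, j)"]
  show "y $$ (i, j) = 0\<^sub>m n n $$ (i, j)" using *(1,2,4,5) by simp
qed auto

lemma dag_zero [simp]: "dag (0\<^sub>m n n) = 0\<^sub>m n n"
  using dag_add[of "0\<^sub>m n n" "0\<^sub>m n n"] add_self_cancel[of "dag (0\<^sub>m n n)" "dag (0\<^sub>m n n)"] by simp

lemma uminus_unique: assumes "x \<in> C" "y \<in> C" "x + y = 0\<^sub>m n n" shows "y = - x"
proof (rule eq_matI)
  fix i j assume ij: "i < dim_row (- x)" "j < dim_col (- x)"
  from arg_cong[OF assms(3), of "\<lambda>m. m $$ (i, j)"]
  show "y $$ (i, j) = (- x) $$ (i, j)" using assms(1,2) ij by (simp add: add_eq_0_iff)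
qed (use assms in auto)

lemma add_uminus_self: "x \<in> C \<Longrightarrow> x + - x = 0\<^sub>m n n" by (intro eq_matI) auto

lemma dag_uminus: "x \<in> A \<Longrightarrow> dag (- x) = - dag x"
  using dag_add[of x "- x"] by (intro uminus_unique) (simp_all add: add_uminus_self)

lemma dag_minus: "x \<in> A \<Longrightarrow> y \<in> A \<Longrightarrow> dag (x - y) = dag x - dag y"
  using dag_add[of x "- y"] by (simp add: dag_uminus add_uminus_minus_mat[of _ n n])

text \<open>Doubling determines the value, by additivity; at this point \<open>F\<close> is just a
  set, so 1/2 is not known to lie in it.\<close>

lemma dag_half: assumes x: "x \<in> A" shows "dag (half x) = half (dag x)"
proof -
  have "dag x = dag (half x) + dag (half x)" using x dag_add[of "half x" "half x"] by simp
  then have "half (dag x) = half (dag (half x)) + half (dag (half x))"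
    using x by (simp add: add_smult_distrib_left_mat[of _ n n])
  then show ?thesis using x by simp
qed

abbreviation "gd \<equiv> group_dag n dag"

lemma gd_one_plus: "x \<in> A \<Longrightarrow> gd (1\<^sub>m n + x) = 1\<^sub>m n + dag x" by (simp add: group_dag_def)
lemma gd_G [simp]: "g \<in> G \<Longrightarrow> gd g \<in> G" by (simp add: group_dag_def)
lemma gd_C [simp]: "g \<in> G \<Longrightarrow> gd g \<in> C" by (rule G_C) simp
lemma gd_gd [simp]: "g \<in> G \<Longrightarrow> gd (gd g) = g" by (simp add: group_dag_def G_eq)
lemma gd_one [simp]: "gd (1\<^sub>m n) = 1\<^sub>m n" using gd_one_plus[OF A_zero] by simp

lemma dag_G_mult: assumes "g \<in> G" "x \<in> A" shows "dag (g * x) = dag x * gd g"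
proof -
  obtain y where y: "y \<in> A" "g = 1\<^sub>m n + y" using assms by (auto elim: G_E)
  then show ?thesis using assms by (simp add: mat_algebra dag_add dag_mult gd_one_plus)
qed

lemma dag_mult_G: assumes "g \<in> G" "x \<in> A" shows "dag (x * g) = gd g * dag x"
proof -
  obtain y where y: "y \<in> A" "g = 1\<^sub>m n + y" using assms by (auto elim: G_E)
  then show ?thesis using assms by (simp add: mat_algebra dag_add dag_mult gd_one_plus)
qed

lemma gd_mult: assumes "g \<in> G" "h \<in> G" shows "gd (g * h) = gd h * gd g"
proof -
  obtain y where y: "y \<in> A" "h = 1\<^sub>m n + y" using assms by (auto elim: G_E)
  have *: "g * h - 1\<^sub>m n = (g - 1\<^sub>m n) + g * y" using y assms by (simp add: mat_algebra, intro eq_matI) auto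
  have "gd (g * h) = 1\<^sub>m n + (dag (g - 1\<^sub>m n) + dag y * gd g)"
    unfolding group_dag_def[of n dag "g * h"] * using y assms by (simp add: dag_add dag_G_mult)
  also have "\<dots> = gd g + dag y * gd g"
    using y assms by (simp add: group_dag_def assoc_add_mat[of _ n n])
  also have "\<dots> = gd h * gd g" using y assms by (simp add: gd_one_plus mat_algebra)
  finally show ?thesis .
qed

lemma gd_iv: assumes "g \<in> G" shows "gd (iv g) = iv (gd g)"
proof -
  have "gd (iv g) * gd g = 1\<^sub>m n" using gd_mult[of g "iv g"] assms by (simp add: iv_mult)
  then show ?thesis using P.inv_equality[of "gd (iv g)" "gd g"] assms by simp
qed

section \<open>Skew elements, the group \<open>U\<close> and the twisted action\<close>

abbreviation "V \<equiv> dag_algebra n r dag"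
abbreviation "U \<equiv> carrier (dag_group n r dag)"
abbreviation "act \<equiv> dag_act n dag"

lemma V_iff: "x \<in> V \<longleftrightarrow> x \<in> A \<and> dag x = - x" by (simp add: dag_algebra_def)
lemma V_A [simp]: "x \<in> V \<Longrightarrow> x \<in> A" and V_dag: "x \<in> V \<Longrightarrow> dag x = - x"
  and V_I: "x \<in> A \<Longrightarrow> dag x = - x \<Longrightarrow> x \<in> V" unfolding V_iff by auto
lemma U_iff: "u \<in> U \<longleftrightarrow> u \<in> G \<and> gd u = iv u" by (simp add: dag_group_def)
lemma U_G [simp]: "u \<in> U \<Longrightarrow> u \<in> G" and U_gd: "u \<in> U \<Longrightarrow> gd u = iv u"
  and U_I: "u \<in> G \<Longrightarrow> gd u = iv u \<Longrightarrow> u \<in> U" unfolding U_iff by auto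

lemma dag_group_eq: "dag_group n r dag = P\<lparr>carrier := U\<rparr>"
  unfolding dag_group_def by (rule carrier_update_carrier)

lemma subgroup_U: "subgroup U P"
proof (rule P.subgroupI)
  have "1\<^sub>m n \<in> U" using P.inv_one by (intro U_I) simp_all
  then show "U \<noteq> {}" by blast
  show "U \<subseteq> G" by (rule subsetI) (rule U_G)
  fix u assume u: "u \<in> U"
  then show "iv u \<in> U" by (intro U_I) (simp_all add: gd_iv U_gd)
  fix v assume v: "v \<in> U"
  show "u \<otimes>\<^bsub>P\<^esub> v \<in> U" using u v P.inv_mult_group[of u v] by (intro U_I) (simp_all add: gd_mult U_gd)
qed

lemma V_zero [simp]: "0\<^sub>m n n \<in> V" by (rule V_I) (simp_all, intro eq_matI, simp_all)
lemma V_add [simp]: "x \<in> V \<Longrightarrow> y \<in> V \<Longrightarrow> x + y \<in> V"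
  by (intro V_I) (simp_all add: dag_add V_dag, intro eq_matI, auto)
lemma V_uminus [simp]: "x \<in> V \<Longrightarrow> - x \<in> V" by (intro V_I) (simp_all add: dag_uminus V_dag)
lemma V_minus [simp]: assumes "x \<in> V" "y \<in> V" shows "x - y \<in> V"
  using V_add[OF assms(1) V_uminus[OF assms(2)]] assms by (simp add: add_uminus_minus_mat[of _ n n])
lemma V_smult [simp]: "c \<in> F \<Longrightarrow> x \<in> V \<Longrightarrow> c \<cdot>\<^sub>m x \<in> V"
  by (intro V_I) (simp_all add: dag_smult_F V_dag, intro eq_matI, auto)
lemma skew_V: "x \<in> A \<Longrightarrow> x - dag x \<in> V"
  by (intro V_I) (simp_all add: dag_minus, intro eq_matI, auto)
lemma half_V: "x \<in> V \<Longrightarrow> half x \<in> V"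
  by (intro V_I) (simp_all add: dag_half V_dag, intro eq_matI, auto)

lemma act_A: "g \<in> G \<Longrightarrow> x \<in> A \<Longrightarrow> act g x \<in> A" by (simp add: dag_act_def)

lemma act_V [simp]: "g \<in> G \<Longrightarrow> x \<in> V \<Longrightarrow> act g x \<in> V"
  by (intro V_I) (simp_all add: act_A, simp add: dag_act_def dag_G_mult dag_mult_G V_dag mat_algebra)

lemma act_mult: "g \<in> G \<Longrightarrow> h \<in> G \<Longrightarrow> x \<in> C \<Longrightarrow> act (g * h) x = act g (act h x)"
  by (simp add: dag_act_def gd_mult mat_algebra)

lemma act_add: "g \<in> G \<Longrightarrow> x \<in> C \<Longrightarrow> y \<in> C \<Longrightarrow> act g (x + y) = act g x + act g y"
  by (simp add: dag_act_def mat_algebra)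
lemma act_smult: "g \<in> G \<Longrightarrow> x \<in> C \<Longrightarrow> act g (c \<cdot>\<^sub>m x) = c \<cdot>\<^sub>m act g x"
  by (simp add: dag_act_def mat_algebra)
lemma finite_V: "finite V" by (rule finite_subset[OF _ finite_A]) auto

lemma action_V: "finite_action P V act"
  by unfold_locales (auto simp: finite_G finite_V act_mult, auto simp: dag_act_def)

lemma act_U: "u \<in> U \<Longrightarrow> act u x = u * x * iv u" by (simp add: dag_act_def U_gd)

text \<open>The hypothesis on \<open>dag\<close> concerns multiples of single elementary matrices.
  Additivity extends it to all supports: entries are reflected in the antidiagonal, and cancellation
  can only shrink the support.\<close>

lemma dag_support:
  assumes x: "x \<in> A" and ij: "i < n" "j < n" and ne: "dag x $$ (i, j) \<noteq> 0"
  shows "x $$ (n - 1 - j, n - 1 - i) \<noteq> 0"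
proof -
  \<comment> \<open>The induction runs over a finite set containing the support rather than over the
    support itself, which allows one entry to be split off at a time.\<close>
  have main: "(n - 1 - j, n - 1 - i) \<in> S"
    if "finite S" "x \<in> A" "\<And>k l. k < n \<Longrightarrow> l < n \<Longrightarrow> x $$ (k, l) \<noteq> 0 \<Longrightarrow> (k, l) \<in> S" "dag x $$ (i, j) \<noteq> 0" for S x
    using that
  proof (induction S arbitrary: x rule: finite_induct)
    case empty
    then have "x = 0\<^sub>m n n" by (intro eq_matI) auto
    then show ?case using empty ij by simp
  next
    case (insert p S)
    obtain k l where p: "p = (k, l)" by (cases p)
    show ?case
    proof (cases "k < n \<and> l < n \<and> x $$ (k, l) \<noteq> 0")
      case False
      then have "\<And>k l. k < n \<Longrightarrow> l < n \<Longrightarrow> x $$ (k, l) \<noteq> 0 \<Longrightarrow> (k, l) \<in> S"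
        using insert.prems(2) p by blast
      then show ?thesis using insert.IH[of x] insert.prems by blast
    next
      case True
      then have kl: "k < n" "l < n" "x $$ (k, l) \<noteq> 0" by auto
      define y where "y = x $$ (k, l) \<cdot>\<^sub>m elementary_mat n k l"
      have e: "elementary_mat n k l \<in> A"
        using A_support[OF insert.prems(1) kl] unfolding A_iff by (auto simp: elementary_mat_def)
      then have yA: "y \<in> A" by (simp add: y_def)
      obtain b where b: "dag y = b \<cdot>\<^sub>m elementary_mat n (n - 1 - l) (n - 1 - k)"
        using elementary[OF kl(3,1,2) e] by (auto simp: y_def)
      have xy: "x = (x - y) + y" using insert.prems(1) yA A_C[OF yA] A_C[OF insert.prems(1)] by (intro eq_matI) auto
      have "dag x = dag (x - y) + dag y" using insert.prems(1) yA xy by (metis A_minus dag_add)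
      then have "dag (x - y) $$ (i, j) + dag y $$ (i, j) \<noteq> 0"
        using insert.prems(3) ij A_C[OF dag_A[OF yA]] by simp
      then consider "dag (x - y) $$ (i, j) \<noteq> 0" | "dag y $$ (i, j) \<noteq> 0" by fastforce
      then show ?thesis
      proof cases
        case 1
        have "(k', l') \<in> S" if "k' < n" "l' < n" "(x - y) $$ (k', l') \<noteq> 0" for k' l'
          using that insert.prems(2)[of k' l'] insert.prems(1) p
          by (auto simp: y_def elementary_mat_def split: if_splits)
        then show ?thesis using insert.IH[of "x - y"] 1 insert.prems(1) yA by simp
      next
        case 2
        then have "i = n - 1 - l" "j = n - 1 - k"
          using ij by (auto simp: b elementary_mat_def split: if_splits)
        then show ?thesis using kl p by simp
      qed
    qed
  qed
  have "(n - 1 - j, n - 1 - i) \<in> {(k, l). k < n \<and> l < n \<and> x $$ (k, l) \<noteq> 0}"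
    by (rule main[OF _ x _ ne]) (auto intro: finite_subset[of _ "{..<n} \<times> {..<n}"])
  then show ?thesis by simp
qed

end

section \<open>The half ideal\<close>

context dag_pattern begin

abbreviation "\<h> \<equiv> half_ideal n r :: 'a mat set"
abbreviation "H \<equiv> carrier (half_group n r :: 'a mat monoid)"

lemma h_I: "x \<in> A \<Longrightarrow> (\<And>i j. i < n \<Longrightarrow> j < n \<Longrightarrow> x $$ (i, j) \<noteq> 0 \<Longrightarrow> n < 2 * (j + 1)) \<Longrightarrow> x \<in> \<h>"
  unfolding half_ideal_def by (auto simp: not_le[symmetric])

lemma h_A [simp]: "x \<in> \<h> \<Longrightarrow> x \<in> A"
  unfolding half_ideal_def by blast

lemma h_support: "x \<in> \<h> \<Longrightarrow> i < n \<Longrightarrow> j < n \<Longrightarrow> x $$ (i, j) \<noteq> 0 \<Longrightarrow> n < 2 * (j + 1)"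
  unfolding half_ideal_def using not_le by blast

lemma h_zero [simp]: "0\<^sub>m n n \<in> \<h>" by (rule h_I) simp_all

lemma h_add [simp]:
  assumes x: "x \<in> \<h>" and y: "y \<in> \<h>" shows "x + y \<in> \<h>"
proof (rule h_I)
  show "x + y \<in> A" using x y by simp
  fix i j assume ij: "i < n" "j < n" and "(x + y) $$ (i, j) \<noteq> 0"
  then have "x $$ (i, j) \<noteq> 0 \<or> y $$ (i, j) \<noteq> 0" using A_C[OF h_A[OF x]] A_C[OF h_A[OF y]] by auto
  then show "n < 2 * (j + 1)" using h_support[OF x ij] h_support[OF y ij] by blast
qed

lemma h_smult [simp]:
  assumes x: "x \<in> \<h>" shows "a \<cdot>\<^sub>m x \<in> \<h>"
proof (rule h_I)
  show "a \<cdot>\<^sub>m x \<in> A" using x by simp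
  fix i j assume ij: "i < n" "j < n" and "(a \<cdot>\<^sub>m x) $$ (i, j) \<noteq> 0"
  then have "x $$ (i, j) \<noteq> 0" using A_C[OF h_A[OF x]] by auto
  then show "n < 2 * (j + 1)" by (rule h_support[OF x ij])
qed

lemma h_uminus [simp]: assumes x: "x \<in> \<h>" shows "- x \<in> \<h>"
proof -
  have "- x = (- 1) \<cdot>\<^sub>m x" by (intro eq_matI) auto
  then show ?thesis using x by simp
qed

lemma h_minus [simp]: assumes "x \<in> \<h>" "y \<in> \<h>" shows "x - y \<in> \<h>"
  using h_add[OF assms(1) h_uminus[OF assms(2)]] assms by (simp add: add_uminus_minus_mat[of _ n n])

lemma h_mult_right [simp]:
  assumes x: "x \<in> \<h>" and y: "y \<in> A" shows "x * y \<in> \<h>"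
proof (rule h_I)
  show "x * y \<in> A" using x y by simp
  fix i j assume ij: "i < n" "j < n" and ne: "(x * y) $$ (i, j) \<noteq> 0"
  obtain k where k: "k < n" "x $$ (i, k) \<noteq> 0" "y $$ (k, j) \<noteq> 0"
    by (rule mult_nonzero_entry[OF A_C[OF h_A[OF x]] A_C[OF y] ij ne])
  show "n < 2 * (j + 1)"
    using h_support[OF x ij(1) k(1,2)] A_support[OF y k(1) ij(2) k(3)] by auto
qed

lemma h_mult_left [simp]:
  assumes x: "x \<in> \<h>" and y: "y \<in> A" shows "y * x \<in> \<h>"
proof (rule h_I)
  show "y * x \<in> A" using x y by simp
  fix i j assume ij: "i < n" "j < n" and ne: "(y * x) $$ (i, j) \<noteq> 0"
  obtain k where k: "k < n" "y $$ (i, k) \<noteq> 0" "x $$ (k, j) \<noteq> 0"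
    by (rule mult_nonzero_entry[OF A_C[OF y] A_C[OF h_A[OF x]] ij ne])
  show "n < 2 * (j + 1)" by (rule h_support[OF x k(1) ij(2) k(3)])
qed

lemma h_mult_G [simp]: assumes g: "g \<in> G" and x: "x \<in> \<h>" shows "x * g \<in> \<h>" "g * x \<in> \<h>"
proof -
  obtain y where y: "y \<in> A" "g = 1\<^sub>m n + y" using g by (auto elim: G_E)
  have "x * g = x + x * y" "g * x = x + y * x" using y x by (simp_all add: mat_algebra)
  then show "x * g \<in> \<h>" "g * x \<in> \<h>" using y x by simp_all
qed

lemma finite_h: "finite \<h>" by (rule finite_subset[OF _ finite_A]) auto

lemma zero_matI:
  "x \<in> C \<Longrightarrow> (\<And>i j. i < n \<Longrightarrow> j < n \<Longrightarrow> x $$ (i, j) \<noteq> 0 \<Longrightarrow> False) \<Longrightarrow> x = 0\<^sub>m n n"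
  by (intro eq_matI) auto

text \<open>The inner indices of \<open>a * x * dag a\<close> would have to satisfy \<open>n/2 < k < l \<le> n/2\<close>, up to rounding.\<close>

lemma h_A_dag_h:
  assumes a: "a \<in> \<h>" and x: "x \<in> A"
  shows "a * x * dag a = 0\<^sub>m n n"
proof (rule zero_matI)
  have C: "a \<in> C" "x \<in> C" "dag a \<in> C" "a * x \<in> C" using a x by simp_all
  then show "a * x * dag a \<in> C" by simp
  fix i j assume ij: "i < n" "j < n" and "(a * x * dag a) $$ (i, j) \<noteq> 0"
  then obtain l where l: "l < n" "(a * x) $$ (i, l) \<noteq> 0" "dag a $$ (l, j) \<noteq> 0"
    using mult_nonzero_entry[OF C(4,3)] by blast
  then obtain k where k: "k < n" "a $$ (i, k) \<noteq> 0" "x $$ (k, l) \<noteq> 0"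
    using mult_nonzero_entry[OF C(1,2) ij(1)] by blast
  have "n < 2 * (k + 1)" by (rule h_support[OF a ij(1) k(1,2)])
  moreover have "k < l" using A_support[OF x k(1) l(1) k(3)] by simp
  moreover have "a $$ (n - 1 - j, n - 1 - l) \<noteq> 0"
    by (rule dag_support[OF h_A[OF a] l(1) ij(2) l(3)])
  then have "n < 2 * (n - 1 - l + 1)" using h_support[OF a, of "n - 1 - j" "n - 1 - l"] ij l by simp
  ultimately show False using l by simp
qed

section \<open>The normal subgroup of the half ideal and the factorization of the group\<close>

lemma H_eq: "H = (\<lambda>x. 1\<^sub>m n + x) ` \<h>"
  by (simp add: half_group_def)

lemma half_group_eq: "half_group n r = P\<lparr>carrier := H\<rparr>"
  unfolding half_group_def by (rule carrier_update_carrier)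

lemma H_iff: "g \<in> H \<longleftrightarrow> g \<in> G \<and> g - 1\<^sub>m n \<in> \<h>"
proof
  assume "g \<in> H"
  then obtain x where "x \<in> \<h>" "g = 1\<^sub>m n + x" by (auto simp: H_eq)
  then show "g \<in> G \<and> g - 1\<^sub>m n \<in> \<h>" by simp
next
  assume "g \<in> G \<and> g - 1\<^sub>m n \<in> \<h>"
  then show "g \<in> H" unfolding H_eq using G_eq[of g] by (metis G_C image_eqI)
qed

lemma one_minus_iv: "g \<in> G \<Longrightarrow> iv g - 1\<^sub>m n = - (iv g * (g - 1\<^sub>m n))"
  by (simp add: mat_algebra iv_mult, intro eq_matI) auto

lemma H_I: "g \<in> G \<Longrightarrow> g - 1\<^sub>m n \<in> \<h> \<Longrightarrow> g \<in> H" by (simp only: H_iff)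
lemma H_G: "g \<in> H \<Longrightarrow> g \<in> G" and H_h: "g \<in> H \<Longrightarrow> g - 1\<^sub>m n \<in> \<h>" unfolding H_iff by auto

lemma subgroup_H: "subgroup H P"
proof (rule P.subgroupI)
  show "H \<subseteq> G" using H_G by blast
  have "1\<^sub>m n \<in> H"
  proof (rule H_I)
    have "1\<^sub>m n - 1\<^sub>m n = (0\<^sub>m n n :: 'a mat)" by (intro eq_matI) auto
    then show "1\<^sub>m n - 1\<^sub>m n \<in> \<h>" using h_zero by (simp only:)
  qed simp
  then show "H \<noteq> {}" by blast
  fix g assume g: "g \<in> H"
  show "iv g \<in> H"
    using H_G[OF g] H_h[OF g] by (intro H_I) (simp_all add: one_minus_iv)
  fix h assume h: "h \<in> H"
  have "g * h - 1\<^sub>m n = (g - 1\<^sub>m n) + g * (h - 1\<^sub>m n)"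
    using H_G[OF g] H_G[OF h] by (simp add: mat_algebra, intro eq_matI) auto
  then show "g \<otimes>\<^bsub>P\<^esub> h \<in> H"
    using H_G[OF g] H_G[OF h] H_h[OF g] H_h[OF h] by (intro H_I) simp_all
qed

lemma normal_H: "normal H P"
  unfolding P.normal_inv_iff
proof (intro conjI ballI subgroup_H)
  fix x h assume x: "x \<in> G" and h: "h \<in> H"
  have "x * h * iv x - 1\<^sub>m n = x * (h - 1\<^sub>m n) * iv x"
    using x H_G[OF h] by (simp add: mat_algebra iv_mult)
  then show "x \<otimes>\<^bsub>P\<^esub> h \<otimes>\<^bsub>P\<^esub> inv\<^bsub>P\<^esub> x \<in> H"
    using x H_G[OF h] H_h[OF h] by (intro H_I) simp_all
qed

text \<open>The quadratic term \<open>a * x * dag a\<close> vanishes by \<open>h_A_dag_h\<close>, so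
  the displacement is linear in \<open>a\<close>; skewness of \<open>x\<close> makes it the skew
  combination of \<open>a * x\<close>.\<close>

lemma act_h:
  assumes a: "a \<in> \<h>" and x: "x \<in> V"
  shows "act (1\<^sub>m n + a) x = x + (a * x - dag (a * x))"
proof -
  have 0: "a * (x * dag a) = 0\<^sub>m n n" using h_A_dag_h[OF a V_A[OF x]] a x by (simp add: mat_algebra)
  have "act (1\<^sub>m n + a) x = x + (x * dag a + (a * x + a * (x * dag a)))"
    using a x by (simp add: dag_act_def gd_one_plus mat_algebra assoc_add_mat[of _ n n], intro eq_matI) auto
  moreover have "dag (a * x) = - (x * dag a)" using a x by (simp add: dag_mult V_dag)
  ultimately show ?thesis using a x by (simp add: 0, intro eq_matI) auto
qed

text \<open>\<open>low\<close> cuts columns and \<open>top_rows\<close> cuts rows at the same middle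
  index. What \<open>low\<close> removes lies in the half ideal, and so does the image of
  \<open>top_rows\<close> under \<open>dag\<close>.\<close>

definition low :: "'a mat \<Rightarrow> 'a mat" where
  "low x = mat n n (\<lambda>(i, j). if 2 * (j + 1) \<le> n then x $$ (i, j) else 0)"

definition top_rows :: "'a mat \<Rightarrow> 'a mat" where
  "top_rows x = mat n n (\<lambda>(i, j). if 2 * (i + 1) \<le> n then x $$ (i, j) else 0)"

lemma low_A [simp]: assumes x: "x \<in> A" shows "low x \<in> A"
  using A_support[OF x] by (intro A_I) (auto simp: low_def split: if_splits)

lemma top_rows_A [simp]: assumes x: "x \<in> A" shows "top_rows x \<in> A"
  using A_support[OF x] by (intro A_I) (auto simp: top_rows_def split: if_splits)

lemma minus_low_h: assumes x: "x \<in> A" shows "x - low x \<in> \<h>"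
proof (rule h_I)
  fix i j assume "i < n" "j < n" "(x - low x) $$ (i, j) \<noteq> 0"
  then show "n < 2 * (j + 1)" by (simp add: low_def split: if_splits)
qed (use x in simp)

lemma dag_top_rows_h: assumes x: "x \<in> A" shows "dag (top_rows x) \<in> \<h>"
proof (rule h_I)
  fix i j assume ij: "i < n" "j < n" "dag (top_rows x) $$ (i, j) \<noteq> 0"
  then have "top_rows x $$ (n - 1 - j, n - 1 - i) \<noteq> 0"
    using dag_support[of "top_rows x" i j] x by simp
  then have "2 * (n - 1 - j + 1) \<le> n" using ij by (simp add: top_rows_def split: if_splits)
  then show "n < 2 * (j + 1)" using ij by simp
qed (use x in simp)

text \<open>The inner summation index of the product is cut at the middle: its lower half can be
  recorded either on the columns of \<open>x\<close> or on the rows of \<open>y\<close>.\<close>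

lemma mult_split:
  assumes x: "x \<in> A" and y: "y \<in> A"
  shows "x * y = (x - low x) * y + x * top_rows y"
proof -
  have "low x * y = x * top_rows y"
  proof (rule eq_matI)
    fix i j assume "i < dim_row (x * top_rows y)" "j < dim_col (x * top_rows y)"
    then have ij: "i < n" "j < n" using x A_C[OF top_rows_A[OF y]] by auto
    then show "(low x * y) $$ (i, j) = (x * top_rows y) $$ (i, j)"
      using index_mult_mat_sum[of "low x" n n y n i j] index_mult_mat_sum[of x n n "top_rows y" n i j] x y
      by (auto simp: low_def top_rows_def intro!: sum.cong)
  qed (use x y in auto)
  then show ?thesis using x y by (simp add: mat_algebra, intro eq_matI) auto
qed

text \<open>The nonzero columns of \<open>low z\<close> lie in the first half, and reflection puts
  the nonzero rows of its image under \<open>dag\<close> in the second half. One product has no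
  inner index; the other would need indices increasing from the second half to the first.\<close>

lemma low_commute:
  assumes z: "z \<in> A"
  shows "low z * dag (low z) = 0\<^sub>m n n" "dag (low z) * low z = 0\<^sub>m n n" and "dag (low z) \<in> \<h>"
proof -
  define x where "x = low z"
  have x: "x \<in> A" using z by (simp add: x_def)
  have col: "2 * (j + 1) \<le> n" if "i < n" "j < n" "x $$ (i, j) \<noteq> 0" for i j
    using that by (simp add: x_def low_def split: if_splits)
  have row: "n \<le> 2 * i" if "i < n" "j < n" "dag x $$ (i, j) \<noteq> 0" for i j
  proof -
    have "x $$ (n - 1 - j, n - 1 - i) \<noteq> 0" using dag_support[OF x that] .
    from col[OF _ _ this] that show ?thesis by simp
  qed
  have C: "x \<in> C" "dag x \<in> C" using x by simp_all
  show "low z * dag (low z) = 0\<^sub>m n n" unfolding x_def[symmetric]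
  proof (rule zero_matI)
    fix i j assume ij: "i < n" "j < n" and "(x * dag x) $$ (i, j) \<noteq> 0"
    then obtain k where k: "k < n" "x $$ (i, k) \<noteq> 0" "dag x $$ (k, j) \<noteq> 0"
      using mult_nonzero_entry[OF C ij] by blast
    then show False using col[OF ij(1) k(1,2)] row[OF k(1) ij(2) k(3)] by simp
  qed (use C in simp)
  show "dag (low z) * low z = 0\<^sub>m n n" unfolding x_def[symmetric]
  proof (rule zero_matI)
    fix i j assume ij: "i < n" "j < n" and "(dag x * x) $$ (i, j) \<noteq> 0"
    then obtain k where k: "k < n" "dag x $$ (i, k) \<noteq> 0" "x $$ (k, j) \<noteq> 0"
      using mult_nonzero_entry[OF C(2,1) ij] by blast
    have "i < k" "k < j"
      using A_support[OF dag_A[OF x] ij(1) k(1,2)] A_support[OF x k(1) ij(2) k(3)] by simp_all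
    then show False using col[OF k(1) ij(2) k(3)] row[OF ij(1) k(1,2)] by simp
  qed (use C in simp)
  show "dag (low z) \<in> \<h>" unfolding x_def[symmetric]
  proof (rule h_I)
    fix i j assume ij: "i < n" "j < n" "dag x $$ (i, j) \<noteq> 0"
    show "n < 2 * (j + 1)" using row[OF ij] A_support[OF dag_A[OF x] ij] by simp
  qed (use x in simp)
qed

text \<open>With \<open>s = 1 + low z\<close> and \<open>t\<close> its image under the involution,
  \<open>s\<close> and \<open>t\<close> commute, so \<open>u = s * iv t\<close> is sent to its
  inverse and lies in \<open>U\<close>. Since \<open>t - 1\<close> lies in the half ideal,
  \<open>u\<close> agrees with \<open>g\<close> modulo that ideal.\<close>

lemma factorization:
  assumes g: "g \<in> G"
  shows "\<exists>h\<in>H. \<exists>u\<in>U. g = h * u"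
proof -
  obtain z where z: "z \<in> A" "g = 1\<^sub>m n + z" using g by (auto elim: G_E)
  define x where "x = low z"
  have x: "x \<in> A" and x0: "x * dag x = 0\<^sub>m n n" "dag x * x = 0\<^sub>m n n" and xh: "dag x \<in> \<h>"
    using low_commute[OF z(1)] z by (simp_all add: x_def)
  define s where "s = 1\<^sub>m n + x"
  define t where "t = 1\<^sub>m n + dag x"
  have s: "s \<in> G" and t: "t \<in> G" using x by (simp_all add: s_def t_def)
  have gs: "gd s = t" "gd t = s" using x by (simp_all add: s_def t_def gd_one_plus)
  have st: "s * t = t * s"
    using x x0 by (simp add: s_def t_def mat_algebra, intro eq_matI) auto
  define u where "u = s * iv t"
  have u: "u \<in> U"
  proof (rule U_I)
    have "iv t * iv s = iv s * iv t"
      using P.inv_mult_group[of s t] P.inv_mult_group[of t s] s t st by simp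
    moreover have "t * iv s = iv s * (s * t) * iv s" using s t by (simp add: mat_algebra)
    then have "t * iv s = iv s * t" using s t by (simp add: st mat_algebra iv_mult)
    ultimately show "gd u = iv u"
      using s t P.inv_mult_group[of s "iv t"] by (simp add: u_def gd_mult gd_iv gs)
  qed (use s t in \<open>simp add: u_def\<close>)
  have uG: "u \<in> G" using u by simp
  have gu: "g - u \<in> \<h>"
  proof -
    have "iv t - 1\<^sub>m n = - (iv t * dag x)" using one_minus_iv[OF t] x by (simp add: t_def)
    then have "s * (iv t - 1\<^sub>m n) \<in> \<h>" using s t xh by simp
    moreover have "z - x \<in> \<h>" unfolding x_def by (rule minus_low_h[OF z(1)])
    moreover have "g - u = (z - x) - s * (iv t - 1\<^sub>m n)"
      using s t z x by (simp add: u_def mat_algebra, intro eq_matI) (auto simp: s_def)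
    ultimately show ?thesis by simp
  qed
  define h where "h = g * iv u"
  have "h \<in> H"
  proof (rule H_I)
    show "h \<in> G" using g uG by (simp add: h_def)
    have "h - 1\<^sub>m n = (g - u) * iv u" using g uG by (simp add: h_def mat_algebra iv_mult)
    then show "h - 1\<^sub>m n \<in> \<h>" using gu uG by simp
  qed
  moreover have "g = h * u" using g uG by (simp add: h_def mat_algebra iv_mult)
  ultimately show ?thesis using u by blast
qed

section \<open>Springer morphisms\<close>

text \<open>The formula by inverses makes oddness and conjugation equivariance evident on all of
  \<open>G\<close>. On \<open>U\<close> it is half of \<open>x - dag x\<close> for
  \<open>x = v - 1\<close>.\<close>

definition skew_part :: "'a mat \<Rightarrow> 'a mat" where "skew_part v = half (v - iv v)"

lemma skew_part_V [simp]: assumes u: "u \<in> U" shows "skew_part u \<in> V"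
proof -
  have D: "dag (u - 1\<^sub>m n) \<in> C" using u by simp
  have "iv u = 1\<^sub>m n + dag (u - 1\<^sub>m n)" using U_gd[OF u] by (simp add: group_dag_def)
  then have "u - iv u = (u - 1\<^sub>m n) - dag (u - 1\<^sub>m n)"
    using D u by (simp only:) (intro eq_matI, auto)
  then show ?thesis unfolding skew_part_def using u by (simp add: half_V skew_V)
qed

lemma skew_part_iv: "u \<in> G \<Longrightarrow> skew_part (iv u) = - skew_part u"
  unfolding skew_part_def by (simp, intro eq_matI) (auto simp: algebra_simps)

lemma skew_part_conj:
  assumes g: "g \<in> G" and v: "v \<in> G"
  shows "skew_part (g * v * iv g) = g * skew_part v * iv g"
proof -
  have "iv (g * v * iv g) = g * iv v * iv g"
    using g v P.inv_mult_group[of "g * v" "iv g"] P.inv_mult_group[of g v] by (simp add: mat_algebra)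
  then show ?thesis using g v by (simp add: skew_part_def mat_algebra)
qed

text \<open>\<open>v - iv v\<close> factors as \<open>(1 + iv v) * (v - 1)\<close>, and half of the
  first factor is unipotent because 2 is invertible.\<close>

lemma skew_part_factor:
  assumes v: "v \<in> G"
  obtains p where "p \<in> G" "skew_part v = p * (v - 1\<^sub>m n)" "skew_part v = (v - 1\<^sub>m n) * p" "p * v = v * p"
proof
  define p where "p = half (1\<^sub>m n + iv v)"
  have pC: "p \<in> C" using v by (simp add: p_def)
  have "p - 1\<^sub>m n = half (iv v - 1\<^sub>m n)"
  proof (rule eq_matI)
    fix i j assume "i < dim_row (half (iv v - 1\<^sub>m n))" "j < dim_col (half (iv v - 1\<^sub>m n))"
    then have ij: "i < n" "j < n" by auto
    then show "(p - 1\<^sub>m n) $$ (i, j) = half (iv v - 1\<^sub>m n) $$ (i, j)"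
      using v two by (simp add: p_def field_simps)
  qed (use v in \<open>auto simp: p_def\<close>)
  then show "p \<in> G" unfolding G_iff using v pC by simp
  show "skew_part v = p * (v - 1\<^sub>m n)"
    using v by (simp add: p_def skew_part_def mat_algebra iv_mult, intro eq_matI) (auto simp: algebra_simps)
  show "skew_part v = (v - 1\<^sub>m n) * p"
    using v by (simp add: p_def skew_part_def mat_algebra iv_mult, intro eq_matI) (auto simp: algebra_simps)
  show "p * v = v * p" using v by (simp add: p_def mat_algebra iv_mult)
qed

section \<open>Polynomial expressions in nilpotent matrices\<close>

definition linear_comb :: "(nat \<Rightarrow> 'a) \<Rightarrow> (nat \<Rightarrow> 'a mat) \<Rightarrow> 'a mat" where
  "linear_comb a X = mat n n (\<lambda>(i, j). \<Sum>k=2..n. a k * X k $$ (i, j))"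

lemma linear_comb_C [simp]: "linear_comb a X \<in> C" by (simp add: linear_comb_def)

lemma linear_comb_cong:
  "(\<And>k. k \<in> {2..n} \<Longrightarrow> X k = Y k) \<Longrightarrow> linear_comb a X = linear_comb a Y"
  by (auto simp: linear_comb_def intro!: eq_matI sum.cong)

lemma linear_comb_mult:
  assumes X: "\<And>k. X k \<in> C" and g: "g \<in> C"
  shows "g * linear_comb a X = linear_comb a (\<lambda>k. g * X k)"
    and "linear_comb a X * g = linear_comb a (\<lambda>k. X k * g)"
proof -
  have "(g * linear_comb a X) $$ (i, j) = linear_comb a (\<lambda>k. g * X k) $$ (i, j)
    \<and> (linear_comb a X * g) $$ (i, j) = linear_comb a (\<lambda>k. X k * g) $$ (i, j)"
    if ij: "i < n" "j < n" for i j
  proof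
    have "(g * linear_comb a X) $$ (i, j) = (\<Sum>l<n. \<Sum>k=2..n. a k * (g $$ (i, l) * X k $$ (l, j)))"
      using ij by (subst index_mult_mat_sum[OF g linear_comb_C])
        (simp_all add: linear_comb_def sum_distrib_left mult_ac)
    also have "\<dots> = linear_comb a (\<lambda>k. g * X k) $$ (i, j)"
      using ij by (subst sum.swap) (simp add: linear_comb_def index_mult_mat_sum[OF g X] sum_distrib_left)
    finally show "(g * linear_comb a X) $$ (i, j) = linear_comb a (\<lambda>k. g * X k) $$ (i, j)" .
    have "(linear_comb a X * g) $$ (i, j) = (\<Sum>l<n. \<Sum>k=2..n. a k * (X k $$ (i, l) * g $$ (l, j)))"
      using ij by (subst index_mult_mat_sum[OF linear_comb_C g])
        (simp_all add: linear_comb_def sum_distrib_right mult.assoc)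
    also have "\<dots> = linear_comb a (\<lambda>k. X k * g) $$ (i, j)"
      using ij by (subst sum.swap) (simp add: linear_comb_def index_mult_mat_sum[OF X g] sum_distrib_left)
    finally show "(linear_comb a X * g) $$ (i, j) = linear_comb a (\<lambda>k. X k * g) $$ (i, j)" .
  qed
  then show "g * linear_comb a X = linear_comb a (\<lambda>k. g * X k)"
    "linear_comb a X * g = linear_comb a (\<lambda>k. X k * g)"
    using g dim_C[OF linear_comb_C] by (auto intro!: eq_matI)
qed

lemma linear_comb_A:
  assumes "\<And>k. k \<in> {2..n} \<Longrightarrow> X k \<in> A"
  shows "linear_comb a X \<in> A"
proof (rule A_I[OF linear_comb_C])
  fix i j assume ij: "i < n" "j < n" "linear_comb a X $$ (i, j) \<noteq> 0"
  then have "(\<Sum>k=2..n. a k * X k $$ (i, j)) \<noteq> 0" by (simp add: linear_comb_def)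
  then obtain k where k: "k \<in> {2..n}" "a k * X k $$ (i, j) \<noteq> 0"
    using sum.neutral[of "{2..n}" "\<lambda>k. a k * X k $$ (i, j)"] by blast
  then have "X k $$ (i, j) \<noteq> 0" by auto
  then show "i < j \<and> (i, j) \<in> r" by (rule A_support[OF assms[OF k(1)] ij(1,2)])
qed

lemma pow_A: "x \<in> A \<Longrightarrow> x ^\<^sub>m Suc k \<in> A"
  by (induction k) simp_all

lemma pow_intertwine:
  assumes "x \<in> C" "x' \<in> C" "g \<in> C" "g * x = x' * g"
  shows "g * x ^\<^sub>m k = x' ^\<^sub>m k * g"
proof (induction k)
  case (Suc k)
  have C: "x ^\<^sub>m k \<in> C" "x' ^\<^sub>m k \<in> C" using assms by simp_all
  have "g * x ^\<^sub>m Suc k = (g * x ^\<^sub>m k) * x" using assms C by (simp add: mat_algebra)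
  also have "\<dots> = x' ^\<^sub>m k * (g * x)" using Suc assms C by (simp add: mat_algebra)
  finally show ?case using assms C by (simp add: mat_algebra)
qed (use assms in simp)

lemma springer_cases:
  assumes "springer_morphism F n r dag f"
  obtains a where "\<And>x. x \<in> A \<Longrightarrow> f (1\<^sub>m n + x) = x + linear_comb a (\<lambda>k. x ^\<^sub>m k)"
  using assms by (auto simp: springer_morphism_def linear_comb_def)

text \<open>One power of \<open>x\<close> is factored out of the polynomial. What remains is
  \<open>1 + q\<close> with \<open>q\<close> nilpotent, hence an element of \<open>G\<close>, and it
  commutes with \<open>x\<close>.\<close>

lemma springer_factor:
  assumes f: "springer_morphism F n r dag f" and v: "v \<in> G"
  obtains p where "p \<in> G" "f v = p * (v - 1\<^sub>m n)" "f v = (v - 1\<^sub>m n) * p"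
proof -
  define x where "x = v - 1\<^sub>m n"
  have x: "x \<in> A" "v = 1\<^sub>m n + x" using v G_eq[of v] by (simp_all add: x_def)
  have xC: "x \<in> C" using x by simp
  obtain a where a: "\<And>x. x \<in> A \<Longrightarrow> f (1\<^sub>m n + x) = x + linear_comb a (\<lambda>k. x ^\<^sub>m k)"
    by (rule springer_cases[OF f]) blast
  \<comment> \<open>Lowering the exponents by one keeps them at least 1, as the sum starts at 2; so
    \<open>q\<close> stays in the pattern algebra.\<close>
  define q where "q = linear_comb a (\<lambda>k. x ^\<^sub>m (k - 1))"
  have powC: "x ^\<^sub>m k \<in> C" for k using xC by simp
  have k: "k - 1 = Suc (k - 2)" "k = Suc (k - 1)" if "k \<in> {2..n}" for k using that by auto
  have qA: "q \<in> A"
    unfolding q_def by (rule linear_comb_A) (metis k(1) pow_A x(1))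
  have qx: "q * x = linear_comb a (\<lambda>k. x ^\<^sub>m k)"
    unfolding q_def linear_comb_mult(2)[OF powC xC]
    by (rule linear_comb_cong) (metis k(2) pow_mat.simps(2))
  have xq: "x * q = q * x"
    unfolding q_def linear_comb_mult[OF powC xC] using pow_intertwine[OF xC xC xC refl] by simp
  show thesis
  proof (rule that[of "1\<^sub>m n + q"])
    show "1\<^sub>m n + q \<in> G" using qA by simp
    show "f v = (1\<^sub>m n + q) * (v - 1\<^sub>m n)" "f v = (v - 1\<^sub>m n) * (1\<^sub>m n + q)"
      unfolding x_def[symmetric] using x qA by (simp_all add: a mat_algebra qx xq)
  qed
qed

lemma springer_intertwine:
  assumes f: "springer_morphism F n r dag f" and x: "x \<in> A" and x': "x' \<in> A" and g: "g \<in> C"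
    and gx: "g * x = x' * g"
  shows "g * f (1\<^sub>m n + x) = f (1\<^sub>m n + x') * g"
proof -
  obtain a where a: "\<And>x. x \<in> A \<Longrightarrow> f (1\<^sub>m n + x) = x + linear_comb a (\<lambda>k. x ^\<^sub>m k)"
    by (rule springer_cases[OF f]) blast
  have C: "x ^\<^sub>m k \<in> C" "x' ^\<^sub>m k \<in> C" for k using x x' by simp_all
  have "g * linear_comb a (\<lambda>k. x ^\<^sub>m k) = linear_comb a (\<lambda>k. x' ^\<^sub>m k) * g"
    unfolding linear_comb_mult(1)[OF C(1) g] linear_comb_mult(2)[OF C(2) g]
    using pow_intertwine[OF A_C[OF x] A_C[OF x'] g gx] by simp
  then show ?thesis using x x' g gx by (simp add: a mat_algebra)
qed

lemma springer_conj:
  assumes f: "springer_morphism F n r dag f" and g: "g \<in> G" and v: "v \<in> G"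
  shows "f (g * v * iv g) = g * f v * iv g"
proof -
  define x where "x = v - 1\<^sub>m n"
  have x: "x \<in> A" "v = 1\<^sub>m n + x" using v G_eq[of v] by (simp_all add: x_def)
  have fC: "f (1\<^sub>m n + y) \<in> C" if "y \<in> A" for y
    using springer_factor[OF f one_plus_A[OF that]] that by (metis A_C G_C mult_C one_plus_minus_one)
  have e: "g * v * iv g = 1\<^sub>m n + g * x * iv g" using g x by (simp add: mat_algebra iv_mult)
  have "g * f (1\<^sub>m n + x) = f (1\<^sub>m n + g * x * iv g) * g"
    by (rule springer_intertwine[OF f]) (use g x in \<open>simp_all add: mat_algebra iv_mult\<close>)
  then have "g * f v * iv g = f (g * v * iv g) * g * iv g" by (simp add: x(2)[symmetric] e[symmetric])
  also have "\<dots> = f (g * v * iv g)"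
    using fC[of "g * x * iv g"] g x by (simp add: e iv_mult mat_algebra)
  finally show ?thesis by simp
qed

text \<open>From \<open>g = 1 + y\<close> follows \<open>2 y + y y = 0\<close>. Half of this is
  \<open>(1 + y/2) y = 0\<close>, and \<open>1 + y/2\<close> is invertible.\<close>

lemma no_involution:
  assumes g: "g \<in> G" and gg: "g * g = 1\<^sub>m n"
  shows "g = 1\<^sub>m n"
proof -
  obtain y where y: "y \<in> A" "g = 1\<^sub>m n + y" using g by (auto elim: G_E)
  have "1\<^sub>m n + (y + (y + y * y)) = 1\<^sub>m n"
    using gg y by (simp add: mat_algebra assoc_add_mat[of _ n n])
  then have "y + (y + y * y) = 0\<^sub>m n n"
    using add_self_cancel[of "1\<^sub>m n" "y + (y + y * y)"] y by simp
  then have "half (y + (y + y * y)) = 0\<^sub>m n n" by simp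
  moreover have "half (y + (y + y * y)) = (1\<^sub>m n + half y) * y"
    using y by (simp add: mat_algebra add_smult_distrib_left_mat[of _ n n] assoc_add_mat[of _ n n, symmetric])
  ultimately have "(1\<^sub>m n + half y) * y = 0\<^sub>m n n" by simp
  then have "y = 0\<^sub>m n n" using iv_mult_left(1)[of "1\<^sub>m n + half y" y] y iv_C[of "1\<^sub>m n + half y"] by simp
  then show ?thesis using y by simp
qed

text \<open>Without elements of order 2 the order of \<open>w\<close> is odd, so some power of
  \<open>w\<close> squares to \<open>w\<close>. Being a power, it inherits the symmetry and the
  commutation relations of \<open>w\<close>.\<close>

lemma square_root:
  assumes w: "w \<in> G" and sym: "gd w = w"
  obtains s where "s \<in> G" "gd s = s" "s * s = w" "\<And>c. c \<in> C \<Longrightarrow> c * w = w * c \<Longrightarrow> c * s = s * c"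
proof -
  have pos: "0 < P.ord w" using P.ord_ge_1[OF finite_G w] by simp
  have odd: "odd (P.ord w)"
  proof
    assume "even (P.ord w)"
    then obtain b where "P.ord w = 2 * b" by (rule evenE)
    then obtain k where k: "P.ord w = k + k" by (simp add: mult_2)
    have "(w [^]\<^bsub>P\<^esub> k) * (w [^]\<^bsub>P\<^esub> k) = 1\<^sub>m n"
      using P.nat_pow_mult[OF w, of k k] P.pow_ord_eq_1[OF w] by (simp add: k)
    then have "w [^]\<^bsub>P\<^esub> k = 1\<^sub>m n" using no_involution P.nat_pow_closed[OF w] by blast
    then have "P.ord w dvd k" using P.pow_eq_id[OF w] by simp
    then show False using k pos by (auto dest: dvd_imp_le)
  qed
  then obtain b where "P.ord w = 2 * b + 1" by (rule oddE)
  then have m: "Suc (P.ord w) = Suc b + Suc b" by simp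
  define m where "m = Suc b"
  note m = m[folded m_def]
  show thesis
  proof (rule that[of "w [^]\<^bsub>P\<^esub> m"])
    show sG: "w [^]\<^bsub>P\<^esub> m \<in> G" using P.nat_pow_closed[OF w] .
    have "gd (w [^]\<^bsub>P\<^esub> k) = w [^]\<^bsub>P\<^esub> k" for k :: nat
    proof (induction k)
      case (Suc k)
      have "gd (w [^]\<^bsub>P\<^esub> Suc k) = gd (w [^]\<^bsub>P\<^esub> k * w)" by simp
      also have "\<dots> = w * w [^]\<^bsub>P\<^esub> k"
        using w sym Suc P.nat_pow_closed[OF w, of k] by (simp add: gd_mult)
      also have "\<dots> = w [^]\<^bsub>P\<^esub> Suc k" using P.nat_pow_Suc2[OF w, of k] by simp
      finally show ?case .
    qed simp
    then show "gd (w [^]\<^bsub>P\<^esub> m) = w [^]\<^bsub>P\<^esub> m" .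
    show "(w [^]\<^bsub>P\<^esub> m) * (w [^]\<^bsub>P\<^esub> m) = w"
      using P.nat_pow_mult[OF w, of m m] P.pow_ord_eq_1[OF w] w by (simp add: m[symmetric])
    fix c assume c: "c \<in> C" "c * w = w * c"
    have "c * w [^]\<^bsub>P\<^esub> k = w [^]\<^bsub>P\<^esub> k * c" for k :: nat
    proof (induction k)
      case 0 show ?case using c by simp
    next
      case (Suc k)
      have wk: "w [^]\<^bsub>P\<^esub> k \<in> C" using P.nat_pow_closed[OF w, of k] by simp
      have "c * w [^]\<^bsub>P\<^esub> Suc k = (c * w [^]\<^bsub>P\<^esub> k) * w" using c wk w by (simp add: mat_algebra)
      also have "\<dots> = w [^]\<^bsub>P\<^esub> k * (c * w)" using Suc c wk w by (simp add: mat_algebra)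
      also have "\<dots> = w [^]\<^bsub>P\<^esub> Suc k * c" using c wk w by (simp add: mat_algebra)
      finally show ?case .
    qed
    then show "c * w [^]\<^bsub>P\<^esub> m = w [^]\<^bsub>P\<^esub> m * c" .
  qed
qed

text \<open>A Springer morphism multiplies the skew part \<open>c\<close> of \<open>v \<in> U\<close> by a unit \<open>w\<close> commuting with \<open>c\<close>.
  Since both matrices are skew, \<open>w\<close> may be symmetrized; it then has a symmetric square root.\<close>

lemma springer_orbit:
  assumes f: "springer_morphism F n r dag f" and v: "v \<in> U"
  shows "f v \<in> orbit P act (skew_part v)"
proof -
  have vG: "v \<in> G" using v by simp
  have fV: "f v \<in> V" using f v by (auto simp: springer_morphism_def)
  define c where "c = skew_part v"
  have cV: "c \<in> V" using v by (simp add: c_def)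
  have cC: "c \<in> C" and fC: "f v \<in> C" using cV fV by simp_all
  define x where "x = v - 1\<^sub>m n"
  have xC: "x \<in> C" using vG by (simp add: x_def)
  obtain p where p: "p \<in> G" "f v = p * x" "f v = x * p"
    using springer_factor[OF f vG] unfolding x_def by blast
  obtain p' where p': "p' \<in> G" "c = p' * x" "c = x * p'" "p' * v = v * p'"
    using skew_part_factor[OF vG] unfolding x_def c_def by blast
  \<comment> \<open>\<open>x\<close> is eliminated between \<open>c = p' * x\<close> and
    \<open>f v = p * x\<close>.\<close>
  define w where "w = p * iv p'"
  have wG: "w \<in> G" using p p' by (simp add: w_def)
  have wc: "w * c = f v" using p p' xC by (simp add: w_def mat_algebra iv_mult)
  \<comment> \<open>Since \<open>p'\<close> commutes with \<open>v\<close>, conjugation by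
    \<open>p'\<close> fixes \<open>f v\<close>; this moves the unit to the right of
    \<open>c\<close>.\<close>
  have "p' * v * iv p' = v" using p' vG by (simp add: mat_algebra iv_mult)
  then have "f v = p' * f v * iv p'" using springer_conj[OF f p'(1) vG] by simp
  also have "\<dots> = p' * (x * p) * iv p'" by (simp only: p(3))
  also have "\<dots> = c * w" using p(1) p'(1) xC unfolding p'(2) by (simp add: w_def mat_algebra)
  finally have cw: "c * w = f v" by simp
  \<comment> \<open>Applying \<open>dag\<close> to \<open>w * c = f v\<close>, with \<open>c\<close>
    and \<open>f v\<close> skew, shows that the image of \<open>w\<close> also carries
    \<open>c\<close> to \<open>f v\<close>, from the other side.\<close>
  have w1: "f v = c * gd w"
  proof -
    have "- f v = dag (w * c)" using V_dag[OF fV] by (simp add: wc)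
    also have "\<dots> = - (c * gd w)" using wG cV by (simp add: dag_G_mult V_dag)
    finally have "- (- f v) = - (- (c * gd w))" by simp
    then show ?thesis by simp
  qed
  have w2: "f v = gd w * c"
  proof -
    have "- f v = dag (c * w)" using V_dag[OF fV] by (simp add: cw)
    also have "\<dots> = - (gd w * c)" using wG cV by (simp add: dag_mult_G V_dag)
    finally have "- (- f v) = - (- (gd w * c))" by simp
    then show ?thesis by simp
  qed
  \<comment> \<open>All four relations between \<open>c\<close> and \<open>f v\<close> are linear in
    the unit, so the average of \<open>w\<close> and its image satisfies them too and is
    symmetric.\<close>
  define y where "y = half ((w - 1\<^sub>m n) + dag (w - 1\<^sub>m n))"
  have y: "y \<in> A" using wG by (simp add: y_def)
  have ysym: "dag y = y"
    using wG by (simp add: y_def dag_half dag_add comm_add_mat[of "dag (w - 1\<^sub>m n)" n n])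
  define w' where "w' = 1\<^sub>m n + y"
  have w'G: "w' \<in> G" and w'sym: "gd w' = w'" using y ysym by (simp_all add: w'_def gd_one_plus)
  have w'_eq: "w' = half (w + gd w)"
  proof (rule eq_matI)
    fix i j assume "i < dim_row (half (w + gd w))" "j < dim_col (half (w + gd w))"
    then have ij: "i < n" "j < n" using wG by auto
    have *: "t + 1 / 2 * ((v - t) + d) = 1 / 2 * (v + (t + d))" for t v d :: 'a
      using two by (simp add: field_simps)
    have D: "dag (w - 1\<^sub>m n) \<in> C" using wG by simp
    show "w' $$ (i, j) = half (w + gd w) $$ (i, j)"
      using wG ij D *[of "1\<^sub>m n $$ (i, j)" "w $$ (i, j)" "dag (w - 1\<^sub>m n) $$ (i, j)"]
      unfolding w'_def y_def group_dag_def by (simp del: index_one_mat(1))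
  qed (use wG y in \<open>auto simp: w'_def\<close>)
  have cw': "c * w' = f v" and w'c: "w' * c = f v"
  proof -
    have "c * w' = half (c * w + c * gd w)" "w' * c = half (w * c + gd w * c)"
      using wG cC by (simp_all add: w'_eq mat_algebra add_smult_distrib_left_mat[of _ n n])
    moreover have "half (f v + f v) = f v" using fC by (simp add: add_smult_distrib_left_mat[of _ n n])
    ultimately show "c * w' = f v" "w' * c = f v" using cw wc w1 w2 by simp_all
  qed
  obtain s where s: "s \<in> G" "gd s = s" "s * s = w'" "\<And>c. c \<in> C \<Longrightarrow> c * w' = w' * c \<Longrightarrow> c * s = s * c"
    using square_root[OF w'G w'sym] by blast
  \<comment> \<open>\<open>s\<close> is symmetric and commutes with \<open>c\<close>, so acting by
    it multiplies \<open>c\<close> by its square \<open>w'\<close>.\<close>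
  have "act s c = s * (c * s)" using s cC by (simp add: dag_act_def mat_algebra)
  also have "\<dots> = s * s * c" using s(4)[OF cC] cw' w'c s(1) cC by (simp add: mat_algebra)
  also have "\<dots> = f v" using s(3) w'c by simp
  finally have "f v = act s (skew_part v)" by (simp add: c_def)
  then show ?thesis unfolding orbit_def using s(1) by blast
qed

end

section \<open>The dual space\<close>

text \<open>Closure under negation and inversion is derived from finiteness: translation by an
  element and multiplication by a nonzero one are injective on \<open>F\<close>, hence
  surjective.\<close>

lemma finite_subfieldD:
  fixes F :: "'a::{field, finite} set"
  assumes "subfield F class_ring"
  shows "0 \<in> F" "1 \<in> F" "\<And>x y. x \<in> F \<Longrightarrow> y \<in> F \<Longrightarrow> x + y \<in> F" "\<And>x y. x \<in> F \<Longrightarrow> y \<in> F \<Longrightarrow> x * y \<in> F"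
    "\<And>x. x \<in> F \<Longrightarrow> - x \<in> F" "\<And>x y. x \<in> F \<Longrightarrow> y \<in> F \<Longrightarrow> x - y \<in> F" "\<And>x. x \<in> F \<Longrightarrow> inverse x \<in> F"
proof -
  note sub = subringE[OF subfieldE(1)[OF assms]]
  show zero: "0 \<in> F" and one: "1 \<in> F" using sub(2,3) by simp_all
  show add: "\<And>x y. x \<in> F \<Longrightarrow> y \<in> F \<Longrightarrow> x + y \<in> F" and mult: "\<And>x y. x \<in> F \<Longrightarrow> y \<in> F \<Longrightarrow> x * y \<in> F"
    using sub(6,7) by simp_all
  show neg: "- x \<in> F" if x: "x \<in> F" for x
  proof -
    have "(\<lambda>y. x + y) ` F = F" by (rule endo_inj_surj) (use x add in \<open>auto simp: inj_on_def\<close>)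
    then have "0 \<in> (\<lambda>y. x + y) ` F" using zero by simp
    then obtain y where "y \<in> F" "x + y = 0" by auto
    then show ?thesis using minus_unique[of x y] by simp
  qed
  show "x - y \<in> F" if "x \<in> F" "y \<in> F" for x y using add[OF that(1) neg[OF that(2)]] by simp
  show "inverse x \<in> F" if x: "x \<in> F" for x
  proof (cases "x = 0")
    case False
    have "(\<lambda>y. x * y) ` F = F" by (rule endo_inj_surj) (use x mult False in \<open>auto simp: inj_on_def\<close>)
    then have "1 \<in> (\<lambda>y. x * y) ` F" using one by simp
    then obtain y where "y \<in> F" "x * y = 1" by force
    then show ?thesis using inverse_unique[of x y] by simp
  qed (use zero in simp)
qed

lemma additive_characterD:
  assumes "nontrivial_additive_character F \<theta>"
  shows "\<And>x y. x \<in> F \<Longrightarrow> y \<in> F \<Longrightarrow> \<theta> (x + y) = \<theta> x * \<theta> y"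
    and "\<And>x. x \<in> F \<Longrightarrow> \<theta> x \<noteq> 0" and "\<exists>x\<in>F. \<theta> x \<noteq> 1"
proof -
  have h: "\<theta> \<in> hom (add_monoid (class_ring\<lparr>carrier := F\<rparr>)) (units_of (class_ring :: complex ring))"
    and ex: "\<exists>x\<in>F. \<theta> x \<noteq> 1"
    using assms by (simp_all add: nontrivial_additive_character_def)
  show "\<And>x y. x \<in> F \<Longrightarrow> y \<in> F \<Longrightarrow> \<theta> (x + y) = \<theta> x * \<theta> y"
    using h by (simp add: hom_def units_of_def)
  have "\<theta> x \<in> Units (class_ring :: complex ring)" if "x \<in> F" for x
    using h that by (auto simp: hom_def units_of_def)
  then have "\<exists>y. \<theta> x * y = 1" if "x \<in> F" for x using that by (auto simp: Units_def)
  then show "\<And>x. x \<in> F \<Longrightarrow> \<theta> x \<noteq> 0" by (metis mult_zero_left zero_neq_one)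
  show "\<exists>x\<in>F. \<theta> x \<noteq> 1" by (rule ex)
qed

text \<open>Reindexing by \<tau> multiplies the sum by \<open>k\<close>. This is the common form of
  the orthogonality arguments below.\<close>

lemma sum_eq_zero_by_translation:
  fixes E :: "'x \<Rightarrow> complex"
  assumes "bij_betw \<tau> X X" and "\<And>x. x \<in> X \<Longrightarrow> E (\<tau> x) = k * E x" and "k \<noteq> 1"
  shows "(\<Sum>x\<in>X. E x) = 0"
proof -
  have "(\<Sum>x\<in>X. E x) = (\<Sum>x\<in>X. E (\<tau> x))" by (rule sum.reindex_bij_betw[OF assms(1), symmetric])
  also have "\<dots> = k * (\<Sum>x\<in>X. E x)" by (simp add: assms(2) sum_distrib_left)
  finally show ?thesis using assms(3) by simp
qed

text \<open>If no \<open>k\<close> worked, the correlation of \<open>\<theta>'\<close> with every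
  \<open>x \<mapsto> \<theta> (k * x)\<close> would vanish. Summing the correlations over
  \<open>k\<close> leaves only the term \<open>x = 0\<close>, which contributes
  \<open>card F\<close>.\<close>

lemma additive_character_exhaust:
  fixes F :: "'a::{field, finite} set"
  assumes F: "subfield F class_ring"
    and \<theta>: "nontrivial_additive_character F \<theta>" and \<theta>': "nontrivial_additive_character F \<theta>'"
  obtains k where "k \<in> F" "k \<noteq> 0" "\<And>x. x \<in> F \<Longrightarrow> \<theta>' x = \<theta> (k * x)"
proof -
  note F' = finite_subfieldD[OF F] and t = additive_characterD[OF \<theta>] and t' = additive_characterD[OF \<theta>']
  have t0: "\<theta> 0 = 1" "\<theta>' 0 = 1" using t(1)[of 0 0] t(2)[of 0] t'(1)[of 0 0] t'(2)[of 0] F'(1) by simp_all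
  have finF: "finite F" by simp
  have "\<exists>k\<in>F. \<forall>x\<in>F. \<theta>' x = \<theta> (k * x)"
  proof (rule ccontr)
    assume no: "\<not> ?thesis"
    have 0: "(\<Sum>x\<in>F. \<theta>' x / \<theta> (k * x)) = 0" if k: "k \<in> F" for k
    proof -
      obtain y where y: "y \<in> F" "\<theta>' y \<noteq> \<theta> (k * y)" using no k by blast
      show ?thesis
      proof (rule sum_eq_zero_by_translation[where \<tau> = "\<lambda>x. x + y" and k = "\<theta>' y / \<theta> (k * y)"])
        show "bij_betw (\<lambda>x. x + y) F F"
          by (rule bij_betw_byWitness[where f' = "\<lambda>x. x - y"]) (use y F'(3,6) in auto)
        show "\<theta>' y / \<theta> (k * y) \<noteq> 1" using y k F'(4) t(2) by simp
        fix x assume x: "x \<in> F"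
        show "\<theta>' (x + y) / \<theta> (k * (x + y)) = \<theta>' y / \<theta> (k * y) * (\<theta>' x / \<theta> (k * x))"
          using x y(1) k F'(4) by (simp add: t(1) t'(1) distrib_left mult.commute)
      qed
    qed
    have inner: "(\<Sum>k\<in>F. 1 / \<theta> (k * x)) = 0" if x: "x \<in> F" "x \<noteq> 0" for x
    proof -
      obtain z where z: "z \<in> F" "\<theta> z \<noteq> 1" using t(3) by blast
      define l where "l = z * inverse x"
      have l: "l \<in> F" "l * x = z" using x z F'(4,7) by (simp_all add: l_def)
      show ?thesis
      proof (rule sum_eq_zero_by_translation[where \<tau> = "\<lambda>k. k + l" and k = "1 / \<theta> z"])
        show "bij_betw (\<lambda>k. k + l) F F"
          by (rule bij_betw_byWitness[where f' = "\<lambda>x. x - l"]) (use l F'(3,6) in auto)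
        show "1 / \<theta> z \<noteq> 1" using z by simp
        fix k assume "k \<in> F"
        then show "1 / \<theta> ((k + l) * x) = 1 / \<theta> z * (1 / \<theta> (k * x))"
          using x l z F'(4) by (simp add: distrib_right t(1))
      qed
    qed
    have "0 = (\<Sum>k\<in>F. \<Sum>x\<in>F. \<theta>' x / \<theta> (k * x))" by (simp add: 0)
    also have "\<dots> = (\<Sum>x\<in>F. \<theta>' x * (\<Sum>k\<in>F. 1 / \<theta> (k * x)))"
      by (subst sum.swap) (simp add: sum_distrib_left)
    also have "\<dots> = (\<Sum>x\<in>F. if x = 0 then of_nat (card F) else 0)"
      by (rule sum.cong[OF refl]) (simp add: inner t0)
    also have "\<dots> = of_nat (card F)" using F'(1) finF by simp
    finally have "card F = 0" by simp
    then show False using F'(1) finF by auto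
  qed
  then obtain k where k: "k \<in> F" "\<And>x. x \<in> F \<Longrightarrow> \<theta>' x = \<theta> (k * x)" by blast
  moreover have "k \<noteq> 0" using t'(3) k t0 by auto
  ultimately show thesis using that by blast
qed

section \<open>Functionals on the skew elements and their Fourier pairing\<close>

locale dag_pattern_character = dag_pattern n r F dag
  for n r and F :: "'a::{field, finite} set" and dag +
  fixes \<theta> :: "'a \<Rightarrow> complex"
  assumes F_subfield: "subfield F class_ring"
    and \<theta>: "nontrivial_additive_character F \<theta>"
begin

lemmas F_zero [simp] = finite_subfieldD(1)[OF F_subfield]
lemmas F_one [simp] = finite_subfieldD(2)[OF F_subfield]
lemmas F_add [simp] = finite_subfieldD(3)[OF F_subfield]
lemmas F_mult [simp] = finite_subfieldD(4)[OF F_subfield]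
lemmas F_uminus [simp] = finite_subfieldD(5)[OF F_subfield]
lemmas F_minus [simp] = finite_subfieldD(6)[OF F_subfield]
lemmas F_inverse [simp] = finite_subfieldD(7)[OF F_subfield]

lemmas \<theta>_add = additive_characterD(1)[OF \<theta>]
lemmas \<theta>_nonzero = additive_characterD(2)[OF \<theta>]

lemma \<theta>_zero [simp]: "\<theta> 0 = 1" using \<theta>_add[of 0 0] \<theta>_nonzero[of 0] by simp

lemma \<theta>_uminus: "x \<in> F \<Longrightarrow> \<theta> (- x) = inverse (\<theta> x)"
  using \<theta>_add[of x "- x"] inverse_unique[of "\<theta> x" "\<theta> (- x)"] by simp

lemma \<theta>_minus: "x \<in> F \<Longrightarrow> y \<in> F \<Longrightarrow> \<theta> (x - y) = \<theta> x / \<theta> y"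
  using \<theta>_add[of x "- y"] by (simp add: \<theta>_uminus divide_inverse)

lemma \<theta>_scale:
  assumes "x \<in> F" "x \<noteq> 0"
  obtains c where "c \<in> F" "\<theta> (c * x) \<noteq> 1"
proof -
  obtain z where "z \<in> F" "\<theta> z \<noteq> 1" using additive_characterD(3)[OF \<theta>] by blast
  then show thesis using that[of "z * inverse x"] assms by (simp add: mult.assoc)
qed

abbreviation "D \<equiv> mat_dual F V"
abbreviation "dact \<equiv> dual_act n r dag"

lemma D_F [simp]: "\<nu> \<in> D \<Longrightarrow> x \<in> V \<Longrightarrow> \<nu> x \<in> F"
  and D_add: "\<nu> \<in> D \<Longrightarrow> x \<in> V \<Longrightarrow> y \<in> V \<Longrightarrow> \<nu> (x + y) = \<nu> x + \<nu> y"
  and D_smult: "\<nu> \<in> D \<Longrightarrow> c \<in> F \<Longrightarrow> x \<in> V \<Longrightarrow> \<nu> (c \<cdot>\<^sub>m x) = c * \<nu> x"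
  and D_ext: "\<nu> \<in> D \<Longrightarrow> x \<notin> V \<Longrightarrow> \<nu> x = undefined"
  by (auto simp: mat_dual_def)

lemma D_I:
  "(\<And>x. x \<in> V \<Longrightarrow> \<nu> x \<in> F) \<Longrightarrow> (\<And>x y. x \<in> V \<Longrightarrow> y \<in> V \<Longrightarrow> \<nu> (x + y) = \<nu> x + \<nu> y) \<Longrightarrow>
    (\<And>c x. c \<in> F \<Longrightarrow> x \<in> V \<Longrightarrow> \<nu> (c \<cdot>\<^sub>m x) = c * \<nu> x) \<Longrightarrow> (\<And>x. x \<notin> V \<Longrightarrow> \<nu> x = undefined) \<Longrightarrow> \<nu> \<in> D"
  by (auto simp: mat_dual_def)

lemma D_zero: "\<nu> \<in> D \<Longrightarrow> \<nu> (0\<^sub>m n n) = 0"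
  using D_add[of \<nu> "0\<^sub>m n n" "0\<^sub>m n n"]
  by (simp only: V_zero right_add_zero_mat[OF zero_carrier_mat] add_cancel_right_right)

lemma D_uminus: "\<nu> \<in> D \<Longrightarrow> x \<in> V \<Longrightarrow> \<nu> (- x) = - \<nu> x"
  using D_add[of \<nu> x "- x"] by (simp add: add_uminus_self D_zero eq_neg_iff_add_eq_0 add.commute)

lemma D_minus: "\<nu> \<in> D \<Longrightarrow> x \<in> V \<Longrightarrow> y \<in> V \<Longrightarrow> \<nu> (x - y) = \<nu> x - \<nu> y"
  using D_add[of \<nu> x "- y"] by (simp add: D_uminus add_uminus_minus_mat[of _ n n])

lemma finite_D: "finite D"
  by (rule finite_subset[of _ "V \<rightarrow>\<^sub>E F"]) (auto simp: mat_dual_def finite_V intro: finite_PiE)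

lemma D_scale: "k \<in> F \<Longrightarrow> \<nu> \<in> D \<Longrightarrow> (\<lambda>x\<in>V. k * \<nu> x) \<in> D"
  by (rule D_I) (simp_all add: D_add D_smult distrib_left mult.left_commute)

lemma D_sum: "\<nu> \<in> D \<Longrightarrow> \<mu> \<in> D \<Longrightarrow> (\<lambda>x\<in>V. \<nu> x + \<mu> x) \<in> D"
  by (rule D_I) (simp_all add: D_add D_smult distrib_left)

lemma dact_D [simp]: "g \<in> G \<Longrightarrow> \<nu> \<in> D \<Longrightarrow> dact g \<nu> \<in> D"
  by (rule D_I) (simp_all add: dual_act_def D_add D_smult act_add act_smult)

lemma dact_apply: "x \<in> V \<Longrightarrow> dact g \<nu> x = \<nu> (act (iv g) x)"
  by (simp add: dual_act_def)

lemma action_D: "finite_action P D dact"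
proof
  show "finite G" by (rule finite_G)
  show "finite D" by (rule finite_D)
  show "dact g \<nu> \<in> D" if "g \<in> G" "\<nu> \<in> D" for g \<nu> using that by simp
  show "dact \<one>\<^bsub>P\<^esub> \<nu> = \<nu>" if "\<nu> \<in> D" for \<nu>
  proof
    fix x show "dact \<one>\<^bsub>P\<^esub> \<nu> x = \<nu> x"
      using that P.inv_one by (cases "x \<in> V") (simp_all add: dual_act_def D_ext dag_act_def)
  qed
  show "dact (g \<otimes>\<^bsub>P\<^esub> h) \<nu> = dact g (dact h \<nu>)" if gh: "g \<in> G" "h \<in> G" and \<nu>: "\<nu> \<in> D" for g h \<nu>
  proof
    fix x show "dact (g \<otimes>\<^bsub>P\<^esub> h) \<nu> x = dact g (dact h \<nu>) x"
      using gh P.inv_mult_group[of g h] by (cases "x \<in> V") (simp_all add: dual_act_def act_mult)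
  qed
qed

abbreviation pr :: "('a mat \<Rightarrow> 'a) \<Rightarrow> 'a mat \<Rightarrow> complex" where "pr \<nu> x \<equiv> \<theta> (\<nu> x)"

lemma pr_quotient: "\<nu> \<in> D \<Longrightarrow> \<mu> \<in> D \<Longrightarrow> x \<in> V \<Longrightarrow> pr \<nu> x / pr \<mu> x = \<theta> (\<nu> x - \<mu> x)"
  by (simp add: \<theta>_minus)

lemma translation_V: "y \<in> V \<Longrightarrow> bij_betw (\<lambda>x. x + y) V V"
proof (rule bij_betw_byWitness[where f' = "\<lambda>x. x - y"])
  assume y: "y \<in> V"
  show "\<forall>x\<in>V. x + y - y = x"
  proof
    fix x assume "x \<in> V"
    then have "x \<in> C" "y \<in> C" using y by simp_all
    then show "x + y - y = x" by (intro eq_matI) auto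
  qed
  show "\<forall>x\<in>V. x - y + y = x"
  proof
    fix x assume "x \<in> V"
    then have "x \<in> C" "y \<in> C" using y by simp_all
    then show "x - y + y = x" by (intro eq_matI) auto
  qed
qed auto

lemma sum_pr_V:
  assumes \<nu>: "\<nu> \<in> D" and \<mu>: "\<mu> \<in> D"
  shows "(\<Sum>x\<in>V. pr \<nu> x / pr \<mu> x) = of_nat (card V) * of_bool (\<nu> = \<mu>)"
proof (cases "\<nu> = \<mu>")
  case True
  then show ?thesis using \<mu> by (simp add: \<theta>_nonzero)
next
  case False
  then obtain x0 where x0: "x0 \<in> V" "\<nu> x0 \<noteq> \<mu> x0"
    using \<nu> \<mu> D_ext by (metis ext)
  \<comment> \<open>\<theta> may be trivial at the difference of the two values itself; at a
    multiple by some \<open>c\<close> in \<open>F\<close> it is not, and linearity over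
    \<open>F\<close> transfers \<open>c\<close> to the vector.\<close>
  obtain c where c: "c \<in> F" "\<theta> (c * (\<nu> x0 - \<mu> x0)) \<noteq> 1"
    by (rule \<theta>_scale[of "\<nu> x0 - \<mu> x0"]) (use \<nu> \<mu> x0 in simp_all)
  define y where "y = c \<cdot>\<^sub>m x0"
  have y: "y \<in> V" using c x0 by (simp add: y_def)
  have "(\<Sum>x\<in>V. pr \<nu> x / pr \<mu> x) = 0"
  proof (rule sum_eq_zero_by_translation[OF translation_V[OF y]])
    show "pr \<nu> y / pr \<mu> y \<noteq> 1"
      using c x0 \<nu> \<mu> y by (simp add: pr_quotient) (simp add: y_def D_smult right_diff_distrib)
    fix x assume "x \<in> V"
    then show "pr \<nu> (x + y) / pr \<mu> (x + y) = pr \<nu> y / pr \<mu> y * (pr \<nu> x / pr \<mu> x)"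
      using \<nu> \<mu> y by (simp add: D_add \<theta>_add mult.commute)
  qed
  then show ?thesis using False by simp
qed

text \<open>A subspace \<open>W\<close> that is maximal among those avoiding \<open>z\<close> is a hyperplane complementary to \<open>z\<close>.\<close>

lemma D_separates:
  assumes z: "z \<in> V" "z \<noteq> 0\<^sub>m n n"
  obtains \<nu> where "\<nu> \<in> D" "\<nu> z \<noteq> 0"
proof -
  define sp where "sp W \<longleftrightarrow> W \<subseteq> V \<and> 0\<^sub>m n n \<in> W \<and> (\<forall>x\<in>W. \<forall>y\<in>W. x + y \<in> W) \<and>
    (\<forall>c\<in>F. \<forall>x\<in>W. c \<cdot>\<^sub>m x \<in> W)" for W
  have VC: "x \<in> C" if "x \<in> V" for x using that by simp
  have "sp {0\<^sub>m n n}" by (auto simp: sp_def intro!: eq_matI)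
  then have ex: "sp {0\<^sub>m n n} \<and> z \<notin> {0\<^sub>m n n}" using z by simp
  have bound: "\<forall>W. sp W \<and> z \<notin> W \<longrightarrow> card W < Suc (card V)"
    using card_mono[OF finite_V] by (auto simp: sp_def less_Suc_eq_le)
  obtain W where W: "sp W" "z \<notin> W" and max: "\<And>W'. sp W' \<Longrightarrow> z \<notin> W' \<Longrightarrow> card W' \<le> card W"
    using ex_has_greatest_nat[OF ex bound] by blast
  have WV: "W \<subseteq> V" and W0: "0\<^sub>m n n \<in> W" and Wadd: "\<And>x y. x \<in> W \<Longrightarrow> y \<in> W \<Longrightarrow> x + y \<in> W"
    and Wsm: "\<And>c x. c \<in> F \<Longrightarrow> x \<in> W \<Longrightarrow> c \<cdot>\<^sub>m x \<in> W" using W(1) by (auto simp: sp_def)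
  have zC: "z \<in> C" using z by simp
  have exc: "\<exists>c\<in>F. v - c \<cdot>\<^sub>m z \<in> W" if v: "v \<in> V" for v
  proof (cases "v \<in> W")
    case True
    have "v - 0 \<cdot>\<^sub>m z = v" using VC[OF v] zC by (intro eq_matI) auto
    then show ?thesis using True F_zero by metis
  next
    case False
    have vC: "v \<in> C" by (rule VC[OF v])
    \<comment> \<open>Adding the line through \<open>v\<close> to \<open>W\<close> gives a larger
      subspace, so by maximality it contains \<open>z\<close>; solving for \<open>v\<close> shows
      that \<open>v\<close> is congruent to a multiple of \<open>z\<close> modulo
      \<open>W\<close>.\<close>
    define W' where "W' = (\<lambda>(w, c). w + c \<cdot>\<^sub>m v) ` (W \<times> F)"
    have memI: "w + c \<cdot>\<^sub>m v \<in> W'" if "w \<in> W" "c \<in> F" for w c using that by (auto simp: W'_def)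
    have memE: "\<exists>w\<in>W. \<exists>c\<in>F. x = w + c \<cdot>\<^sub>m v" if "x \<in> W'" for x using that by (auto simp: W'_def)
    have "sp W'"
      unfolding sp_def
    proof (intro conjI ballI)
      show "W' \<subseteq> V" using WV v by (auto simp: W'_def)
      have "0\<^sub>m n n = 0\<^sub>m n n + 0 \<cdot>\<^sub>m v" using vC by (intro eq_matI) auto
      then show "0\<^sub>m n n \<in> W'" using memI[OF W0 F_zero] by simp
      fix x assume "x \<in> W'"
      then obtain w c where x: "w \<in> W" "c \<in> F" "x = w + c \<cdot>\<^sub>m v" using memE by blast
      have wC: "w \<in> C" using x WV by auto
      show "d \<cdot>\<^sub>m x \<in> W'" if d: "d \<in> F" for d
      proof -
        have "d \<cdot>\<^sub>m x = d \<cdot>\<^sub>m w + (d * c) \<cdot>\<^sub>m v"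
          unfolding x(3) using wC vC by (intro eq_matI) (auto simp: algebra_simps)
        then show ?thesis using memI[of "d \<cdot>\<^sub>m w" "d * c"] x d Wsm by simp
      qed
      fix y assume "y \<in> W'"
      then obtain w' c' where y: "w' \<in> W" "c' \<in> F" "y = w' + c' \<cdot>\<^sub>m v" using memE by blast
      have w'C: "w' \<in> C" using y WV by auto
      have "x + y = (w + w') + (c + c') \<cdot>\<^sub>m v"
        unfolding x(3) y(3) using wC w'C vC by (intro eq_matI) (auto simp: algebra_simps)
      then show "x + y \<in> W'" using memI[of "w + w'" "c + c'"] x y Wadd by simp
    qed
    moreover have "W \<subset> W'"
    proof
      show "W \<subseteq> W'"
      proof
        fix w assume w: "w \<in> W"
        have "w \<in> C" using w WV by auto
        then have "w = w + 0 \<cdot>\<^sub>m v" using vC by (intro eq_matI) auto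
        then show "w \<in> W'" using memI[OF w F_zero] by simp
      qed
      have "v = 0\<^sub>m n n + 1 \<cdot>\<^sub>m v" using vC by (intro eq_matI) auto
      then have "v \<in> W'" using memI[OF W0 F_one] by simp
      then show "W \<noteq> W'" using False by blast
    qed
    moreover have "finite W'" using finite_subset[OF WV finite_V] by (simp add: W'_def)
    ultimately have "z \<in> W'" using max[of W'] psubset_card_mono[of W' W] by (meson not_le)
    then obtain w c where wc: "w \<in> W" "c \<in> F" "z = w + c \<cdot>\<^sub>m v" using memE by blast
    have wC: "w \<in> C" using wc WV by auto
    have c0: "c \<noteq> 0"
    proof
      assume "c = 0"
      then have "z = w" unfolding wc(3) using wC vC by (intro eq_matI) auto
      then show False using wc W by simp
    qed
    have "v - inverse c \<cdot>\<^sub>m z = (- inverse c) \<cdot>\<^sub>m w"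
      unfolding wc(3) using wC vC c0 by (intro eq_matI) (auto simp: field_simps)
    then have "v - inverse c \<cdot>\<^sub>m z \<in> W" using Wsm[of "- inverse c" w] wc by simp
    then show ?thesis using wc by (intro bexI[of _ "inverse c"]) simp_all
  qed
  have uni: "c = d" if c: "c \<in> F" "v - c \<cdot>\<^sub>m z \<in> W" and d: "d \<in> F" "v - d \<cdot>\<^sub>m z \<in> W" and v: "v \<in> V" for v c d
  proof (rule ccontr)
    assume ne: "c \<noteq> d"
    have vC: "v \<in> C" by (rule VC[OF v])
    \<comment> \<open>Two different coefficients would, after subtraction and division by their
      difference, put \<open>z\<close> into \<open>W\<close>.\<close>
    define e where "e = inverse (d - c)"
    have e: "e \<in> F" "e * (d - c) = 1" using c d ne by (simp_all add: e_def)
    have "e \<cdot>\<^sub>m ((v - c \<cdot>\<^sub>m z) + (- 1) \<cdot>\<^sub>m (v - d \<cdot>\<^sub>m z)) = z"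
    proof (rule eq_matI)
      fix i j assume ij: "i < dim_row z" "j < dim_col z"
      have "e * ((v $$ (i, j) - c * z $$ (i, j)) + (- 1) * (v $$ (i, j) - d * z $$ (i, j))) = e * (d - c) * z $$ (i, j)"
        by (simp add: algebra_simps)
      then show "(e \<cdot>\<^sub>m ((v - c \<cdot>\<^sub>m z) + (- 1) \<cdot>\<^sub>m (v - d \<cdot>\<^sub>m z))) $$ (i, j) = z $$ (i, j)"
        using ij zC vC e(2) by simp
    qed (use zC vC in auto)
    moreover have "e \<cdot>\<^sub>m ((v - c \<cdot>\<^sub>m z) + (- 1) \<cdot>\<^sub>m (v - d \<cdot>\<^sub>m z)) \<in> W"
      by (intro Wsm Wadd e(1) c(2) d(2)) simp
    ultimately show False using W by simp
  qed
  \<comment> \<open>The functional is the coordinate along \<open>z\<close> in the decomposition of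
    \<open>V\<close> into \<open>W\<close> and the line of \<open>z\<close>; it takes the value 1 at
    \<open>z\<close>.\<close>
  define \<nu> where "\<nu> = (\<lambda>v\<in>V. THE c. c \<in> F \<and> v - c \<cdot>\<^sub>m z \<in> W)"
  have \<nu>: "\<nu> v \<in> F \<and> v - \<nu> v \<cdot>\<^sub>m z \<in> W" if v: "v \<in> V" for v
  proof -
    have "\<exists>!c. c \<in> F \<and> v - c \<cdot>\<^sub>m z \<in> W" using exc[OF v] uni[OF _ _ _ _ v] by blast
    from theI'[OF this] show ?thesis using v by (simp add: \<nu>_def)
  qed
  have \<nu>_eq: "\<nu> v = c" if "v \<in> V" "c \<in> F" "v - c \<cdot>\<^sub>m z \<in> W" for v c
    using \<nu>[OF that(1)] uni[OF _ _ that(2,3,1)] by blast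
  show thesis
  proof (rule that)
    show "\<nu> \<in> D"
    proof (rule D_I)
      show "\<nu> x \<in> F" if "x \<in> V" for x using \<nu>[OF that] by simp
      show "\<nu> x = undefined" if "x \<notin> V" for x using that by (simp add: \<nu>_def)
      show "\<nu> (x + y) = \<nu> x + \<nu> y" if xy: "x \<in> V" "y \<in> V" for x y
      proof (rule \<nu>_eq)
        have "x + y - (\<nu> x + \<nu> y) \<cdot>\<^sub>m z = (x - \<nu> x \<cdot>\<^sub>m z) + (y - \<nu> y \<cdot>\<^sub>m z)"
          using VC[OF xy(1)] VC[OF xy(2)] zC by (intro eq_matI) (auto simp: algebra_simps)
        then show "x + y - (\<nu> x + \<nu> y) \<cdot>\<^sub>m z \<in> W" using Wadd \<nu> xy by simp
      qed (use xy \<nu> in simp_all)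
      show "\<nu> (c \<cdot>\<^sub>m x) = c * \<nu> x" if cx: "c \<in> F" "x \<in> V" for c x
      proof (rule \<nu>_eq)
        have "c \<cdot>\<^sub>m x - (c * \<nu> x) \<cdot>\<^sub>m z = c \<cdot>\<^sub>m (x - \<nu> x \<cdot>\<^sub>m z)"
          using VC[OF cx(2)] zC by (intro eq_matI) (auto simp: algebra_simps)
        then show "c \<cdot>\<^sub>m x - (c * \<nu> x) \<cdot>\<^sub>m z \<in> W" using Wsm \<nu> cx by simp
      qed (use cx \<nu> in simp_all)
    qed
    have "z - 1 \<cdot>\<^sub>m z = 0\<^sub>m n n" using zC by (intro eq_matI) auto
    then have "\<nu> z = 1" using \<nu>_eq[OF z(1) F_one] W0 by simp
    then show "\<nu> z \<noteq> 0" by simp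
  qed
qed

text \<open>The translation takes place in the dual: a functional separating \<open>x\<close> and
  \<open>y\<close>, scaled so that \<theta> detects the difference, is added to the summation
  variable.\<close>

lemma sum_pr_D:
  assumes x: "x \<in> V" and y: "y \<in> V"
  shows "(\<Sum>\<nu>\<in>D. pr \<nu> x / pr \<nu> y) = of_nat (card D) * of_bool (x = y)"
proof (cases "x = y")
  case True
  then show ?thesis using y by (simp add: \<theta>_nonzero)
next
  case False
  have "x - y \<noteq> 0\<^sub>m n n"
  proof
    assume 0: "x - y = 0\<^sub>m n n"
    have C: "x \<in> C" "y \<in> C" using x y by simp_all
    have "x = y"
    proof (rule eq_matI)
      fix i j assume ij: "i < dim_row y" "j < dim_col y"
      from arg_cong[OF 0, of "\<lambda>m. m $$ (i, j)"] show "x $$ (i, j) = y $$ (i, j)" using ij C by simp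
    qed (use C in auto)
    with False show False by simp
  qed
  then obtain \<mu> where \<mu>: "\<mu> \<in> D" "\<mu> (x - y) \<noteq> 0" using D_separates x y V_minus by blast
  obtain c where c: "c \<in> F" "\<theta> (c * \<mu> (x - y)) \<noteq> 1"
    by (rule \<theta>_scale[of "\<mu> (x - y)"]) (use \<mu> x y in simp_all)
  define \<epsilon> where "\<epsilon> = (\<lambda>x\<in>V. c * \<mu> x)"
  have \<epsilon>: "\<epsilon> \<in> D" using D_scale c \<mu> by (simp add: \<epsilon>_def)
  have "(\<Sum>\<nu>\<in>D. pr \<nu> x / pr \<nu> y) = 0"
  proof (rule sum_eq_zero_by_translation[where \<tau> = "\<lambda>\<nu>. \<lambda>x\<in>V. \<nu> x + \<epsilon> x" and k = "pr \<epsilon> x / pr \<epsilon> y"])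
    have m: "(\<lambda>x\<in>V. \<nu> x - \<epsilon> x) \<in> D" if "\<nu> \<in> D" for \<nu>
    proof -
      have "(\<lambda>x\<in>V. \<nu> x + (\<lambda>x\<in>V. - 1 * \<epsilon> x) x) \<in> D" by (intro D_sum D_scale that \<epsilon>) simp
      also have "(\<lambda>x\<in>V. \<nu> x + (\<lambda>x\<in>V. - 1 * \<epsilon> x) x) = (\<lambda>x\<in>V. \<nu> x - \<epsilon> x)" by (rule restrict_ext) simp
      finally show ?thesis .
    qed
    have e: "(\<lambda>x\<in>V. \<nu> x) = \<nu>" if "\<nu> \<in> D" for \<nu> using D_ext[OF that] by (intro ext) (simp add: restrict_def)
    show "bij_betw (\<lambda>\<nu>. \<lambda>x\<in>V. \<nu> x + \<epsilon> x) D D"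
      by (rule bij_betw_byWitness[where f' = "\<lambda>\<nu>. \<lambda>x\<in>V. \<nu> x - \<epsilon> x"])
        (use m D_sum[OF _ \<epsilon>] in \<open>auto simp: e cong: restrict_cong\<close>)
    show "pr \<epsilon> x / pr \<epsilon> y \<noteq> 1"
    proof -
      have "pr \<epsilon> x / pr \<epsilon> y = \<theta> (\<epsilon> (x - y))" using \<epsilon> x y by (simp add: D_minus \<theta>_minus)
      then show ?thesis using c x y by (simp add: \<epsilon>_def)
    qed
    fix \<nu> assume "\<nu> \<in> D"
    then show "pr (\<lambda>x\<in>V. \<nu> x + \<epsilon> x) x / pr (\<lambda>x\<in>V. \<nu> x + \<epsilon> x) y = pr \<epsilon> x / pr \<epsilon> y * (pr \<nu> x / pr \<nu> y)"
      using x y \<epsilon> by (simp add: \<theta>_add mult.commute)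
  qed
  then show ?thesis using False by simp
qed

text \<open>The sum of \<open>pr \<nu> x\<close> over both variables is evaluated by each
  orthogonality relation, once against the zero functional and once against the zero matrix.\<close>

lemma card_V_D: "card V = card D"
proof -
  define o0 where "o0 = (\<lambda>x\<in>V. 0 :: 'a)"
  have o0: "o0 \<in> D" by (rule D_I) (simp_all add: o0_def)
  have "(of_nat (card V) :: complex) = (\<Sum>\<nu>\<in>D. of_nat (card V) * of_bool (\<nu> = o0))"
    using o0 finite_D by (simp add: of_bool_def if_distrib[of "\<lambda>x. _ * x"] cong: if_cong)
  also have "\<dots> = (\<Sum>\<nu>\<in>D. \<Sum>x\<in>V. pr \<nu> x / pr o0 x)" by (simp add: sum_pr_V o0)
  also have "\<dots> = (\<Sum>\<nu>\<in>D. \<Sum>x\<in>V. pr \<nu> x / pr \<nu> (0\<^sub>m n n))"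
    by (intro sum.cong refl) (simp add: o0_def D_zero)
  also have "\<dots> = (\<Sum>x\<in>V. of_nat (card D) * of_bool (x = 0\<^sub>m n n))"
    by (subst sum.swap) (simp add: sum_pr_D)
  also have "\<dots> = of_nat (card D)"
    using finite_V V_zero by (simp add: of_bool_def if_distrib[of "\<lambda>x. _ * x"] del: V_zero cong: if_cong)
  finally show ?thesis by (simp only: of_nat_eq_iff)
qed

end

section \<open>Polarizations and the main theorem\<close>

locale dag_pattern_springer = dag_pattern_character n r F dag \<theta>
  for n r and F :: "'a::{field, finite} set" and dag \<theta> +
  fixes f :: "'a mat \<Rightarrow> 'a mat"
  assumes f: "springer_morphism F n r dag f"
begin

lemma bij_f: "bij_betw f U V"
proof -
  have "bij_betw f G A" and im: "f ` U = V" using f by (auto simp: springer_morphism_def)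
  then have "inj_on f U" using inj_on_subset[of f G U] subgroup.subset[OF subgroup_U] by (simp add: bij_betw_def)
  then show ?thesis using im by (simp add: bij_betw_def)
qed

lemma f_V: "u \<in> U \<Longrightarrow> f u \<in> V" using bij_f by (auto simp: bij_betw_def)

lemma f_one: "f (1\<^sub>m n) = 0\<^sub>m n n"
proof -
  obtain p where "p \<in> G" "f (1\<^sub>m n) = p * (1\<^sub>m n - 1\<^sub>m n)" using springer_factor[OF f G_one] by blast
  moreover have "1\<^sub>m n - 1\<^sub>m n = (0\<^sub>m n n :: 'a mat)" by (intro eq_matI) auto
  ultimately show ?thesis by simp
qed

section \<open>The polarization attached to one functional\<close>

context
  fixes \<nu> assumes \<nu>: "\<nu> \<in> D"
begin

text \<open>By \<open>act_h\<close>, \<open>E (a * x)\<close> is the factor by which the element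
  \<open>1 + a\<close> of \<open>H\<close> changes \<open>pr \<nu> x\<close>. Passing to
  \<open>y - dag y\<close> makes the functional applicable to all of \<open>A\<close>.\<close>

definition E :: "'a mat \<Rightarrow> complex" where "E y = \<theta> (\<nu> (y - dag y))"

text \<open>The annihilator of the half ideal under \<open>E (a * x)\<close>. It is stable under
  left multiplication by \<open>A\<close> and \<open>G\<close>, because the half ideal is stable
  under right multiplication.\<close>

definition J :: "'a mat set" where "J = {x \<in> A. \<forall>a\<in>\<h>. E (a * x) = 1}"

lemma E_add: assumes "x \<in> A" "y \<in> A" shows "E (x + y) = E x * E y"
proof -
  have "x + y - dag (x + y) = (x - dag x) + (y - dag y)"
    using assms A_C[OF dag_A[OF assms(1)]] A_C[OF dag_A[OF assms(2)]] A_C[OF assms(1)] A_C[OF assms(2)]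
    by (simp only: dag_add) (intro eq_matI, auto)
  then show ?thesis using \<nu> assms by (simp add: E_def D_add skew_V \<theta>_add)
qed

lemma E_nonzero: "x \<in> A \<Longrightarrow> E x \<noteq> 0" using \<nu> by (simp add: E_def skew_V \<theta>_nonzero)

lemma E_zero: "E (0\<^sub>m n n) = 1"
  using E_add[of "0\<^sub>m n n" "0\<^sub>m n n"] E_nonzero[of "0\<^sub>m n n"] by simp

lemma E_uminus: assumes "x \<in> A" shows "E (- x) = inverse (E x)"
proof -
  have "E x * E (- x) = 1" using E_add[of x "- x"] assms by (simp add: add_uminus_self E_zero)
  then show ?thesis using inverse_unique by metis
qed

lemma E_dag: assumes x: "x \<in> A" shows "E (dag x) = inverse (E x)"
proof -
  have "dag x - dag (dag x) = - (x - dag x)"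
    using x A_C[OF dag_A[OF x]] A_C[OF x] by (simp only: dag_dag) (intro eq_matI, auto)
  then show ?thesis using \<nu> x by (simp add: E_def D_uminus skew_V \<theta>_uminus)
qed

lemma J_A [simp]: "x \<in> J \<Longrightarrow> x \<in> A" and J_E: "x \<in> J \<Longrightarrow> a \<in> \<h> \<Longrightarrow> E (a * x) = 1"
  and J_I: "x \<in> A \<Longrightarrow> (\<And>a. a \<in> \<h> \<Longrightarrow> E (a * x) = 1) \<Longrightarrow> x \<in> J"
  unfolding J_def by auto

lemma J_zero: "0\<^sub>m n n \<in> J"
  by (rule J_I) (simp_all add: E_zero)

lemma J_add: "x \<in> J \<Longrightarrow> y \<in> J \<Longrightarrow> x + y \<in> J"
  by (rule J_I) (simp_all add: mat_algebra E_add J_E)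

lemma J_uminus: "x \<in> J \<Longrightarrow> - x \<in> J"
  by (rule J_I) (simp_all add: E_uminus J_E)

lemma J_mult_A: assumes "x \<in> J" "y \<in> A" shows "y * x \<in> J"
proof (rule J_I)
  show "E (a * (y * x)) = 1" if "a \<in> \<h>" for a
    using J_E[OF assms(1), of "a * y"] that assms by (simp add: mat_algebra)
qed (use assms in simp)

lemma J_mult_G: assumes "x \<in> J" "g \<in> G" shows "g * x \<in> J"
proof (rule J_I)
  show "E (a * (g * x)) = 1" if "a \<in> \<h>" for a
    using J_E[OF assms(1), of "a * g"] that assms by (simp add: mat_algebra)
qed (use assms in simp)

lemma J_mult_G_iff: assumes "x \<in> A" "g \<in> G" shows "g * x \<in> J \<longleftrightarrow> x \<in> J"
  using J_mult_G[of x g] J_mult_G[of "g * x" "iv g"] assms by auto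

text \<open>The product is cut at its middle index. The part \<open>x - low x\<close> lies in the
  half ideal and pairs trivially with \<open>y\<close>. In the other part \<open>dag\<close> moves
  the top rows of \<open>y\<close> into the half ideal, and \<open>1 + x \<in> U\<close> expresses
  \<open>dag x\<close> as a left multiple of \<open>x\<close>, which lies in
  \<open>J\<close>.\<close>

lemma E_J_mult:
  assumes x: "x \<in> J" and y: "y \<in> J" and u: "1\<^sub>m n + x \<in> U"
  shows "E (x * y) = 1"
proof -
  have xA: "x \<in> A" and yA: "y \<in> A" using x y by simp_all
  define t where "t = top_rows y"
  have t: "t \<in> A" "dag t \<in> \<h>" using yA by (simp_all add: t_def dag_top_rows_h)
  let ?u = "1\<^sub>m n + x"
  have uG: "?u \<in> G" using xA by simp
  have dx: "dag x = - (iv ?u * x)"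
  proof -
    have "1\<^sub>m n + dag x = iv ?u" using U_gd[OF u] xA by (simp add: gd_one_plus)
    then have "dag x = iv ?u - 1\<^sub>m n" using one_plus_minus_one[OF A_C[OF dag_A[OF xA]]] by simp
    also have "\<dots> = - (iv ?u * x)" using one_minus_iv[OF uG] xA by simp
    finally show ?thesis .
  qed
  have "dag (x * t) = - ((dag t * iv ?u) * x)"
    using xA t uG by (simp add: dag_mult dx mat_algebra)
  moreover have "E ((dag t * iv ?u) * x) = 1" using t uG by (intro J_E[OF x]) simp
  ultimately have "E (dag (x * t)) = 1" using t uG xA by (simp add: E_uminus)
  then have 1: "E (x * t) = 1" using E_dag[of "x * t"] xA t by simp
  have 2: "E ((x - low x) * y) = 1" by (rule J_E[OF y minus_low_h[OF xA]])
  have "E (x * y) = E ((x - low x) * y) * E (x * t)"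
    unfolding t_def by (subst mult_split[OF xA yA], rule E_add) (use xA yA in simp_all)
  then show ?thesis using 1 2 by simp
qed

definition L :: "'a mat set" where "L = {v \<in> U. v - 1\<^sub>m n \<in> J}"

definition \<phi> :: "'a mat \<Rightarrow> complex" where "\<phi> v = E (half (v - 1\<^sub>m n))"

lemma L_U: "v \<in> L \<Longrightarrow> v \<in> U" and L_J: "v \<in> L \<Longrightarrow> v - 1\<^sub>m n \<in> J" and L_I: "v \<in> U \<Longrightarrow> v - 1\<^sub>m n \<in> J \<Longrightarrow> v \<in> L"
  by (simp_all add: L_def)

lemma L_G: "v \<in> L \<Longrightarrow> v \<in> G" using L_U by simp

lemma mult_minus_one:
  assumes "v \<in> G" "w \<in> G"
  shows "v * w - 1\<^sub>m n = (v - 1\<^sub>m n) + (w - 1\<^sub>m n) + (v - 1\<^sub>m n) * (w - 1\<^sub>m n)"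
  using assms by (simp add: mat_algebra, intro eq_matI) auto

lemma subgroup_L: "subgroup L P"
proof (rule P.subgroupI)
  show "L \<subseteq> G" using L_G by blast
  have "1\<^sub>m n - 1\<^sub>m n = (0\<^sub>m n n :: 'a mat)" by (intro eq_matI) auto
  then have "1\<^sub>m n - 1\<^sub>m n \<in> J" using J_zero by (simp only:)
  then have "1\<^sub>m n \<in> L" using subgroup.one_closed[OF subgroup_U] by (intro L_I) simp_all
  then show "L \<noteq> {}" by blast
  fix v assume v: "v \<in> L"
  show "iv v \<in> L"
  proof (rule L_I)
    show "iv v \<in> U" using subgroup.m_inv_closed[OF subgroup_U L_U[OF v]] .
    show "iv v - 1\<^sub>m n \<in> J"
      unfolding one_minus_iv[OF L_G[OF v]] using L_J[OF v] L_G[OF v] by (intro J_uminus J_mult_G) simp_all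
  qed
  fix w assume w: "w \<in> L"
  show "v \<otimes>\<^bsub>P\<^esub> w \<in> L"
  proof (rule L_I)
    show "v \<otimes>\<^bsub>P\<^esub> w \<in> U" using subgroup.m_closed[OF subgroup_U L_U[OF v] L_U[OF w]] .
    show "v \<otimes>\<^bsub>P\<^esub> w - 1\<^sub>m n \<in> J"
      using mult_minus_one[OF L_G[OF v] L_G[OF w]] L_J[OF v] L_J[OF w] by (simp add: J_add J_mult_A)
  qed
qed

lemma \<phi>_mult: assumes v: "v \<in> L" and w: "w \<in> L" shows "\<phi> (v * w) = \<phi> v * \<phi> w"
proof -
  define x where "x = v - 1\<^sub>m n"
  define y where "y = w - 1\<^sub>m n"
  have x: "x \<in> J" and y: "y \<in> J" using L_J v w by (simp_all add: x_def y_def)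
  have xA: "x \<in> A" and yA: "y \<in> A" using x y by simp_all
  have xu: "1\<^sub>m n + x \<in> U" using L_U[OF v] G_eq[OF G_C[OF L_G[OF v]]] by (simp add: x_def)
  have "E (x * y) = 1" by (rule E_J_mult[OF x y xu])
  \<comment> \<open>Halving preserves \<open>J\<close>, since the factor 1/2 can be moved to the
    element of the half ideal. This puts half of the quadratic term within reach of
    \<open>E_J_mult\<close>.\<close>
  have hJ: "half z \<in> J" if z: "z \<in> J" for z
  proof (rule J_I)
    fix a assume a: "a \<in> \<h>"
    have "a * half z = half a * z" using a z by (simp add: mat_algebra)
    then show "E (a * half z) = 1" using J_E[OF z, of "half a"] a by simp
  qed (use z in simp)
  have "E (x * half y) = 1" by (rule E_J_mult[OF x hJ[OF y] xu])
  then have xy: "E (half (x * y)) = 1" using xA yA by (simp add: mat_algebra)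
  have "\<phi> (v * w) = E (half x + half y + half (x * y))"
    unfolding \<phi>_def mult_minus_one[OF L_G[OF v] L_G[OF w]] x_def[symmetric] y_def[symmetric]
    using xA yA by (simp add: add_smult_distrib_left_mat[of _ n n])
  also have "\<dots> = E (half x) * E (half y) * E (half (x * y))" using xA yA by (simp add: E_add)
  finally show ?thesis using xy by (simp add: \<phi>_def x_def y_def)
qed

lemma \<phi>_nonzero: "v \<in> L \<Longrightarrow> \<phi> v \<noteq> 0"
  using L_J J_A by (simp add: \<phi>_def E_nonzero)

abbreviation "orbH \<equiv> orbit (P\<lparr>carrier := H\<rparr>) dact \<nu>"

text \<open>Orbit counting replaces the orbit by \<open>H\<close>, and \<open>act_h\<close> turns
  the sum over \<open>H\<close> into a sum over the half ideal of the additive character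
  \<open>a \<mapsto> E (a * x)\<close>, which is trivial exactly when \<open>x\<close> lies in
  \<open>J\<close>.\<close>

lemma sum_orbit_H:
  assumes x: "x \<in> V"
  shows "(\<Sum>\<mu>\<in>orbH. pr \<mu> x) = of_nat (card orbH) * (if x \<in> J then pr \<nu> x else 0)"
proof -
  interpret HD: finite_action "P\<lparr>carrier := H\<rparr>" D dact
    by (rule finite_action.subgroup_action[OF action_D subgroup_H])
  have inj: "inj_on (\<lambda>a. 1\<^sub>m n + a) \<h>"
  proof (rule inj_onI)
    fix a b assume ab: "a \<in> \<h>" "b \<in> \<h>" and e: "1\<^sub>m n + a = 1\<^sub>m n + b"
    show "a = b"
      using arg_cong[OF e, of "\<lambda>m. m - 1\<^sub>m n"]
      unfolding one_plus_minus_one[OF A_C[OF h_A[OF ab(1)]]] one_plus_minus_one[OF A_C[OF h_A[OF ab(2)]]] .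
  qed
  have cardH: "card H = card \<h>" unfolding H_eq by (rule card_image[OF inj])
  have h0: "of_nat (card \<h>) \<noteq> (0 :: complex)" using finite_h h_zero by (metis card_0_eq empty_iff of_nat_eq_0_iff)
  have average: "of_nat (card orbH) * (\<Sum>h\<in>H. pr (dact h \<nu>) x) = of_nat (card \<h>) * (\<Sum>\<mu>\<in>orbH. pr \<mu> x)"
    using HD.sum_action[OF \<nu>, of "\<lambda>\<mu>. pr \<mu> x"] by (simp add: cardH)
  have dual: "(\<Sum>h\<in>H. pr (dact h \<nu>) x) = (\<Sum>h\<in>H. pr \<nu> (act h x))"
  proof -
    have "(\<Sum>h\<in>H. pr (dact h \<nu>) x) = (\<Sum>h\<in>H. pr \<nu> (act (inv\<^bsub>P\<lparr>carrier := H\<rparr>\<^esub> h) x))"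
      using x by (intro sum.cong refl) (simp add: dact_apply P.m_inv_consistent[OF subgroup_H])
    also have "\<dots> = (\<Sum>h\<in>H. pr \<nu> (act h x))"
      using HD.sum_inv[of "\<lambda>h. pr \<nu> (act h x)"] by simp
    finally show ?thesis .
  qed
  have linear: "(\<Sum>h\<in>H. pr \<nu> (act h x)) = (\<Sum>a\<in>\<h>. pr \<nu> x * E (a * x))"
    unfolding H_eq sum.reindex[OF inj] o_def
    by (rule sum.cong[OF refl]) (use \<nu> x in \<open>simp add: act_h D_add skew_V E_def \<theta>_add\<close>)
  have sumE: "(\<Sum>a\<in>\<h>. E (a * x)) = (if x \<in> J then of_nat (card \<h>) else 0)"
  proof (cases "x \<in> J")
    case True
    then show ?thesis by (simp add: J_E)
  next
    case False
    then obtain b where b: "b \<in> \<h>" "E (b * x) \<noteq> 1" using J_I x V_A by blast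
    have "(\<Sum>a\<in>\<h>. E (a * x)) = 0"
    proof (rule sum_eq_zero_by_translation[where \<tau> = "\<lambda>a. a + b"])
      have C: "a + b - b = a" "a - b + b = a" if "a \<in> \<h>" for a
      proof -
        have "a \<in> C" "b \<in> C" using that b by simp_all
        then show "a + b - b = a" "a - b + b = a" by (auto intro!: eq_matI)
      qed
      show "bij_betw (\<lambda>a. a + b) \<h> \<h>"
        by (rule bij_betw_byWitness[where f' = "\<lambda>a. a - b"]) (use b C in auto)
      show "E ((a + b) * x) = E (b * x) * E (a * x)" if "a \<in> \<h>" for a
        using that b x by (simp add: mat_algebra E_add mult.commute)
    qed (use b in simp)
    then show ?thesis using False by simp
  qed
  have "of_nat (card orbH) * (pr \<nu> x * (if x \<in> J then of_nat (card \<h>) else 0))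
    = of_nat (card \<h>) * (\<Sum>\<mu>\<in>orbH. pr \<mu> x)"
    using average unfolding dual linear sum_distrib_left[symmetric] sumE .
  then show ?thesis using h0 by (cases "x \<in> J") simp_all
qed

text \<open>Correlating the orbit sum with \<nu> over \<open>V\<close> gives \<open>card V\<close>
  by orthogonality, and the orbit size times the number of skew elements in \<open>J\<close> by
  \<open>sum_orbit_H\<close>. As \<open>f v\<close> is a unit times \<open>v - 1\<close>, the
  bijection \<open>f\<close> matches those elements with \<open>L\<close>.\<close>

lemma card_orbH_L: "card orbH * card L = card U"
proof -
  interpret HD: finite_action "P\<lparr>carrier := H\<rparr>" D dact
    by (rule finite_action.subgroup_action[OF action_D subgroup_H])
  have "(of_nat (card V) :: complex) = (\<Sum>\<mu>\<in>orbH. of_nat (card V) * of_bool (\<mu> = \<nu>))"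
    using HD.self_in_orbit[OF \<nu>] HD.finite_orbit[OF \<nu>]
    by (simp add: of_bool_def if_distrib[of "\<lambda>x. _ * x"] cong: if_cong)
  also have "\<dots> = (\<Sum>\<mu>\<in>orbH. \<Sum>x\<in>V. pr \<mu> x / pr \<nu> x)"
    by (rule sum.cong[OF refl], rule sum_pr_V[symmetric]) (use HD.orbit_subset[OF \<nu>] \<nu> in auto)
  also have "\<dots> = (\<Sum>x\<in>V. (\<Sum>\<mu>\<in>orbH. pr \<mu> x) / pr \<nu> x)"
    by (subst sum.swap) (simp add: sum_divide_distrib)
  also have "\<dots> = (\<Sum>x\<in>V. of_nat (card orbH) * of_bool (x \<in> J))"
    by (rule sum.cong[OF refl]) (use \<nu> in \<open>simp add: sum_orbit_H \<theta>_nonzero\<close>)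
  also have "\<dots> = of_nat (card orbH) * of_nat (card {x \<in> V. x \<in> J})"
    by (rule sum_mult_of_bool[OF finite_V])
  also have "card {x \<in> V. x \<in> J} = card L"
  proof -
    have iff: "f v \<in> J \<longleftrightarrow> v - 1\<^sub>m n \<in> J" if v: "v \<in> U" for v
    proof -
      obtain p where "p \<in> G" "f v = p * (v - 1\<^sub>m n)" using springer_factor[OF f U_G[OF v]] by blast
      then show ?thesis using J_mult_G_iff[of "v - 1\<^sub>m n" p] v by simp
    qed
    have "f ` L = {x \<in> V. x \<in> J}"
    proof
      show "f ` L \<subseteq> {x \<in> V. x \<in> J}" using iff L_U L_J f_V by auto
      show "{x \<in> V. x \<in> J} \<subseteq> f ` L"
      proof
        fix x assume x: "x \<in> {x \<in> V. x \<in> J}"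
        then obtain v where v: "v \<in> U" "x = f v" using bij_f by (auto simp: bij_betw_def)
        then have "v \<in> L" using x iff[OF v(1)] by (intro L_I) simp_all
        then show "x \<in> f ` L" using v by blast
      qed
    qed
    moreover have "inj_on f L" using bij_f L_U inj_on_subset[of f U L] by (auto simp: bij_betw_def)
    ultimately show ?thesis by (metis card_image)
  qed
  finally have "of_nat (card V) = (of_nat (card orbH * card L) :: complex)" by simp
  then show ?thesis using bij_betw_same_card[OF bij_f] by (simp only: of_nat_eq_iff)
qed

lemma sum_orbit_H_skew_part:
  assumes v: "v \<in> U"
  shows "(\<Sum>\<mu>\<in>orbH. pr \<mu> (skew_part v)) = of_nat (card orbH) * (if v \<in> L then \<phi> v else 0)"
proof -
  have vG: "v \<in> G" using v by simp
  obtain p where "p \<in> G" "skew_part v = p * (v - 1\<^sub>m n)" using skew_part_factor[OF vG] by blast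
  then have "skew_part v \<in> J \<longleftrightarrow> v \<in> L"
    using J_mult_G_iff[of "v - 1\<^sub>m n" p] v by (simp add: L_def)
  moreover have "pr \<nu> (skew_part v) = \<phi> v"
  proof -
    have D: "dag (v - 1\<^sub>m n) \<in> C" using vG by simp
    have "iv v = 1\<^sub>m n + dag (v - 1\<^sub>m n)" using U_gd[OF v] by (simp add: group_dag_def)
    then have "skew_part v = half (v - 1\<^sub>m n) - half (dag (v - 1\<^sub>m n))"
      unfolding skew_part_def using D vG by (simp only:) (intro eq_matI, auto simp: right_diff_distrib distrib_left)
    then show ?thesis using vG by (simp add: \<phi>_def E_def dag_half)
  qed
  ultimately show ?thesis using sum_orbit_H[OF skew_part_V[OF v]] by simp
qed

lemma polarization:
  "\<exists>L \<phi>. subgroup L (P\<lparr>carrier := U\<rparr>) \<and>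
      (\<forall>x\<in>L. \<forall>y\<in>L. \<phi> (x \<otimes>\<^bsub>P\<^esub> y) = \<phi> x * \<phi> y) \<and> (\<forall>x\<in>L. \<phi> x \<noteq> 0) \<and>
      card orbH * card L = card U \<and>
      (\<forall>v\<in>U. (\<Sum>\<mu>\<in>orbH. pr \<mu> (skew_part v)) = of_nat (card orbH) * (if v \<in> L then \<phi> v else 0))"
proof (intro exI[of _ L] exI[of _ \<phi>] conjI ballI)
  show "subgroup L (P\<lparr>carrier := U\<rparr>)"
    by (rule P.subgroup_incl[OF subgroup_L subgroup_U]) (use L_U in blast)
qed (simp_all add: \<phi>_mult \<phi>_nonzero card_orbH_L sum_orbit_H_skew_part)

end

section \<open>Specialization of the abstract theory and comparison of choices\<close>

sublocale orbit_character_theory P V act D dact U H pr f skew_part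
proof (intro orbit_character_theory.intro orbit_character_theory_axioms.intro group_P action_V action_D
    subgroup_U normal_H bij_f card_V_D sum_pr_V sum_pr_D polarization)
  show "pr (dact g \<nu>) x = pr \<nu> (act (iv g) x)" if "x \<in> V" for g \<nu> x using that by (simp add: dact_apply)
  show "pr \<nu> (f \<one>\<^bsub>P\<^esub>) = 1" if "\<nu> \<in> D" for \<nu> using that by (simp add: f_one D_zero)
  show "skew_part v \<in> V" if "v \<in> U" for v using that by (rule skew_part_V)
  show "f (u \<otimes>\<^bsub>P\<^esub> v \<otimes>\<^bsub>P\<^esub> iv u) = act u (f v)" if "u \<in> U" "v \<in> U" for u v
    using springer_conj[OF f U_G[OF that(1)] U_G[OF that(2)]] that(1) by (simp add: act_U)
  show "skew_part (u \<otimes>\<^bsub>P\<^esub> v \<otimes>\<^bsub>P\<^esub> iv u) = act u (skew_part v)" if "u \<in> U" "v \<in> U" for u v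
    using skew_part_conj[OF U_G[OF that(1)] U_G[OF that(2)]] that(1) by (simp add: act_U)
  show "f v \<in> orbit P act (skew_part v)" if "v \<in> U" for v by (rule springer_orbit[OF f that])
  show "pr \<nu> (skew_part (iv v)) = inverse (pr \<nu> (skew_part v))" if "\<nu> \<in> D" "v \<in> U" for \<nu> v
    using that by (simp add: skew_part_iv D_uminus \<theta>_uminus)
  show "\<exists>h\<in>H. \<exists>u\<in>U. g = h \<otimes>\<^bsub>P\<^esub> u" if "g \<in> G" for g using factorization[OF that] by simp
qed

lemma supercharacter_eq: "supercharacter n r dag f \<theta> = \<chi>"
  by (intro ext) (simp add: supercharacter_def \<chi>_def half_group_eq[symmetric])

lemma superclass_eq: "superclass n r dag f = \<kappa>"
  by (intro ext) (simp add: superclass_def \<kappa>_def)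

lemma supercharacters_eq: "supercharacters F n r dag f \<theta> = \<chi> ` D"
  by (simp add: supercharacters_def supercharacter_eq)

lemma superclasses_eq: "superclasses n r dag f = \<kappa> ` U"
  by (simp add: superclasses_def superclass_eq)

lemma supercharacter_theory_dag_group:
  "supercharacter_theory (dag_group n r dag) (superclasses n r dag f) (supercharacters F n r dag f \<theta>)"
  using supercharacter_theory by (simp only: dag_group_eq[symmetric] supercharacters_eq superclasses_eq)

lemma is_character_supercharacter:
  "\<nu> \<in> D \<Longrightarrow> is_character (dag_group n r dag) (supercharacter n r dag f \<theta> \<nu>)"
  using is_character_\<chi> by (simp only: dag_group_eq[symmetric] supercharacter_eq)

text \<open>Written without \<open>f\<close> on the right, so that superclasses for two Springer
  morphisms can be compared.\<close>

lemma superclass_skew_part: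
  assumes u: "u \<in> U"
  shows "superclass n r dag f u = {v \<in> U. orbit P act (skew_part v) = orbit P act (skew_part u)}"
proof -
  have o: "orbit P act (f v) = orbit P act (skew_part v)" if "v \<in> U" for v
    using V.orbit_eq[OF c_closed[OF that] f_orbit_c[OF that]] .
  have "f v \<in> orbit P act (f u) \<longleftrightarrow> orbit P act (skew_part v) = orbit P act (skew_part u)" if v: "v \<in> U" for v
    using V.orbit_eq_iff[OF f_closed[OF u] f_closed[OF v]] o[OF u] o[OF v] by simp
  then show ?thesis by (auto simp: superclass_def)
qed

lemma supercharacter_skew_part:
  "\<nu> \<in> D \<Longrightarrow> supercharacter n r dag f \<theta> \<nu> = (\<lambda>v\<in>U. of_nat (card (orbit (half_group n r) dact \<nu>)) /
    of_nat (card (orbit P dact \<nu>)) * (\<Sum>\<mu>\<in>orbit P dact \<nu>. \<theta> (\<mu> (skew_part v))))"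
  using \<chi>_c by (intro ext) (auto simp: supercharacter_eq half_group_eq[symmetric] \<chi>_def)

end

text \<open>Scaling commutes with the dual action and is injective since \<open>k\<close> is
  nonzero. The subgroup \<open>K\<close> is general so that one statement serves both the
  \<open>G\<close>-orbit and the \<open>H\<close>-orbit in the prefactor.\<close>

lemma (in dag_pattern_character) orbit_scale:
  assumes k: "k \<in> F" "k \<noteq> 0" and \<nu>: "\<nu> \<in> D" and K: "subgroup K P"
  defines "s \<equiv> \<lambda>\<mu>. \<lambda>x\<in>V. k * \<mu> x"
  shows "inj_on s (orbit (P\<lparr>carrier := K\<rparr>) dact \<nu>)"
    and "orbit (P\<lparr>carrier := K\<rparr>) dact (s \<nu>) = s ` orbit (P\<lparr>carrier := K\<rparr>) dact \<nu>"
proof -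
  have KG: "K \<subseteq> G" by (rule subgroup.subset[OF K])
  show "inj_on s (orbit (P\<lparr>carrier := K\<rparr>) dact \<nu>)"
  proof (rule inj_onI)
    fix \<mu> \<mu>' assume "\<mu> \<in> orbit (P\<lparr>carrier := K\<rparr>) dact \<nu>" "\<mu>' \<in> orbit (P\<lparr>carrier := K\<rparr>) dact \<nu>" and e: "s \<mu> = s \<mu>'"
    then have D: "\<mu> \<in> D" "\<mu>' \<in> D" using \<nu> KG by (auto simp: orbit_subgroup)
    show "\<mu> = \<mu>'"
    proof
      fix x show "\<mu> x = \<mu>' x"
        using fun_cong[OF e, of x] k D_ext[OF D(1), of x] D_ext[OF D(2), of x] by (cases "x \<in> V") (simp_all add: s_def)
    qed
  qed
  have "dact g (s \<nu>) = s (dact g \<nu>)" if "g \<in> K" for g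
    using that KG by (intro ext) (auto simp: s_def dual_act_def)
  then show "orbit (P\<lparr>carrier := K\<rparr>) dact (s \<nu>) = s ` orbit (P\<lparr>carrier := K\<rparr>) dact \<nu>"
    by (simp add: orbit_subgroup image_image)
qed

text \<open>Replacing \<theta> by another character amounts to scaling the functional by a nonzero
  \<open>k\<close>, which maps the dual to itself and preserves both orbit sizes; \<open>f\<close>
  is removed by passing to the skew part. Exchanging the roles of the two choices gives the opposite
  inclusion.\<close>

lemma (in dag_pattern_springer) supercharacters_subset:
  assumes f': "springer_morphism F n r dag f'" and \<theta>': "nontrivial_additive_character F \<theta>'"
  shows "supercharacters F n r dag f' \<theta>' \<subseteq> supercharacters F n r dag f \<theta>"
proof -
  interpret S: dag_pattern_springer n r F dag \<theta>' f'
    by (intro dag_pattern_springer.intro dag_pattern_character.intro dag_pattern_axioms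
        dag_pattern_character_axioms.intro dag_pattern_springer_axioms.intro F_subfield \<theta>' f')
  obtain k where k: "k \<in> F" "k \<noteq> 0" "\<And>x. x \<in> F \<Longrightarrow> \<theta>' x = \<theta> (k * x)"
    using additive_character_exhaust[OF F_subfield \<theta> \<theta>'] by blast
  define s where "s \<mu> = (\<lambda>x\<in>V. k * \<mu> x)" for \<mu> :: "'a mat \<Rightarrow> 'a"
  have "supercharacter n r dag f' \<theta>' \<nu> = supercharacter n r dag f \<theta> (s \<nu>)" if \<nu>: "\<nu> \<in> D" for \<nu>
  proof -
    have s\<nu>: "s \<nu> \<in> D" using D_scale[OF k(1) \<nu>] by (simp add: s_def)
    have PG: "P\<lparr>carrier := G\<rparr> = P" by simp
    note sc = orbit_scale[OF k(1,2) \<nu>, folded s_def]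
    note scG = sc[OF P.subgroup_self, unfolded PG] and scH = sc[OF subgroup_H, folded half_group_eq]
    have "(\<Sum>\<mu>\<in>orbit P dact (s \<nu>). \<theta> (\<mu> (skew_part v))) = (\<Sum>\<mu>\<in>orbit P dact \<nu>. \<theta>' (\<mu> (skew_part v)))"
      if v: "v \<in> U" for v
      unfolding scG(2) sum.reindex[OF scG(1)] o_def
      by (rule sum.cong[OF refl]) (use v k D.orbit_subset[OF \<nu>] in \<open>auto simp: s_def\<close>)
    then show ?thesis
      unfolding supercharacter_skew_part[OF s\<nu>] S.supercharacter_skew_part[OF \<nu>]
      using card_image[OF scG(1)] card_image[OF scH(1)] scG(2) scH(2) by (intro restrict_ext) simp
  qed
  moreover have "s \<nu> \<in> D" if "\<nu> \<in> D" for \<nu> using D_scale[OF k(1) that] by (simp add: s_def)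
  ultimately show ?thesis by (auto simp: supercharacters_def)
qed

text \<open>Translation by 1 permutes the field without changing the sum of its elements, so the
  cardinality is 0 in the field; for an odd number and \<open>2 = 0\<close> this would mean
  \<open>1 = 0\<close>.\<close>

lemma odd_card_two_nonzero:
  assumes "odd (card (UNIV :: 'a::{field, finite} set))"
  shows "(2 :: 'a) \<noteq> 0"
proof
  assume two: "(2 :: 'a) = 0"
  have "(\<Sum>x\<in>(UNIV :: 'a set). x) = (\<Sum>x\<in>UNIV. x + 1)"
    by (rule sum.reindex_bij_witness[of _ "\<lambda>x. x + 1" "\<lambda>x. x - 1"]) auto
  then have "of_nat (card (UNIV :: 'a set)) = (0 :: 'a)" by (simp add: sum.distrib)
  moreover obtain b where "card (UNIV :: 'a set) = 2 * b + 1" using assms by (rule oddE)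
  ultimately show False using two by simp
qed

theorem theorem6p1:
  fixes p m q k n :: nat
    and F :: "'a::{field, finite} set"
    and r :: "nat rel"
    and dag f :: "'a mat \<Rightarrow> 'a mat"
    and \<theta> :: "'a \<Rightarrow> complex"
  assumes "prime p" and "odd p" and "0 < m" and "q = p ^ m" and "0 < k"
    and "card (UNIV :: 'a set) = q ^ k"
    and "subfield F class_ring" and "card F = q"
    and "pattern_order n r"
    and "anti_involution F (pattern_algebra n r) dag"
    and "\<And>\<alpha> i j. \<alpha> \<noteq> 0 \<Longrightarrow> i < n \<Longrightarrow> j < n \<Longrightarrow>
           (elementary_mat n i j :: 'a mat) \<in> pattern_algebra n r \<Longrightarrow>
           \<exists>\<beta>. \<beta> \<noteq> 0 \<and> dag (\<alpha> \<cdot>\<^sub>m elementary_mat n i j)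
                       = \<beta> \<cdot>\<^sub>m elementary_mat n (n - 1 - j) (n - 1 - i)"
    and "springer_morphism F n r dag f"
    and "nontrivial_additive_character F \<theta>"
  shows "(\<forall>\<nu> \<in> mat_dual F (dag_algebra n r dag).
            is_character (dag_group n r dag) (supercharacter n r dag f \<theta> \<nu>))
       \<and> supercharacter_theory (dag_group n r dag)
            (superclasses n r dag f) (supercharacters F n r dag f \<theta>)
       \<and> (\<forall>f' \<theta>'. springer_morphism F n r dag f' \<and> nontrivial_additive_character F \<theta>' \<longrightarrow>
            superclasses n r dag f' = superclasses n r dag f \<and>
            supercharacters F n r dag f' \<theta>' = supercharacters F n r dag f \<theta>)"
proof -
  have "odd (card (UNIV :: 'a set))" using assms(2,4,6) by simp
  then have two: "(2 :: 'a) \<noteq> 0" by (rule odd_card_two_nonzero)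
  \<comment> \<open>Stated for arbitrary \<open>f'\<close> and \<open>\<theta>'\<close>, as the
    whole theory is instantiated for both choices and then compared.\<close>
  have loc: "dag_pattern_springer n r F dag \<theta>' f'"
    if "springer_morphism F n r dag f'" "nontrivial_additive_character F \<theta>'" for f' \<theta>'
    by (intro dag_pattern_springer.intro dag_pattern_character.intro dag_pattern.intro
        dag_pattern_springer_axioms.intro dag_pattern_character_axioms.intro)
      (use that two assms(7,9-11) in auto)
  interpret S: dag_pattern_springer n r F dag \<theta> f by (rule loc[OF assms(12,13)])
  have "superclasses n r dag f' = superclasses n r dag f \<and>
      supercharacters F n r dag f' \<theta>' = supercharacters F n r dag f \<theta>"
    if f': "springer_morphism F n r dag f'" and \<theta>': "nontrivial_additive_character F \<theta>'" for f' \<theta>'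
  proof
    interpret S': dag_pattern_springer n r F dag \<theta>' f' by (rule loc[OF f' \<theta>'])
    show "superclasses n r dag f' = superclasses n r dag f"
      unfolding superclasses_def
      by (rule image_cong[OF refl]) (simp only: S.superclass_skew_part S'.superclass_skew_part)
    show "supercharacters F n r dag f' \<theta>' = supercharacters F n r dag f \<theta>"
      using S.supercharacters_subset[OF f' \<theta>'] S'.supercharacters_subset[OF assms(12,13)] by blast
  qed
  then show ?thesis
    using S.is_character_supercharacter S.supercharacter_theory_dag_group by blast
qed

end
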